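(* Let $\Omega\subset\mathbb{R}^d$ ($d\ge 1$) be a bounded, convex, open set, let $p$ satisfy $1<p<\infty$ if $d=1,2$ and $1<p<\frac{d+2}{d-2}$ if $d\ge 3$, and let $\gamma=\frac{p}{p-1}$. Let $u_0\in H^1_0(\Omega)$ be nontrivial and let $\{u_n\}_{n=0}^\infty$ be the sequence generated by $u_{n+1}=\mathcal{A}(u_n)$. Let $\phi\in H^1_0(\Omega)$ be a nontrivial solution of $-\phi+\Delta\phi+|\phi|^{p-1}\phi=0$ in $\Omega$, $\phi|_{\partial\Omega}=0$, which is the strong $H^1_0(\Omega)$ limit of a subsequence $\{u_{n_k}\}$. Assume that the operator $T_\phi:H^1_0(\Omega)\to H^1_0(\Omega)$, $T_\phi h=\mathcal{L}^{-1}(p|\phi|^{p-1}h)$, satisfies $\sigma(T_\phi)\setminus(-\infty,1)=\{p\}$ and that the eigenvalue $p$ of $T_\phi$ has algebraic multiplicity one. Then the entire sequence $\{u_n\}$ converges to $\phi$ in $H^1_0(\Omega)$.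
   Context: All functions are real valued and $\Omega$ is nonempty. $\langle\cdot,\cdot\rangle$ is the $L^2(\Omega)$ inner product (extended to the duality between $H^{-1}$ and $H^1_0$). $H^1_0(\Omega)$ carries the inner product $\langle f,g\rangle_{H^1}=\int_\Omega fg+\nabla f\cdot\nabla g$ with norm $\|\cdot\|_{H^1}$. $\mathcal{L}=I-\Delta:H^1_0(\Omega)\to H^{-1}(\Omega)$ (Dirichlet boundary conditions), and $\mathcal{L}^{-1}$ is its inverse. For $u\in H^1_0(\Omega)$, $u\ne0$, set $$M[u]=\frac{\langle\mathcal{L}u,u\rangle}{\langle|u|^{p-1}u,u\rangle}=\frac{\|u\|_{H^1}^2}{\|u\|_{L^{p+1}}^{p+1}},\qquad \mathcal{A}(u)=M[u]^\gamma\,\mathcal{L}^{-1}(|u|^{p-1}u).$$ The iterates are well defined, since $\mathcal{A}(u)\in H^1_0(\Omega)\setminus\{0\}$ whenever $u\in H^1_0(\Omega)\setminus\{0\}$. Solutions are understood in the weak sense: $\int_\Omega\nabla\phi\cdot\nabla v+\phi v-|\phi|^{p-1}\phi v=0$ for all $v\in H^1_0(\Omega)$. *)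

theory Defs
  imports "HOL-Analysis.Analysis"
begin

text \<open>
  Functions modulo equality almost everywhere. A function on \<open>\<Omega>\<close> is represented by its
  extension by zero, so that a single vector space serves all \<open>\<Omega>\<close>.
\<close>

quotient_type (overloaded) 'a aefun =
  "'a::euclidean_space \<Rightarrow> real" / "\<lambda>f g. AE x in lebesgue. f x = g x"
  by (intro equivpI reflpI sympI transpI) auto

instantiation aefun :: (euclidean_space) real_vector
begin

lift_definition zero_aefun :: "'a aefun" is "\<lambda>x. 0" .

lift_definition plus_aefun :: "'a aefun \<Rightarrow> 'a aefun \<Rightarrow> 'a aefun" is "\<lambda>f g x. f x + g x"
  by (erule (1) eventually_elim2) simp

lift_definition minus_aefun :: "'a aefun \<Rightarrow> 'a aefun \<Rightarrow> 'a aefun" is "\<lambda>f g x. f x - g x"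
  by (erule (1) eventually_elim2) simp

lift_definition uminus_aefun :: "'a aefun \<Rightarrow> 'a aefun" is "\<lambda>f x. - f x"
  by (erule eventually_mono) simp

lift_definition scaleR_aefun :: "real \<Rightarrow> 'a aefun \<Rightarrow> 'a aefun" is "\<lambda>c f x. c * f x"
  by (erule eventually_mono) simp

instance
  by standard (transfer; simp add: algebra_simps)+

end

primrec Ck :: "nat \<Rightarrow> ('a::euclidean_space \<Rightarrow> real) \<Rightarrow> bool" where
  "Ck 0 f \<longleftrightarrow> continuous_on UNIV f"
| "Ck (Suc k) f \<longleftrightarrow> (\<forall>x. f differentiable (at x)) \<and>
     (\<forall>b\<in>Basis. Ck k (\<lambda>x. frechet_derivative f (at x) b))"

definition test_functions :: "'a::euclidean_space set \<Rightarrow> ('a \<Rightarrow> real) set" where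
  "test_functions \<Omega> = {\<psi>. (\<forall>k. Ck k \<psi>) \<and>
     compact (closure {x. \<psi> x \<noteq> 0}) \<and> closure {x. \<psi> x \<noteq> 0} \<subseteq> \<Omega>}"

definition square_integrable ::
    "'a::euclidean_space set \<Rightarrow> ('a \<Rightarrow> 'b::euclidean_space) \<Rightarrow> bool" where
  "square_integrable \<Omega> f \<longleftrightarrow> f \<in> borel_measurable (lebesgue_on \<Omega>) \<and>
     integrable (lebesgue_on \<Omega>) (\<lambda>x. (norm (f x))\<^sup>2)"

definition is_weak_gradient ::
    "'a::euclidean_space set \<Rightarrow> 'a aefun \<Rightarrow> ('a \<Rightarrow> 'a) \<Rightarrow> bool" where
  "is_weak_gradient \<Omega> u G \<longleftrightarrow> square_integrable \<Omega> G \<and>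
     (\<forall>\<psi>\<in>test_functions \<Omega>. \<forall>b\<in>Basis.
        (\<integral>x. rep_aefun u x * frechet_derivative \<psi> (at x) b \<partial>lebesgue_on \<Omega>) =
        - (\<integral>x. (G x \<bullet> b) * \<psi> x \<partial>lebesgue_on \<Omega>))"

text \<open>The weak gradient is determined only almost everywhere; every use of it is under an integral.\<close>

definition weak_gradient :: "'a::euclidean_space set \<Rightarrow> 'a aefun \<Rightarrow> 'a \<Rightarrow> 'a" where
  "weak_gradient \<Omega> u = (SOME G. is_weak_gradient \<Omega> u G)"

definition H1 :: "'a::euclidean_space set \<Rightarrow> 'a aefun set" where
  "H1 \<Omega> = {u. (AE x in lebesgue. x \<notin> \<Omega> \<longrightarrow> rep_aefun u x = 0) \<and>
     square_integrable \<Omega> (rep_aefun u) \<and> (\<exists>G. is_weak_gradient \<Omega> u G)}"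

definition H1_inner :: "'a::euclidean_space set \<Rightarrow> 'a aefun \<Rightarrow> 'a aefun \<Rightarrow> real" where
  "H1_inner \<Omega> f g = (\<integral>x. rep_aefun f x * rep_aefun g x
     + weak_gradient \<Omega> f x \<bullet> weak_gradient \<Omega> g x \<partial>lebesgue_on \<Omega>)"

definition H1_norm :: "'a::euclidean_space set \<Rightarrow> 'a aefun \<Rightarrow> real" where
  "H1_norm \<Omega> u = sqrt (H1_inner \<Omega> u u)"

text \<open>The closure of the test functions in \<open>H\<^sup>1(\<Omega>)\<close>.\<close>

definition H10 :: "'a::euclidean_space set \<Rightarrow> 'a aefun set" where
  "H10 \<Omega> = {u \<in> H1 \<Omega>. \<forall>\<epsilon>>0. \<exists>\<psi>\<in>test_functions \<Omega>. H1_norm \<Omega> (u - abs_aefun \<psi>) < \<epsilon>}"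

text \<open>
  Elements of \<open>H\<^sup>-\<^sup>1(\<Omega>)\<close> are functionals on \<^term>\<open>H10 \<Omega>\<close>, made extensional by
  \<^const>\<open>restrict\<close> so that equality of functionals is equality in HOL. A function \<open>f\<close> acts by the
  \<open>L\<^sup>2\<close> pairing, and \<open>I - \<Delta>\<close> acts by \<open>v \<mapsto> \<integral> u v + \<nabla>u \<bullet> \<nabla>v\<close>.
\<close>

definition L2_functional ::
    "'a::euclidean_space set \<Rightarrow> ('a \<Rightarrow> real) \<Rightarrow> 'a aefun \<Rightarrow> real" where
  "L2_functional \<Omega> f = (\<lambda>v\<in>H10 \<Omega>. \<integral>x. f x * rep_aefun v x \<partial>lebesgue_on \<Omega>)"

definition L_op :: "'a::euclidean_space set \<Rightarrow> 'a aefun \<Rightarrow> 'a aefun \<Rightarrow> real" where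
  "L_op \<Omega> u = (\<lambda>v\<in>H10 \<Omega>. H1_inner \<Omega> u v)"

definition L_inv :: "'a::euclidean_space set \<Rightarrow> ('a aefun \<Rightarrow> real) \<Rightarrow> 'a aefun" where
  "L_inv \<Omega> = inv_into (H10 \<Omega>) (L_op \<Omega>)"

definition power_nl :: "real \<Rightarrow> 'a::euclidean_space aefun \<Rightarrow> 'a \<Rightarrow> real" where
  "power_nl p u x = \<bar>rep_aefun u x\<bar> powr (p - 1) * rep_aefun u x"

definition M_quot :: "'a::euclidean_space set \<Rightarrow> real \<Rightarrow> 'a aefun \<Rightarrow> real" where
  "M_quot \<Omega> p u = L_op \<Omega> u u / L2_functional \<Omega> (power_nl p u) u"

definition A_map :: "'a::euclidean_space set \<Rightarrow> real \<Rightarrow> real \<Rightarrow> 'a aefun \<Rightarrow> 'a aefun" where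
  "A_map \<Omega> p \<gamma> u = (M_quot \<Omega> p u powr \<gamma>) *\<^sub>R L_inv \<Omega> (L2_functional \<Omega> (power_nl p u))"

definition weak_solution :: "'a::euclidean_space set \<Rightarrow> real \<Rightarrow> 'a aefun \<Rightarrow> bool" where
  "weak_solution \<Omega> p \<phi> \<longleftrightarrow> \<phi> \<in> H10 \<Omega> \<and>
     (\<forall>v\<in>H10 \<Omega>. (\<integral>x. weak_gradient \<Omega> \<phi> x \<bullet> weak_gradient \<Omega> v x
        + rep_aefun \<phi> x * rep_aefun v x - power_nl p \<phi> x * rep_aefun v x \<partial>lebesgue_on \<Omega>) = 0)"

definition T_op :: "'a::euclidean_space set \<Rightarrow> real \<Rightarrow> 'a aefun \<Rightarrow> 'a aefun \<Rightarrow> 'a aefun" where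
  "T_op \<Omega> p \<phi> h =
     L_inv \<Omega> (L2_functional \<Omega> (\<lambda>x. p * \<bar>rep_aefun \<phi> x\<bar> powr (p - 1) * rep_aefun h x))"

definition bounded_operator ::
    "'a::euclidean_space set \<Rightarrow> ('a aefun \<Rightarrow> 'a aefun) \<Rightarrow> bool" where
  "bounded_operator \<Omega> S \<longleftrightarrow> S ` H10 \<Omega> \<subseteq> H10 \<Omega> \<and>
     (\<forall>f\<in>H10 \<Omega>. \<forall>g\<in>H10 \<Omega>. S (f + g) = S f + S g) \<and>
     (\<forall>c. \<forall>f\<in>H10 \<Omega>. S (c *\<^sub>R f) = c *\<^sub>R S f) \<and>
     (\<exists>C. \<forall>f\<in>H10 \<Omega>. H1_norm \<Omega> (S f) \<le> C * H1_norm \<Omega> f)"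

text \<open>
  The spectrum over the real Hilbert space \<^term>\<open>H10 \<Omega>\<close>: \<open>\<mu> I - T\<close> has no bounded two-sided
  inverse. The operator it is used for is self-adjoint, so complexifying would add no points.
\<close>

definition spectrum_H10 ::
    "'a::euclidean_space set \<Rightarrow> ('a aefun \<Rightarrow> 'a aefun) \<Rightarrow> real set" where
  "spectrum_H10 \<Omega> T = {\<mu>. \<not> (\<exists>S. bounded_operator \<Omega> S \<and>
     (\<forall>h\<in>H10 \<Omega>. S (\<mu> *\<^sub>R h - T h) = h \<and> \<mu> *\<^sub>R S h - T (S h) = h))}"

text \<open>
  Dimension of the generalized eigenspace; \<^const>\<open>dim\<close> is \<open>0\<close> on infinite-dimensional
  spaces, so the value \<open>1\<close> is unambiguous.
\<close>

definition algebraic_multiplicity ::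
    "'a::euclidean_space set \<Rightarrow> ('a aefun \<Rightarrow> 'a aefun) \<Rightarrow> real \<Rightarrow> nat" where
  "algebraic_multiplicity \<Omega> T \<mu> =
     dim {h \<in> H10 \<Omega>. \<exists>k. ((\<lambda>g. T g - \<mu> *\<^sub>R g) ^^ k) h = 0}"

end

theory Submission
  imports Defs "HOL-Computational_Algebra.Polynomial"
begin

text \<open>
Write \<open>K(u) = \<L>\<^sup>-\<^sup>1(\<bar>u\<bar>\<^sup>p\<^sup>-\<^sup>1 u)\<close>, so that \<open>\<A>(u) = M[u]\<^sup>\<gamma> K(u)\<close>. The solution \<open>\<phi>\<close> is a fixed point of \<open>K\<close>, and \<open>T = T\<^sub>\<phi>\<close> is the
derivative of \<open>K\<close> at \<open>\<phi>\<close>. It is self-adjoint and nonnegative on \<open>H\<^sup>1\<^sub>0(\<Omega>)\<close> and satisfies \<open>T \<phi> = p \<phi>\<close>, so \<open>K\<close>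
itself repels along \<open>\<phi>\<close>. The factor \<open>M[u]\<^sup>\<gamma>\<close> with \<open>\<gamma> = p / (p - 1)\<close> cancels exactly this expansion: the derivative of
\<open>\<A>\<close> at \<open>\<phi>\<close> is \<open>B = T - p P\<close>, where \<open>P\<close> is the orthogonal projection onto \<open>\<phi>\<close>
(\<open>normalized_iteration_derivative\<close>). The operator \<open>B\<close> kills \<open>\<phi>\<close> and agrees with \<open>T\<close> on the orthogonal complement,
where by hypothesis the spectrum of \<open>T\<close> stays below \<open>1\<close>. Hence \<open>B\<close> has norm less than \<open>1\<close>
(\<open>deflated_operator_contraction\<close>), and \<open>\<phi>\<close> attracts a whole neighbourhood of itself. Some iterate \<open>u (r k)\<close> lies in this
neighbourhood, and from then on the distance to \<open>\<phi>\<close> decays geometrically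
(\<open>contracting_derivative_imp_convergence\<close>).

The spectral step argues with approximate eigenvalues. The supremum of the numerical
range of \<open>B\<close> is an approximate eigenvalue, so it is below \<open>1\<close> or equal to \<open>p\<close>; the second case is excluded because an
isolated point at the edge of the spectrum is an eigenvalue (\<open>injective_gap_imp_coercive\<close>), while \<open>p\<close> is simple and used up by \<open>\<phi>\<close>.

The analytic work consists of three parts. Weak gradients are unique almost everywhere by
\<open>fundamental_lemma_calculus_of_variations\<close>, which makes \<open>H\<^sup>1\<^sub>0(\<Omega>)\<close> a Hilbert space and \<open>\<L>\<^sup>-\<^sup>1\<close> available through the Riesz theorem. The
embedding of \<open>H\<^sup>1\<^sub>0(\<Omega>)\<close> into \<open>L\<^sup>p\<^sup>+\<^sup>1(\<Omega>)\<close> (\<open>Sobolev_embedding\<close>) is obtained for test functions from the telescoping sum of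
their means over balls of radius \<open>2\<^sup>-\<^sup>k\<close>: subcriticality says precisely that the increments decay
geometrically in \<open>L\<^sup>p\<^sup>+\<^sup>1\<close>. Finally \<open>K\<close> is differentiable at \<open>\<phi>\<close> (\<open>solution_map_derivative\<close>) by a pointwise expansion of the
power and a trilinear estimate that follows from the embedding by scaling.
\<close>

section \<open>Hilbert spaces carried by a subspace\<close>

text \<open>
The discriminant criterion behind every Cauchy--Schwarz inequality below, for forms as well as for integrals.
\<close>

lemma quadratic_nonneg_imp_discriminant:
  fixes a b c :: real
  assumes q: "\<And>t. 0 \<le> a + 2 * b * t + c * t\<^sup>2" and c: "0 \<le> c"
  shows "b\<^sup>2 \<le> a * c"
proof (cases "c = 0")
  case True
  have "b = 0"
  proof (rule ccontr)
    assume "b \<noteq> 0"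
    then show False using q[of "- (a + 1) / (2 * b)"] True by simp
  qed
  then show ?thesis using True by simp
next
  case False
  then have "0 \<le> (a + 2 * b * (- b / c) + c * (- b / c)\<^sup>2) * c"
    using q[of "- b / c"] c by simp
  also have "\<dots> = a * c - b\<^sup>2" using False by (simp add: field_simps power2_eq_square)
  finally show ?thesis by simp
qed

lemma null_times_Bfun:
  fixes f g :: "'a \<Rightarrow> real"
  assumes "(f \<longlongrightarrow> 0) F" "Bfun g F"
  shows "((\<lambda>x. f x * g x) \<longlongrightarrow> 0) F"
  using bounded_bilinear.Zfun_prod_Bfun[OF bounded_bilinear_mult] assms by (simp add: tendsto_Zfun_iff)

text \<open>
\<open>H\<^sup>1\<^sub>0(\<Omega>)\<close> depends on the set \<open>\<Omega>\<close>, so it is a subspace of a fixed vector space rather than a type, and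
its inner product lives on a carrier. Definiteness is split off into a second locale because the form
\<open>\<langle>U x, y\<rangle>\<close> of a nonnegative operator \<open>U\<close> also obeys Cauchy--Schwarz, and this is the main tool of
the spectral arguments.
\<close>

locale psd_form =
  fixes H :: "'v::real_vector set" and ip :: "'v \<Rightarrow> 'v \<Rightarrow> real"
  assumes subspace_H: "subspace H"
    and ip_sym: "x \<in> H \<Longrightarrow> y \<in> H \<Longrightarrow> ip x y = ip y x"
    and ip_add_left: "x \<in> H \<Longrightarrow> y \<in> H \<Longrightarrow> z \<in> H \<Longrightarrow> ip (x + y) z = ip x z + ip y z"
    and ip_scale_left: "x \<in> H \<Longrightarrow> z \<in> H \<Longrightarrow> ip (c *\<^sub>R x) z = c * ip x z"
    and ip_nonneg: "x \<in> H \<Longrightarrow> 0 \<le> ip x x"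
begin

lemma H_closed [simp, intro]:
  "0 \<in> H" "x \<in> H \<Longrightarrow> y \<in> H \<Longrightarrow> x + y \<in> H" "x \<in> H \<Longrightarrow> c *\<^sub>R x \<in> H"
  "x \<in> H \<Longrightarrow> - x \<in> H" "x \<in> H \<Longrightarrow> y \<in> H \<Longrightarrow> x - y \<in> H"
  using subspace_H
  by (auto simp: subspace_0 subspace_add subspace_scale subspace_neg subspace_diff)

lemma ip_add_right: "x \<in> H \<Longrightarrow> y \<in> H \<Longrightarrow> z \<in> H \<Longrightarrow> ip z (x + y) = ip z x + ip z y"
  using ip_add_left[of x y z] by (simp add: ip_sym)

lemma ip_scale_right: "x \<in> H \<Longrightarrow> z \<in> H \<Longrightarrow> ip z (c *\<^sub>R x) = c * ip z x"
  using ip_scale_left[of x z c] by (simp add: ip_sym)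

lemma ip_minus_left: "x \<in> H \<Longrightarrow> z \<in> H \<Longrightarrow> ip (- x) z = - ip x z"
  using ip_scale_left[of x z "-1"] by simp

lemma ip_minus_right: "x \<in> H \<Longrightarrow> z \<in> H \<Longrightarrow> ip z (- x) = - ip z x"
  using ip_scale_right[of x z "-1"] by simp

lemma ip_diff_left: "x \<in> H \<Longrightarrow> y \<in> H \<Longrightarrow> z \<in> H \<Longrightarrow> ip (x - y) z = ip x z - ip y z"
  using ip_add_left[of x "- y" z] by (simp add: ip_minus_left)

lemma ip_diff_right: "x \<in> H \<Longrightarrow> y \<in> H \<Longrightarrow> z \<in> H \<Longrightarrow> ip z (x - y) = ip z x - ip z y"
  using ip_add_right[of x "- y" z] by (simp add: ip_minus_right)

lemma ip_zero_left [simp]: "z \<in> H \<Longrightarrow> ip 0 z = 0"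
  using ip_scale_left[of z z 0] by simp

lemma ip_zero_right [simp]: "z \<in> H \<Longrightarrow> ip z 0 = 0"
  using ip_scale_right[of z z 0] by simp

lemmas ip_simps = ip_add_left ip_add_right ip_scale_left ip_scale_right ip_minus_left
  ip_minus_right ip_diff_left ip_diff_right

lemma ip_Cauchy_Schwarz_square:
  assumes x: "x \<in> H" and y: "y \<in> H"
  shows "(ip x y)\<^sup>2 \<le> ip x x * ip y y"
proof (rule quadratic_nonneg_imp_discriminant)
  fix t :: real
  have "0 \<le> ip (x + t *\<^sub>R y) (x + t *\<^sub>R y)" using x y by (intro ip_nonneg) auto
  also have "\<dots> = ip x x + 2 * ip x y * t + ip y y * t\<^sup>2"
    using x y ip_sym[OF x y] by (simp add: ip_simps algebra_simps power2_eq_square)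
  finally show "0 \<le> ip x x + 2 * ip x y * t + ip y y * t\<^sup>2" .
qed (rule ip_nonneg[OF y])

definition nm :: "'v \<Rightarrow> real" where "nm x = sqrt (ip x x)"

lemma nm_nonneg [simp]: "x \<in> H \<Longrightarrow> 0 \<le> nm x"
  by (simp add: nm_def ip_nonneg)

lemma nm_square: "x \<in> H \<Longrightarrow> (nm x)\<^sup>2 = ip x x"
  by (simp add: nm_def ip_nonneg)

lemma nm_zero [simp]: "nm 0 = 0"
  by (simp add: nm_def)

lemma nm_scale: "x \<in> H \<Longrightarrow> nm (c *\<^sub>R x) = \<bar>c\<bar> * nm x"
  by (simp add: nm_def ip_simps real_sqrt_mult mult.assoc[symmetric])

lemma nm_minus: "x \<in> H \<Longrightarrow> nm (- x) = nm x"
  by (simp add: nm_def ip_simps)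

lemma nm_diff_commute: "x \<in> H \<Longrightarrow> y \<in> H \<Longrightarrow> nm (x - y) = nm (y - x)"
  using nm_minus[of "x - y"] by simp

lemma ip_Cauchy_Schwarz:
  assumes x: "x \<in> H" and y: "y \<in> H"
  shows "\<bar>ip x y\<bar> \<le> nm x * nm y"
proof (rule power2_le_imp_le)
  show "\<bar>ip x y\<bar>\<^sup>2 \<le> (nm x * nm y)\<^sup>2"
    using ip_Cauchy_Schwarz_square[OF x y] x y by (simp add: power_mult_distrib nm_square)
qed (use x y in simp)

lemma nm_triangle:
  assumes x: "x \<in> H" and y: "y \<in> H"
  shows "nm (x + y) \<le> nm x + nm y"
proof (rule power2_le_imp_le)
  have "(nm (x + y))\<^sup>2 = (nm x)\<^sup>2 + 2 * ip x y + (nm y)\<^sup>2"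
    using x y ip_sym[OF x y] by (simp add: nm_square ip_simps)
  also have "\<dots> \<le> (nm x + nm y)\<^sup>2"
    using ip_Cauchy_Schwarz[OF x y] by (simp add: power2_eq_square algebra_simps)
  finally show "(nm (x + y))\<^sup>2 \<le> (nm x + nm y)\<^sup>2" .
qed (use x y in simp)

lemma nm_triangle_diff:
  assumes x: "x \<in> H" and y: "y \<in> H"
  shows "nm (x - y) \<le> nm x + nm y"
  using nm_triangle[of x "- y"] x y by (simp add: nm_minus)

lemma tendsto_ip_left:
  assumes X: "\<And>n. X n \<in> H" and L: "L \<in> H" and lim: "(\<lambda>n. nm (X n - L)) \<longlonglongrightarrow> 0" and y: "y \<in> H"
  shows "(\<lambda>n. ip (X n) y) \<longlonglongrightarrow> ip L y"
proof -
  have "(\<lambda>n. ip (X n) y - ip L y) \<longlonglongrightarrow> 0"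
  proof (rule Lim_null_comparison)
    show "\<forall>\<^sub>F n in sequentially. norm (ip (X n) y - ip L y) \<le> nm (X n - L) * nm y"
      using ip_Cauchy_Schwarz[of "X _ - L" y] X L y
      by (intro always_eventually) (auto simp: ip_diff_left)
    show "(\<lambda>n. nm (X n - L) * nm y) \<longlonglongrightarrow> 0"
      using tendsto_mult_right[OF lim, of "nm y"] by simp
  qed
  then show ?thesis by (simp add: LIM_zero_iff)
qed

lemma tendsto_nm:
  assumes X: "\<And>n. X n \<in> H" and L: "L \<in> H" and lim: "(\<lambda>n. nm (X n - L)) \<longlonglongrightarrow> 0"
  shows "(\<lambda>n. nm (X n)) \<longlonglongrightarrow> nm L"
proof -
  have "(\<lambda>n. nm (X n) - nm L) \<longlonglongrightarrow> 0"
  proof (rule Lim_null_comparison[OF _ lim], intro always_eventually allI)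
    fix n
    show "norm (nm (X n) - nm L) \<le> nm (X n - L)"
      using nm_triangle[of "X n - L" L] nm_triangle[of "L - X n" "X n"] nm_diff_commute[of "X n" L] X[of n] L
      by auto
  qed
  then show ?thesis by (simp add: LIM_zero_iff)
qed

end

locale hilbert_subspace = psd_form H ip
  for H :: "'v::real_vector set" and ip :: "'v \<Rightarrow> 'v \<Rightarrow> real" +
  assumes ip_definite: "x \<in> H \<Longrightarrow> ip x x = 0 \<Longrightarrow> x = 0"
    and complete_H: "(\<And>n. X n \<in> H) \<Longrightarrow>
       (\<And>e. 0 < e \<Longrightarrow> \<exists>N. \<forall>m\<ge>N. \<forall>n\<ge>N. nm (X m - X n) < e) \<Longrightarrow>
       \<exists>L\<in>H. (\<lambda>n. nm (X n - L)) \<longlonglongrightarrow> 0"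
begin

lemma nm_eq_0: "x \<in> H \<Longrightarrow> nm x = 0 \<Longrightarrow> x = 0"
  using ip_definite[of x] ip_nonneg[of x] by (simp add: nm_def)

lemma nm_pos: "x \<in> H \<Longrightarrow> x \<noteq> 0 \<Longrightarrow> 0 < nm x"
  using nm_eq_0[of x] nm_nonneg[of x] by linarith

lemma ip_pos: "x \<in> H \<Longrightarrow> x \<noteq> 0 \<Longrightarrow> 0 < ip x x"
  using ip_definite[of x] ip_nonneg[of x] by linarith

text \<open>
A sequence in \<open>V\<close> that minimizes the distance to \<open>h\<close> is Cauchy by the parallelogram law, and its limit \<open>w\<close>
is the projection of \<open>h\<close> onto the closure of \<open>V\<close>. The sequence is part of the conclusion so that
estimates known on \<open>V\<close> can be carried over to \<open>w\<close>.
\<close>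

lemma orthogonal_projection_closure:
  assumes V: "subspace V" "V \<subseteq> H" and h: "h \<in> H"
  obtains v w where "\<And>n::nat. v n \<in> V" "w \<in> H" "(\<lambda>n. nm (v n - w)) \<longlonglongrightarrow> 0"
    "\<And>x. x \<in> V \<Longrightarrow> ip (h - w) x = 0"
proof -
  define D where "D = (\<lambda>v. ip (h - v) (h - v)) ` V"
  define d where "d = Inf D"
  have D0: "D \<noteq> {}" using subspace_0[OF V(1)] by (auto simp: D_def)
  have Dbd: "bdd_below D"
    by (rule bdd_belowI[of _ 0]) (use V h in \<open>auto simp: D_def intro!: ip_nonneg\<close>)
  have dle: "d \<le> ip (h - v) (h - v)" if "v \<in> V" for v
    unfolding d_def by (rule cInf_lower[OF _ Dbd]) (use that in \<open>auto simp: D_def\<close>)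
  have "\<exists>v\<in>V. ip (h - v) (h - v) < d + 1 / real (Suc n)" for n
    using cInf_lessD[OF D0, of "d + 1 / real (Suc n)"] by (auto simp: D_def d_def)
  then obtain v where v: "\<And>n. v n \<in> V" and vd: "\<And>n. ip (h - v n) (h - v n) < d + 1 / real (Suc n)"
    by metis
  have vH: "v n \<in> H" for n using v V by auto
  have par: "(nm (v m - v n))\<^sup>2 \<le> 2 / real (Suc m) + 2 / real (Suc n)" for m n
  proof -
    have "(1/2) *\<^sub>R (v m + v n) \<in> V" using v V(1) by (intro subspace_scale subspace_add) auto
    from dle[OF this] have "4 * d \<le> 4 * ip (h - (1/2) *\<^sub>R (v m + v n)) (h - (1/2) *\<^sub>R (v m + v n))" by simp
    also have "\<dots> = 2 * ip (h - v m) (h - v m) + 2 * ip (h - v n) (h - v n) - ip (v m - v n) (v m - v n)"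
      using vH h ip_sym[OF vH[of m] vH[of n]] ip_sym[OF vH[of m] h] ip_sym[OF vH[of n] h]
      by (simp add: ip_simps algebra_simps)
    finally show ?thesis using vd[of m] vd[of n] vH by (simp add: nm_square)
  qed
  have "\<exists>L\<in>H. (\<lambda>n. nm (v n - L)) \<longlonglongrightarrow> 0"
  proof (rule complete_H[OF vH])
    fix e :: real assume e: "0 < e"
    obtain N where N: "4 / e\<^sup>2 < real N" using reals_Archimedean2 by blast
    have Np: "0 < real N" using N e by (meson divide_pos_pos less_trans zero_less_numeral zero_less_power)
    have small: "2 / real (Suc n) < e\<^sup>2 / 2" if "N \<le> n" for n
    proof -
      have "4 < e\<^sup>2 * real N" using N e by (simp add: field_simps)
      also have "\<dots> \<le> e\<^sup>2 * real (Suc n)" using that by (intro mult_left_mono) auto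
      finally show ?thesis by (simp add: field_simps)
    qed
    show "\<exists>N. \<forall>m\<ge>N. \<forall>n\<ge>N. nm (v m - v n) < e"
    proof (intro exI[of _ N] allI impI)
      fix m n assume "N \<le> m" "N \<le> n"
      then have "(nm (v m - v n))\<^sup>2 < e\<^sup>2"
        using par[of m n] small[of m] small[of n] by linarith
      then show "nm (v m - v n) < e" using e by (auto intro: power2_less_imp_less)
    qed
  qed
  then obtain w where w: "w \<in> H" and lim: "(\<lambda>n. nm (v n - w)) \<longlonglongrightarrow> 0" by blast
  have "ip (h - w) x = 0" if x: "x \<in> V" for x
  proof -
    have xH: "x \<in> H" using x V by auto
    have "(- ip (h - w) x)\<^sup>2 \<le> 0 * ip x x"
    proof (rule quadratic_nonneg_imp_discriminant)
      fix t :: real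
      have "0 \<le> 1 / real (Suc n) + 2 * - (ip h x - ip (v n) x) * t + ip x x * t\<^sup>2" for n
      proof -
        have "d \<le> ip (h - (v n + t *\<^sub>R x)) (h - (v n + t *\<^sub>R x))"
          by (rule dle) (use v x V(1) in \<open>auto intro!: subspace_add subspace_scale\<close>)
        also have "\<dots> = ip (h - v n) (h - v n) + 2 * - (ip h x - ip (v n) x) * t + ip x x * t\<^sup>2"
          using vH[of n] h xH ip_sym[OF vH[of n] h] ip_sym[OF vH[of n] xH] ip_sym[OF h xH]
          by (simp add: ip_simps) (simp add: algebra_simps power2_eq_square)
        finally show ?thesis using vd[of n] by linarith
      qed
      moreover have "(\<lambda>n. 1 / real (Suc n) + 2 * - (ip h x - ip (v n) x) * t + ip x x * t\<^sup>2)
          \<longlonglongrightarrow> 0 + 2 * - (ip h x - ip w x) * t + ip x x * t\<^sup>2"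
        by (intro tendsto_intros tendsto_ip_left[OF vH w lim xH] LIMSEQ_Suc[OF lim_1_over_n])
      ultimately show "0 \<le> 0 + 2 * - ip (h - w) x * t + ip x x * t\<^sup>2"
        using w h xH by (intro LIMSEQ_le_const) (auto simp: ip_diff_left)
    qed (rule ip_nonneg[OF xH])
    then show ?thesis by simp
  qed
  then show thesis using that v w lim by blast
qed

text \<open>
The component \<open>z\<close> of a vector orthogonal to the kernel of \<open>F\<close> spans the orthogonal complement of that
kernel, so \<open>F\<close> is a multiple of \<open>\<langle>z, \<cdot>\<rangle>\<close>.
\<close>

lemma Riesz_representation:
  assumes add: "\<And>x y. x \<in> H \<Longrightarrow> y \<in> H \<Longrightarrow> F (x + y) = F x + F y"
    and scale: "\<And>c x. x \<in> H \<Longrightarrow> F (c *\<^sub>R x) = c * F x"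
    and bd: "\<And>x. x \<in> H \<Longrightarrow> \<bar>F x\<bar> \<le> C * nm x"
  obtains w where "w \<in> H" "\<And>v. v \<in> H \<Longrightarrow> ip w v = F v"
proof (cases "\<forall>x\<in>H. F x = 0")
  case True
  then show ?thesis using that[of 0] by auto
next
  case False
  then obtain h where h: "h \<in> H" and Fh: "F h \<noteq> 0" by auto
  define V where "V = {x\<in>H. F x = 0}"
  have F0: "F 0 = 0" using scale[of 0 0] by simp
  have V: "subspace V" "V \<subseteq> H"
    unfolding subspace_def V_def by (auto simp: add scale F0)
  obtain v w where v: "\<And>n::nat. v n \<in> V" and w: "w \<in> H" and lim: "(\<lambda>n. nm (v n - w)) \<longlonglongrightarrow> 0"
    and orth: "\<And>x. x \<in> V \<Longrightarrow> ip (h - w) x = 0"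
    using orthogonal_projection_closure[OF V h] by metis
  have diff: "F (x - y) = F x - F y" if "x \<in> H" "y \<in> H" for x y
    using add[of x "- y"] scale[of y "-1"] that by simp
  have "(\<lambda>n. F w) \<longlonglongrightarrow> 0"
  proof (rule Lim_null_comparison)
    show "\<forall>\<^sub>F n in sequentially. norm (F w) \<le> C * nm (v n - w)"
    proof (intro always_eventually allI)
      fix n
      have "F (v n - w) = - F w" using v[of n] w by (simp add: V_def diff)
      then show "norm (F w) \<le> C * nm (v n - w)" using bd[of "v n - w"] v[of n] w by (simp add: V_def)
    qed
    show "(\<lambda>n. C * nm (v n - w)) \<longlonglongrightarrow> 0" using tendsto_mult_left[OF lim, of C] by simp
  qed
  then have Fw: "F w = 0" by (simp add: LIMSEQ_const_iff)
  define z where "z = h - w"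
  have z: "z \<in> H" "F z \<noteq> 0" using h w Fh Fw by (auto simp: z_def diff)
  have zz: "ip z z \<noteq> 0" using ip_definite[OF z(1)] z(2) F0 by auto
  show ?thesis
  proof (rule that[of "(F z / ip z z) *\<^sub>R z"])
    fix x assume x: "x \<in> H"
    have "x - (F x / F z) *\<^sub>R z \<in> V" using x z by (auto simp: V_def diff scale)
    from orth[OF this] have "ip z x = F x / F z * ip z z"
      using x z by (simp add: z_def[symmetric] ip_simps)
    then show "ip ((F z / ip z z) *\<^sub>R z) x = F x" using x z zz by (simp add: ip_simps)
  qed (use z in auto)
qed

section \<open>Self-adjoint operators and spectral gaps\<close>

definition sa_op :: "('v \<Rightarrow> 'v) \<Rightarrow> bool" where
  "sa_op U \<longleftrightarrow> (\<forall>x\<in>H. U x \<in> H) \<and> (\<forall>x\<in>H. \<forall>y\<in>H. U (x + y) = U x + U y) \<and>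
     (\<forall>c. \<forall>x\<in>H. U (c *\<^sub>R x) = c *\<^sub>R U x) \<and> (\<forall>x\<in>H. \<forall>y\<in>H. ip (U x) y = ip x (U y)) \<and>
     (\<exists>C. \<forall>x\<in>H. nm (U x) \<le> C * nm x)"

lemma sa_opD:
  assumes "sa_op U"
  shows "x \<in> H \<Longrightarrow> U x \<in> H" "x \<in> H \<Longrightarrow> y \<in> H \<Longrightarrow> U (x + y) = U x + U y"
    "x \<in> H \<Longrightarrow> U (c *\<^sub>R x) = c *\<^sub>R U x" "x \<in> H \<Longrightarrow> y \<in> H \<Longrightarrow> ip (U x) y = ip x (U y)"
  using assms by (auto simp: sa_op_def)

lemma sa_op_diff:
  assumes "sa_op U" "x \<in> H" "y \<in> H"
  shows "U (x - y) = U x - U y"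
  using sa_opD(2)[OF assms(1), of x "- y"] sa_opD(3)[OF assms(1), of y "-1"] assms by simp

lemma sa_op_bound:
  assumes "sa_op U"
  obtains C where "0 < C" "\<And>x. x \<in> H \<Longrightarrow> nm (U x) \<le> C * nm x"
proof -
  obtain C where C: "\<And>x. x \<in> H \<Longrightarrow> nm (U x) \<le> C * nm x" using assms unfolding sa_op_def by metis
  have "nm (U x) \<le> max C 1 * nm x" if "x \<in> H" for x
    using C[OF that] mult_right_mono[of C "max C 1" "nm x"] that by auto
  then show thesis using that[of "max C 1"] by auto
qed

lemma sa_op_affine:
  assumes U: "sa_op U"
  shows "sa_op (\<lambda>x. a *\<^sub>R x + b *\<^sub>R U x)"
proof -
  obtain C where C: "0 < C" "\<And>x. x \<in> H \<Longrightarrow> nm (U x) \<le> C * nm x" using sa_op_bound[OF U] by metis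
  have "nm (a *\<^sub>R x + b *\<^sub>R U x) \<le> (\<bar>a\<bar> + \<bar>b\<bar> * C) * nm x" if x: "x \<in> H" for x
  proof -
    have "nm (a *\<^sub>R x + b *\<^sub>R U x) \<le> \<bar>a\<bar> * nm x + \<bar>b\<bar> * nm (U x)"
      using nm_triangle[of "a *\<^sub>R x" "b *\<^sub>R U x"] x sa_opD[OF U] by (simp add: nm_scale)
    also have "\<dots> \<le> \<bar>a\<bar> * nm x + \<bar>b\<bar> * (C * nm x)"
      using C(2)[OF x] by (intro add_left_mono mult_left_mono) auto
    finally show ?thesis by (simp add: algebra_simps)
  qed
  then show ?thesis
    unfolding sa_op_def using sa_opD[OF U] ip_sym
    by (auto simp: algebra_simps ip_simps intro!: exI[of _ "\<bar>a\<bar> + \<bar>b\<bar> * C"])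
qed

lemma sa_op_square:
  assumes U: "sa_op U"
  shows "sa_op (\<lambda>x. U (U x))"
proof -
  obtain C where C: "0 < C" "\<And>x. x \<in> H \<Longrightarrow> nm (U x) \<le> C * nm x" using sa_op_bound[OF U] by metis
  have "nm (U (U x)) \<le> (C * C) * nm x" if x: "x \<in> H" for x
  proof -
    have "nm (U (U x)) \<le> C * nm (U x)" using C(2) x sa_opD[OF U] by blast
    also have "\<dots> \<le> C * (C * nm x)" using C(1) C(2)[OF x] by (intro mult_left_mono) auto
    finally show ?thesis by (simp add: mult.assoc)
  qed
  then show ?thesis
    unfolding sa_op_def using sa_opD[OF U] by (auto intro!: exI[of _ "C * C"])
qed

text \<open>
The negation says that \<open>\<mu>\<close> is an approximate eigenvalue of \<open>U\<close>. Outside the spectrum the property holds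
because the resolvent is bounded.
\<close>

definition bounded_below_at :: "('v \<Rightarrow> 'v) \<Rightarrow> real \<Rightarrow> bool" where
  "bounded_below_at U \<mu> \<longleftrightarrow> (\<exists>c>0. \<forall>x\<in>H. c * nm x \<le> nm (U x - \<mu> *\<^sub>R x))"

text \<open>
Cauchy--Schwarz for the form \<open>\<langle>U x, y\<rangle>\<close>, taken at \<open>y = U x\<close>.
\<close>

lemma psd_op_square_le:
  assumes U: "sa_op U" and pos: "\<And>x. x \<in> H \<Longrightarrow> 0 \<le> ip (U x) x"
    and le: "\<And>x. x \<in> H \<Longrightarrow> ip (U x) x \<le> \<Lambda> * ip x x" and x: "x \<in> H"
  shows "ip (U x) (U x) \<le> \<Lambda> * ip (U x) x"
proof -
  note U' = sa_opD[OF U]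
  interpret Q: psd_form H "\<lambda>x y. ip (U x) y"
    by standard (use subspace_H U' pos ip_sym in \<open>auto simp: ip_simps\<close>)
  have Ux: "U x \<in> H" using U' x by auto
  have n: "0 \<le> ip (U x) (U x)" by (rule ip_nonneg[OF Ux])
  have "(ip (U x) (U x))\<^sup>2 \<le> ip (U x) x * ip (U (U x)) (U x)"
    using Q.ip_Cauchy_Schwarz_square[OF x Ux] .
  also have "\<dots> \<le> ip (U x) x * (\<Lambda> * ip (U x) (U x))"
    by (intro mult_left_mono le pos Ux x)
  finally have "ip (U x) (U x) * ip (U x) (U x) \<le> (\<Lambda> * ip (U x) x) * ip (U x) (U x)"
    by (simp add: power2_eq_square algebra_simps)
  moreover have "0 \<le> \<Lambda> * ip (U x) x" if "ip (U x) (U x) = 0"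
  proof -
    have "U x = 0" using ip_definite[OF Ux] that by auto
    then show ?thesis using x by simp
  qed
  ultimately show ?thesis using n by (cases "ip (U x) (U x) = 0") (auto simp: mult_le_cancel_right)
qed

text \<open>
By the previous inequality, \<open>c\<^sup>2 \<parallel>x\<parallel>\<^sup>2 \<le> \<parallel>U x\<parallel>\<^sup>2 \<le> C \<langle>U x, x\<rangle>\<close> with \<open>C\<close> a bound for \<open>U\<close>.
\<close>

lemma psd_bounded_below_imp_coercive:
  assumes U: "sa_op U" and pos: "\<And>x. x \<in> H \<Longrightarrow> 0 \<le> ip (U x) x"
    and c: "0 < c" "\<And>x. x \<in> H \<Longrightarrow> c * nm x \<le> nm (U x)"
  obtains d where "0 < d" "\<And>x. x \<in> H \<Longrightarrow> d * ip x x \<le> ip (U x) x"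
proof -
  note U' = sa_opD[OF U]
  obtain C where C: "0 < C" "\<And>x. x \<in> H \<Longrightarrow> nm (U x) \<le> C * nm x" using sa_op_bound[OF U] by metis
  have le: "ip (U x) x \<le> C * ip x x" if x: "x \<in> H" for x
  proof -
    have "ip (U x) x \<le> nm (U x) * nm x" using ip_Cauchy_Schwarz[of "U x" x] x U' by auto
    also have "\<dots> \<le> (C * nm x) * nm x" using C(2)[OF x] x by (intro mult_right_mono) auto
    finally show ?thesis using nm_square[OF x] by (simp add: power2_eq_square mult.assoc)
  qed
  show thesis
  proof (rule that[of "c\<^sup>2 / C"])
    fix x assume x: "x \<in> H"
    have "c\<^sup>2 * ip x x = (c * nm x)\<^sup>2" using nm_square[OF x] by (simp add: power_mult_distrib)
    also have "\<dots> \<le> (nm (U x))\<^sup>2" using c x by (intro power_mono) auto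
    also have "\<dots> \<le> C * ip (U x) x"
      using psd_op_square_le[OF U pos le x] x U' by (simp add: nm_square)
    finally show "c\<^sup>2 / C * ip x x \<le> ip (U x) x" using C(1) by (simp add: field_simps)
  qed (use c C in auto)
qed

text \<open>
The supremum \<open>\<Lambda>\<close> of the numerical range is an approximate eigenvalue: otherwise the nonnegative operator
\<open>\<Lambda> - U\<close> would be coercive, and \<open>\<Lambda>\<close> could be lowered.
\<close>

lemma numerical_range_sup:
  assumes U: "sa_op U" and nontriv: "\<phi> \<in> H" "\<phi> \<noteq> 0"
  obtains \<Lambda> where "\<And>x. x \<in> H \<Longrightarrow> ip (U x) x \<le> \<Lambda> * ip x x" "\<not> bounded_below_at U \<Lambda>"
    "\<And>K. (\<And>x. x \<in> H \<Longrightarrow> ip (U x) x \<le> K * ip x x) \<Longrightarrow> \<Lambda> \<le> K"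
proof -
  note U' = sa_opD[OF U]
  obtain C where C: "0 < C" "\<And>x. x \<in> H \<Longrightarrow> nm (U x) \<le> C * nm x" using sa_op_bound[OF U] by metis
  define S where "S = (\<lambda>x. ip (U x) x / ip x x) ` (H - {0})"
  have S0: "S \<noteq> {}" using nontriv by (auto simp: S_def)
  have quot: "ip (U x) x \<le> K * ip x x \<longleftrightarrow> ip (U x) x / ip x x \<le> K" if "x \<in> H" "x \<noteq> 0" for x K
    using ip_pos[OF that] by (simp add: field_simps)
  have leC: "ip (U x) x \<le> C * ip x x" if x: "x \<in> H" for x
  proof -
    have "ip (U x) x \<le> nm (U x) * nm x" using ip_Cauchy_Schwarz[of "U x" x] x U' by auto
    also have "\<dots> \<le> (C * nm x) * nm x" using C(2)[OF x] x by (intro mult_right_mono) auto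
    finally show ?thesis using nm_square[OF x] by (simp add: power2_eq_square mult.assoc)
  qed
  have bd: "bdd_above S" by (rule bdd_aboveI[of _ C]) (use quot leC in \<open>auto simp: S_def\<close>)
  define \<Lambda> where "\<Lambda> = Sup S"
  have le: "ip (U x) x \<le> \<Lambda> * ip x x" if x: "x \<in> H" for x
  proof (cases "x = 0")
    case False
    then have "ip (U x) x / ip x x \<in> S" using x by (auto simp: S_def)
    then show ?thesis using quot[OF x False] cSup_upper[OF _ bd] by (auto simp: \<Lambda>_def)
  qed (use x sa_opD(3)[OF U x, of 0] in auto)
  have least: "\<Lambda> \<le> K" if "\<And>x. x \<in> H \<Longrightarrow> ip (U x) x \<le> K * ip x x" for K
    unfolding \<Lambda>_def by (rule cSup_least[OF S0]) (use that quot in \<open>auto simp: S_def\<close>)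
  have "\<not> bounded_below_at U \<Lambda>"
  proof
    assume "bounded_below_at U \<Lambda>"
    then obtain c where c: "0 < c" "\<And>x. x \<in> H \<Longrightarrow> c * nm x \<le> nm (U x - \<Lambda> *\<^sub>R x)"
      by (auto simp: bounded_below_at_def)
    define W where "W = (\<lambda>x. \<Lambda> *\<^sub>R x + (-1) *\<^sub>R U x)"
    have W: "sa_op W" unfolding W_def by (rule sa_op_affine[OF U])
    have Wp: "0 \<le> ip (W x) x" if "x \<in> H" for x
      using le[OF that] that U' by (simp add: W_def ip_simps)
    have Wc: "c * nm x \<le> nm (W x)" if "x \<in> H" for x
      using c(2)[OF that] nm_diff_commute[of "U x" "\<Lambda> *\<^sub>R x"] that U' by (simp add: W_def)
    obtain d where d: "0 < d" "\<And>x. x \<in> H \<Longrightarrow> d * ip x x \<le> ip (W x) x"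
      using psd_bounded_below_imp_coercive[OF W Wp c(1) Wc] by metis
    have "\<Lambda> \<le> \<Lambda> - d"
      by (rule least) (use d(2) U' in \<open>auto simp: W_def ip_simps algebra_simps\<close>)
    then show False using d(1) by simp
  qed
  then show thesis using that le least by metis
qed

text \<open>
If \<open>s\<close> is the infimum of \<open>\<parallel>S x\<parallel> / \<parallel>x\<parallel>\<close>, then \<open>- s\<^sup>2\<close> is the supremum of the numerical range of \<open>- S\<^sup>2\<close>, hence
an approximate eigenvalue of that operator. As \<open>S\<^sup>2 - s\<^sup>2 = (S + s) (S - s)\<close>, one of \<open>\<plusminus> s\<close> is an
approximate eigenvalue of \<open>S\<close>, which forces \<open>s \<ge> r\<close>. For self-adjoint \<open>S\<close> this
is the resolvent estimate in terms of the distance to the spectrum.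
\<close>

lemma bounded_below_gap:
  assumes S: "sa_op S" and reg: "\<And>\<mu>. \<bar>\<mu>\<bar> < r \<Longrightarrow> bounded_below_at S \<mu>" and r: "0 \<le> r"
    and x: "x \<in> H"
  shows "r * nm x \<le> nm (S x)"
proof (cases "x = 0")
  case False
  note S' = sa_opD[OF S]
  define U where "U = (\<lambda>x. 0 *\<^sub>R x + (-1) *\<^sub>R S (S x))"
  have U: "sa_op U" unfolding U_def by (rule sa_op_affine[OF sa_op_square[OF S]])
  have Uq: "ip (U y) y = - (nm (S y))\<^sup>2" if "y \<in> H" for y
    using that S' by (simp add: U_def ip_simps nm_square)
  obtain \<Lambda> where le: "\<And>y. y \<in> H \<Longrightarrow> ip (U y) y \<le> \<Lambda> * ip y y" and nb: "\<not> bounded_below_at U \<Lambda>"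
    and least: "\<And>K. (\<And>y. y \<in> H \<Longrightarrow> ip (U y) y \<le> K * ip y y) \<Longrightarrow> \<Lambda> \<le> K"
    using numerical_range_sup[OF U x False] by metis
  have L0: "\<Lambda> \<le> 0" by (rule least) (simp add: Uq)
  define s where "s = sqrt (- \<Lambda>)"
  have s: "0 \<le> s" "s\<^sup>2 = - \<Lambda>" using L0 by (auto simp: s_def)
  have "r \<le> s"
  proof (rule ccontr)
    assume "\<not> r \<le> s"
    then have "bounded_below_at S s" "bounded_below_at S (- s)" using reg s(1) by auto
    then obtain c d where c: "0 < c" "\<And>y. y \<in> H \<Longrightarrow> c * nm y \<le> nm (S y - s *\<^sub>R y)"
      and d: "0 < d" "\<And>y. y \<in> H \<Longrightarrow> d * nm y \<le> nm (S y - (- s) *\<^sub>R y)"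
      unfolding bounded_below_at_def by metis
    have "d * c * nm y \<le> nm (U y - \<Lambda> *\<^sub>R y)" if y: "y \<in> H" for y
    proof -
      define z where "z = S y - s *\<^sub>R y"
      have z: "z \<in> H" using y S' by (simp add: z_def)
      have "s * s = - \<Lambda>" using s(2) by (simp add: power2_eq_square)
      moreover have "S z + s *\<^sub>R z = S (S y) - (s * s) *\<^sub>R y"
        using y S' sa_op_diff[OF S, of "S y" "s *\<^sub>R y"] by (simp add: z_def algebra_simps)
      ultimately have eq: "S z - (- s) *\<^sub>R z = - (U y - \<Lambda> *\<^sub>R y)" by (simp add: U_def)
      have "d * c * nm y \<le> d * nm z" using c(2)[OF y] d(1) by (simp add: z_def mult.assoc)
      also have "\<dots> \<le> nm (U y - \<Lambda> *\<^sub>R y)"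
        using d(2)[OF z] nm_minus[of "U y - \<Lambda> *\<^sub>R y"] y sa_opD[OF U] by (simp only: eq) auto
      finally show ?thesis .
    qed
    then have "bounded_below_at U \<Lambda>" using c(1) d(1) unfolding bounded_below_at_def
      by (intro exI[of _ "d * c"]) auto
    then show False using nb by simp
  qed
  have "(s * nm x)\<^sup>2 \<le> (nm (S x))\<^sup>2"
    using le[OF x] Uq[OF x] s(2) nm_square[OF x] by (simp add: power_mult_distrib)
  then have "s * nm x \<le> nm (S x)" using x S' by (auto intro: power2_le_imp_le)
  then show ?thesis using \<open>r \<le> s\<close> mult_right_mono[of r s "nm x"] x by auto
qed (use x sa_opD(3)[OF S x, of 0] in auto)

text \<open>
An isolated point of the spectrum of a self-adjoint operator is an eigenvalue; here the point is \<open>0\<close>,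
the bottom of the spectrum. Centred at \<open>\<delta> / 2\<close>, the gap gives \<open>\<langle>R x, R x\<rangle> \<ge> \<delta> \<langle>R x, x\<rangle>\<close>. Cauchy--Schwarz for the
form of \<open>R\<close> turns this into the claim for vectors in the range of \<open>R\<close>, and that range is dense
because \<open>R\<close> is self-adjoint and injective.
\<close>

lemma injective_gap_imp_coercive:
  assumes R: "sa_op R" and Rpos: "\<And>x. x \<in> H \<Longrightarrow> 0 \<le> ip (R x) x"
    and Rker: "\<And>x. x \<in> H \<Longrightarrow> R x = 0 \<Longrightarrow> x = 0"
    and dp: "0 < \<delta>" and reg: "\<And>\<mu>. 0 < \<mu> \<Longrightarrow> \<mu> < \<delta> \<Longrightarrow> bounded_below_at R \<mu>"
    and h: "h \<in> H"
  shows "\<delta> * ip h h \<le> ip (R h) h"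
proof -
  note R' = sa_opD[OF R]
  define S where "S = (\<lambda>x. (- (\<delta> / 2)) *\<^sub>R x + 1 *\<^sub>R R x)"
  have S: "sa_op S" unfolding S_def by (rule sa_op_affine[OF R])
  have regS: "bounded_below_at S \<mu>" if "\<bar>\<mu>\<bar> < \<delta> / 2" for \<mu>
  proof -
    have "- (\<delta> / 2) < \<mu>" "\<mu> < \<delta> / 2" using that by auto
    then have "0 < \<mu> + \<delta> / 2" "\<mu> + \<delta> / 2 < \<delta>" by auto
    from reg[OF this] have "bounded_below_at R (\<mu> + \<delta> / 2)" .
    moreover have "R x - (\<mu> + \<delta> / 2) *\<^sub>R x = S x - \<mu> *\<^sub>R x" for x
      by (simp add: S_def algebra_simps)
    ultimately show ?thesis by (simp add: bounded_below_at_def)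
  qed
  have RR: "\<delta> * ip (R x) x \<le> ip (R x) (R x)" if x: "x \<in> H" for x
  proof -
    have "\<delta> / 2 * nm x \<le> nm (S x)"
      by (rule bounded_below_gap[OF S regS _ x]) (use dp in auto)
    then have "(\<delta> / 2 * nm x)\<^sup>2 \<le> (nm (S x))\<^sup>2" using dp x by (intro power_mono) auto
    then have "\<delta>\<^sup>2 / 4 * ip x x \<le> ip (S x) (S x)"
      using nm_square[OF x] nm_square[of "S x"] sa_opD[OF S] x by (simp add: power_mult_distrib power_divide)
    also have "\<dots> = \<delta>\<^sup>2 / 4 * ip x x - \<delta> * ip (R x) x + ip (R x) (R x)"
      using x R' ip_sym[of x "R x"] by (simp add: S_def ip_simps power2_eq_square field_simps)
    finally show ?thesis by simp
  qed
  have Rrange: "\<delta> * ip (R x) (R x) \<le> ip (R (R x)) (R x)" if x: "x \<in> H" for x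
  proof -
    interpret Q: psd_form H "\<lambda>x y. ip (R x) y"
      by standard (use subspace_H R' Rpos ip_sym in \<open>auto simp: ip_simps\<close>)
    have Rx: "R x \<in> H" using R' x by auto
    show ?thesis
    proof (cases "R x = 0")
      case False
      have pos: "0 < ip (R x) (R x)" using ip_pos[OF Rx False] .
      have "(ip (R x) (R x))\<^sup>2 \<le> ip (R x) x * ip (R (R x)) (R x)"
        using Q.ip_Cauchy_Schwarz_square[OF x Rx] .
      then have "\<delta> * (ip (R x) (R x))\<^sup>2 \<le> (\<delta> * ip (R x) x) * ip (R (R x)) (R x)"
        using dp by (simp add: mult.assoc)
      also have "\<dots> \<le> ip (R x) (R x) * ip (R (R x)) (R x)"
        using RR[OF x] Rpos[OF Rx] by (intro mult_right_mono)
      finally have "(\<delta> * ip (R x) (R x)) * ip (R x) (R x) \<le> ip (R (R x)) (R x) * ip (R x) (R x)"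
        by (simp add: power2_eq_square algebra_simps)
      then show ?thesis using pos by (simp add: mult_le_cancel_right)
    qed (use Rx in \<open>auto intro: Rpos\<close>)
  qed
  show "\<delta> * ip h h \<le> ip (R h) h"
  proof -
    have V: "subspace (R ` H)" "R ` H \<subseteq> H"
    proof -
      show "subspace (R ` H)" unfolding subspace_def
      proof (intro conjI ballI allI)
        show "0 \<in> R ` H" using R'(3)[of 0 0] by (auto intro!: image_eqI[of _ _ 0])
      qed (auto simp: R'(2,3)[symmetric])
    qed (use R' in auto)
    obtain v w where v: "\<And>n::nat. v n \<in> R ` H" and w: "w \<in> H" and lim: "(\<lambda>n. nm (v n - w)) \<longlonglongrightarrow> 0"
      and orth: "\<And>x. x \<in> R ` H \<Longrightarrow> ip (h - w) x = 0"
      using orthogonal_projection_closure[OF V h] by metis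
    have "ip (R (h - w)) (R (h - w)) = ip (h - w) (R (R (h - w)))"
      using h w R' by simp
    also have "\<dots> = 0" using orth h w R' by simp
    finally have "R (h - w) = 0" using ip_definite[of "R (h - w)"] h w R' by simp
    then have hw: "h = w" using Rker[of "h - w"] h w by simp
    have vH: "v n \<in> H" for n using v[of n] V by auto
    obtain C where C: "0 < C" "\<And>x. x \<in> H \<Longrightarrow> nm (R x) \<le> C * nm x" using sa_op_bound[OF R] by metis
    have limR: "(\<lambda>n. ip (R (v n)) (v n) - \<delta> * (nm (v n))\<^sup>2) \<longlonglongrightarrow> ip (R w) w - \<delta> * (nm w)\<^sup>2"
    proof -
      have "(\<lambda>n. ip (v n - w) (R (v n - w))) \<longlonglongrightarrow> 0"
      proof (rule Lim_null_comparison)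
        show "\<forall>\<^sub>F n in sequentially. norm (ip (v n - w) (R (v n - w))) \<le> nm (v n - w) * (C * nm (v n - w))"
        proof (intro always_eventually allI)
          fix n
          have "norm (ip (v n - w) (R (v n - w))) \<le> nm (v n - w) * nm (R (v n - w))"
            using ip_Cauchy_Schwarz[of "v n - w" "R (v n - w)"] vH w R' by simp
          also have "\<dots> \<le> nm (v n - w) * (C * nm (v n - w))"
            using C(2)[of "v n - w"] vH w by (intro mult_left_mono) auto
          finally show "norm (ip (v n - w) (R (v n - w))) \<le> nm (v n - w) * (C * nm (v n - w))" .
        qed
        show "(\<lambda>n. nm (v n - w) * (C * nm (v n - w))) \<longlonglongrightarrow> 0"
          using tendsto_mult[OF lim tendsto_mult_left[OF lim, of C]] by simp
      qed
      then have "(\<lambda>n. ip (v n - w) (R (v n - w)) + 2 * ip (v n) (R w) - ip w (R w) - \<delta> * (nm (v n))\<^sup>2)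
         \<longlonglongrightarrow> 0 + 2 * ip w (R w) - ip w (R w) - \<delta> * (nm w)\<^sup>2"
        using w R' by (intro tendsto_intros tendsto_ip_left[OF vH w lim] tendsto_nm[OF vH w lim]) auto
      moreover have "ip (v n - w) (R (v n - w)) + 2 * ip (v n) (R w) - ip w (R w) = ip (R (v n)) (v n)" for n
        using vH[of n] w R' ip_sym[of w "R (v n)"] ip_sym[of "v n" "R (v n)"]  sa_op_diff[OF R, of "v n" w]
        by (simp add: ip_simps)
      moreover have "ip w (R w) = ip (R w) w" using w R' by simp
      ultimately show ?thesis by simp
    qed
    have "0 \<le> ip (R (v n)) (v n) - \<delta> * (nm (v n))\<^sup>2" for n
      using v[of n] Rrange R' by (auto simp: nm_square)
    then have "0 \<le> ip (R w) w - \<delta> * (nm w)\<^sup>2"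
      by (intro LIMSEQ_le_const[OF limR]) auto
    then show ?thesis using hw nm_square[OF w] by simp
  qed
qed

text \<open>
Let \<open>P\<close> be the orthogonal projection onto \<open>\<phi>\<close> and \<open>B = T - p P\<close>. An approximate eigenvalue \<open>\<mu> \<ge> 1\<close> of \<open>B\<close>
is one of \<open>T\<close>, so it can only be \<open>p\<close>; in particular the supremum \<open>\<Lambda>\<close> of the numerical range of \<open>B\<close> is
less than \<open>1\<close> or equal to \<open>p\<close>. In the second case \<open>p - B\<close> is nonnegative, it is injective because the
\<open>p\<close>-eigenspace of \<open>T\<close> is spanned by \<open>\<phi>\<close>, and it has the gap \<open>(0, p - 1)\<close>; so \<open>p - B \<ge> p - 1\<close>,
that is \<open>\<Lambda> \<le> 1\<close>, a contradiction.
\<close>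

lemma deflated_operator_contraction:
  assumes T: "sa_op T" and pos: "\<And>x. x \<in> H \<Longrightarrow> 0 \<le> ip (T x) x"
    and \<phi>: "\<phi> \<in> H" "\<phi> \<noteq> 0" "T \<phi> = p *\<^sub>R \<phi>" and p: "1 < p"
    and reg: "\<And>\<mu>. 1 \<le> \<mu> \<Longrightarrow> \<mu> \<noteq> p \<Longrightarrow> bounded_below_at T \<mu>"
    and ker: "\<And>x. x \<in> H \<Longrightarrow> ip x \<phi> = 0 \<Longrightarrow> T x = p *\<^sub>R x \<Longrightarrow> x = 0"
  shows "\<exists>\<rho>. 0 \<le> \<rho> \<and> \<rho> < 1 \<and>
    (\<forall>x\<in>H. nm (T x - (p * ip x \<phi> / ip \<phi> \<phi>) *\<^sub>R \<phi>) \<le> \<rho> * nm x)"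
proof -
  note T' = sa_opD[OF T]
  define s where "s = ip \<phi> \<phi>"
  have s: "0 < s" using ip_pos \<phi> by (simp add: s_def)
  define B where "B = (\<lambda>x. T x - (p * ip x \<phi> / s) *\<^sub>R \<phi>)"
  have BH: "B x \<in> H" if "x \<in> H" for x using that T' \<phi> by (simp add: B_def)
  have Bphi: "ip (B x) \<phi> = 0" if x: "x \<in> H" for x
    using x \<phi> T' s by (simp add: B_def ip_simps s_def)
  have B: "sa_op B"
  proof -
    obtain C where C: "0 < C" "\<And>x. x \<in> H \<Longrightarrow> nm (T x) \<le> C * nm x" using sa_op_bound[OF T] by metis
    have "nm (B x) \<le> (C + p) * nm x" if x: "x \<in> H" for x
    proof -
      have "\<bar>p * ip x \<phi> / s\<bar> * nm \<phi> \<le> p * (nm x * nm \<phi>) / s * nm \<phi>"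
        using ip_Cauchy_Schwarz[OF x \<phi>(1)] p s \<phi>
        by (intro mult_right_mono) (auto simp: abs_mult intro!: divide_right_mono mult_left_mono)
      also have "\<dots> = p * nm x" using nm_square[OF \<phi>(1)] s by (simp add: s_def field_simps power2_eq_square)
      finally show ?thesis
        using nm_triangle_diff[of "T x" "(p * ip x \<phi> / s) *\<^sub>R \<phi>"] C(2)[OF x] x T' \<phi>
        by (simp add: B_def nm_scale algebra_simps)
    qed
    moreover have "ip (B x) y = ip x (B y)" if "x \<in> H" "y \<in> H" for x y
      using that \<phi> T' ip_sym[of x \<phi>] ip_sym[of y \<phi>] by (simp add: B_def ip_simps)
    ultimately show ?thesis unfolding sa_op_def
      using BH \<phi> T' by (auto simp: B_def ip_simps algebra_simps add_divide_distrib intro!: exI[of _ "C + p"])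
  qed
  note B' = sa_opD[OF B]
  have Bpos: "0 \<le> ip (B x) x" if x: "x \<in> H" for x
  proof -
    \<comment> \<open>With the component \<open>y\<close> of \<open>x\<close> orthogonal to \<open>\<phi>\<close>, the value is \<open>\<langle>T y, y\<rangle>\<close>.\<close>
    define y where "y = x - (ip x \<phi> / s) *\<^sub>R \<phi>"
    have y: "y \<in> H" using x \<phi> by (simp add: y_def)
    have TyB: "T y = B x" using x \<phi> sa_op_diff[OF T, of x "(ip x \<phi> / s) *\<^sub>R \<phi>"] T'
      by (simp add: y_def B_def)
    have "ip (B x) x = ip (T y) y"
      unfolding TyB using x \<phi> BH Bphi by (simp add: y_def ip_simps)
    then show ?thesis using pos[OF y] by simp
  qed
  have regB: "bounded_below_at B \<mu>" if mu: "1 \<le> \<mu>" "\<mu> \<noteq> p" for \<mu>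
  proof -
    obtain c where c: "0 < c" "\<And>x. x \<in> H \<Longrightarrow> c * nm x \<le> nm (T x - \<mu> *\<^sub>R x)"
      using reg[OF mu] by (auto simp: bounded_below_at_def)
    have "c / (1 + p) * nm x \<le> nm (B x - \<mu> *\<^sub>R x)" if x: "x \<in> H" for x
    proof -
      define y where "y = B x - \<mu> *\<^sub>R x"
      have y: "y \<in> H" using x BH by (simp add: y_def)
      have "ip y \<phi> = - \<mu> * ip x \<phi>" using x \<phi> BH Bphi by (simp add: y_def ip_simps)
      then have "\<mu> * \<bar>ip x \<phi>\<bar> = \<bar>ip y \<phi>\<bar>" using mu by (simp add: abs_mult)
      moreover have "1 * \<bar>ip x \<phi>\<bar> \<le> \<mu> * \<bar>ip x \<phi>\<bar>" using mu by (intro mult_right_mono) auto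
      ultimately have xy: "\<bar>ip x \<phi>\<bar> \<le> nm y * nm \<phi>" using ip_Cauchy_Schwarz[OF y \<phi>(1)] by linarith
      have "\<bar>p * ip x \<phi> / s\<bar> * nm \<phi> \<le> p * (nm y * nm \<phi>) / s * nm \<phi>"
        using xy p s \<phi>
        by (intro mult_right_mono) (auto simp: abs_mult intro!: divide_right_mono mult_left_mono)
      also have "\<dots> = p * nm y" using nm_square[OF \<phi>(1)] s by (simp add: s_def field_simps power2_eq_square)
      finally have 1: "nm ((p * ip x \<phi> / s) *\<^sub>R \<phi>) \<le> p * nm y" using \<phi> by (simp add: nm_scale)
      have "T x - \<mu> *\<^sub>R x = y + (p * ip x \<phi> / s) *\<^sub>R \<phi>" by (simp add: y_def B_def)
      then have "c * nm x \<le> nm y + p * nm y"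
        using c(2)[OF x] nm_triangle[of y "(p * ip x \<phi> / s) *\<^sub>R \<phi>"] y \<phi> 1 by auto
      then show ?thesis using p by (simp add: y_def[symmetric] field_simps)
    qed
    then show ?thesis using c p unfolding bounded_below_at_def by (intro exI[of _ "c / (1 + p)"]) auto
  qed
  obtain \<Lambda> where le: "\<And>y. y \<in> H \<Longrightarrow> ip (B y) y \<le> \<Lambda> * ip y y" and nb: "\<not> bounded_below_at B \<Lambda>"
    and least: "\<And>K. (\<And>y. y \<in> H \<Longrightarrow> ip (B y) y \<le> K * ip y y) \<Longrightarrow> \<Lambda> \<le> K"
    using numerical_range_sup[OF B \<phi>(1,2)] by metis
  have L0: "0 \<le> \<Lambda>" using le[OF \<phi>(1)] Bpos[OF \<phi>(1)] ip_pos[OF \<phi>(1,2)]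
    by (metis less_le_not_le linorder_le_less_linear mult_neg_pos order_trans)
  have "\<Lambda> \<noteq> p"
  proof
    assume Lp: "\<Lambda> = p"
    define R where "R = (\<lambda>x. p *\<^sub>R x + (-1) *\<^sub>R B x)"
    define \<delta> where "\<delta> = p - 1"
    have dp: "0 < \<delta>" using p by (simp add: \<delta>_def)
    have R: "sa_op R" unfolding R_def by (rule sa_op_affine[OF B])
    note R' = sa_opD[OF R]
    have Rpos: "0 \<le> ip (R x) x" if "x \<in> H" for x
      using le[OF that] that BH Lp by (simp add: R_def ip_simps)
    have Rker: "x = 0" if x: "x \<in> H" and R0: "R x = 0" for x
    proof -
      have Bx: "B x = p *\<^sub>R x" using R0 by (simp add: R_def)
      then have "ip x \<phi> = 0" using Bphi[OF x] x \<phi> p by (simp add: ip_simps)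
      then show ?thesis using ker[OF x] Bx by (simp add: B_def)
    qed
    have regR: "bounded_below_at R \<mu>" if "0 < \<mu>" "\<mu> < \<delta>" for \<mu>
    proof -
      have "1 \<le> p - \<mu>" "p - \<mu> \<noteq> p" using that by (auto simp: \<delta>_def)
      from regB[OF this] obtain c where c: "0 < c" "\<And>x. x \<in> H \<Longrightarrow> c * nm x \<le> nm (B x - (p - \<mu>) *\<^sub>R x)"
        by (auto simp: bounded_below_at_def)
      have "R x - \<mu> *\<^sub>R x = - (B x - (p - \<mu>) *\<^sub>R x)" for x by (simp add: R_def algebra_simps)
      then have "c * nm x \<le> nm (R x - \<mu> *\<^sub>R x)" if "x \<in> H" for x
        using c(2)[OF that] nm_minus[of "B x - (p - \<mu>) *\<^sub>R x"] that BH by simp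
      then show ?thesis using c(1) by (auto simp: bounded_below_at_def)
    qed
    note Rcoer = injective_gap_imp_coercive[OF R Rpos Rker dp regR]
    have "\<Lambda> \<le> p - \<delta>"
      by (rule least) (use Rcoer BH in \<open>auto simp: R_def ip_simps algebra_simps\<close>)
    then show False using dp Lp by simp
  qed
  then have L1: "\<Lambda> < 1" using nb regB[of \<Lambda>] by force
  show ?thesis
  proof (intro exI[of _ \<Lambda>] conjI ballI L0 L1)
    fix x assume x: "x \<in> H"
    have "ip (B x) (B x) \<le> \<Lambda> * ip (B x) x" by (rule psd_op_square_le[OF B Bpos le x])
    also have "\<dots> \<le> \<Lambda> * (\<Lambda> * ip x x)" using le[OF x] L0 by (intro mult_left_mono)
    finally have "(nm (B x))\<^sup>2 \<le> (\<Lambda> * nm x)\<^sup>2"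
      using x BH nm_square[OF x] by (simp add: nm_square power2_eq_square[of \<Lambda>] power_mult_distrib)
    then have "nm (B x) \<le> \<Lambda> * nm x" using x L0 by (auto intro: power2_le_imp_le)
    then show "nm (T x - (p * ip x \<phi> / ip \<phi> \<phi>) *\<^sub>R \<phi>) \<le> \<Lambda> * nm x" by (simp add: B_def s_def)
  qed
qed

section \<open>Iterations with a contracting derivative\<close>

definition derivative_at :: "('v \<Rightarrow> 'v) \<Rightarrow> ('v \<Rightarrow> 'v) \<Rightarrow> 'v \<Rightarrow> bool" where
  "derivative_at K D \<phi> \<longleftrightarrow> (\<forall>\<epsilon>>0. \<exists>\<delta>>0. \<forall>u\<in>H. nm (u - \<phi>) < \<delta> \<longrightarrow>
     nm (K u - K \<phi> - D (u - \<phi>)) \<le> \<epsilon> * nm (u - \<phi>))"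

text \<open>
Near \<open>\<phi>\<close> one step shrinks the distance to \<open>\<phi>\<close> by the factor \<open>(1 + \<rho>) / 2\<close>, so a single iterate close to
\<open>\<phi>\<close> keeps all later ones close and makes them converge geometrically.
\<close>

lemma contracting_derivative_imp_convergence:
  assumes \<phi>: "\<phi> \<in> H" and fix_pt: "A \<phi> = \<phi>" and A: "\<And>u. u \<in> H \<Longrightarrow> A u \<in> H"
    and D: "derivative_at A D \<phi>" and DH: "\<And>x. x \<in> H \<Longrightarrow> D x \<in> H"
    and \<rho>: "\<rho> < 1" "0 \<le> \<rho>" "\<And>x. x \<in> H \<Longrightarrow> nm (D x) \<le> \<rho> * nm x"
    and u0: "u 0 \<in> H" and u: "\<And>n. u (Suc n) = A (u n)"
    and sub: "(\<lambda>k. nm (u (r k) - \<phi>)) \<longlonglongrightarrow> 0"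
  shows "(\<lambda>n. nm (u n - \<phi>)) \<longlonglongrightarrow> 0"
proof -
  have uH: "u n \<in> H" for n by (induction n) (auto simp: u0 u A)
  define q where "q = (1 + \<rho>) / 2"
  have q: "0 \<le> q" "q < 1" using \<rho> by (auto simp: q_def)
  have "0 < (1 - \<rho>) / 2" using \<rho> by simp
  then obtain \<delta> where \<delta>: "0 < \<delta>" "\<And>v. v \<in> H \<Longrightarrow> nm (v - \<phi>) < \<delta> \<Longrightarrow>
      nm (A v - A \<phi> - D (v - \<phi>)) \<le> (1 - \<rho>) / 2 * nm (v - \<phi>)"
    using D unfolding derivative_at_def by metis
  have step: "nm (A v - \<phi>) \<le> q * nm (v - \<phi>)" if v: "v \<in> H" "nm (v - \<phi>) < \<delta>" for v
  proof -
    have "nm (A v - \<phi>) \<le> nm (A v - A \<phi> - D (v - \<phi>)) + nm (D (v - \<phi>))"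
      using nm_triangle[of "A v - A \<phi> - D (v - \<phi>)" "D (v - \<phi>)"] v A \<phi> DH by (simp add: fix_pt)
    also have "\<dots> \<le> (1 - \<rho>) / 2 * nm (v - \<phi>) + \<rho> * nm (v - \<phi>)"
      using \<delta>(2)[OF v] \<rho>(3)[of "v - \<phi>"] v \<phi> by (intro add_mono) auto
    also have "\<dots> = q * nm (v - \<phi>)" by (simp add: q_def field_simps)
    finally show ?thesis .
  qed
  obtain k where k: "nm (u (r k) - \<phi>) < \<delta>"
    using order_tendstoD(2)[OF sub \<delta>(1)] by (auto simp: eventually_sequentially)
  define N where "N = r k"
  have geo: "nm (u (j + N) - \<phi>) \<le> q ^ j * nm (u N - \<phi>)" for j
  proof (induction j)
    case (Suc j)
    have "q ^ j * nm (u N - \<phi>) \<le> 1 * nm (u N - \<phi>)"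
      using q uH \<phi> by (intro mult_right_mono power_le_one) auto
    then have "nm (u (j + N) - \<phi>) < \<delta>" using Suc k by (simp add: N_def)
    from step[OF uH this] have "nm (u (Suc j + N) - \<phi>) \<le> q * nm (u (j + N) - \<phi>)" by (simp add: u)
    also have "\<dots> \<le> q * (q ^ j * nm (u N - \<phi>))" using Suc q by (intro mult_left_mono) auto
    finally show ?case by (simp add: mult.assoc)
  qed simp
  have "(\<lambda>j. nm (u (j + N) - \<phi>)) \<longlonglongrightarrow> 0"
  proof (rule Lim_null_comparison)
    show "\<forall>\<^sub>F j in sequentially. norm (nm (u (j + N) - \<phi>)) \<le> q ^ j * nm (u N - \<phi>)"
      using geo uH \<phi> by (intro always_eventually) auto
    show "(\<lambda>j. q ^ j * nm (u N - \<phi>)) \<longlonglongrightarrow> 0"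
      using tendsto_mult_right[OF LIMSEQ_realpow_zero[OF q], of "nm (u N - \<phi>)"] by simp
  qed
  then show ?thesis by (rule LIMSEQ_offset)
qed

text \<open>
Put \<open>h = u - \<phi>\<close>, \<open>s = \<parallel>\<phi>\<parallel>\<^sup>2\<close> and \<open>a = \<langle>\<phi>, h\<rangle>\<close>. Up to \<open>o(\<parallel>h\<parallel>)\<close> one has \<open>\<langle>u, u\<rangle> = s + 2 a\<close> and, since \<open>T\<close> is
symmetric with \<open>T \<phi> = p \<phi>\<close>, also \<open>\<langle>K u, u\<rangle> = s + (1 + p) a\<close>. The quotient is therefore
\<open>1 + (1 - p) a / s\<close>, and its power \<open>\<gamma> = p / (p - 1)\<close> is \<open>1 - p a / s\<close>. Multiplied by \<open>K u = \<phi> + T h\<close> this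
yields \<open>\<phi> + T h - (p a / s) \<phi>\<close>: the exponent is chosen so that the factor cancels the expansion of \<open>T\<close>
along \<open>\<phi>\<close>.
\<close>

lemma normalized_iteration_derivative:
  assumes K: "\<And>u. u \<in> H \<Longrightarrow> K u \<in> H" and K\<phi>: "K \<phi> = \<phi>" and \<phi>: "\<phi> \<in> H" "\<phi> \<noteq> 0"
    and T: "sa_op T" "T \<phi> = p *\<^sub>R \<phi>" and KT: "derivative_at K T \<phi>"
    and p: "1 < p" and \<gamma>: "\<gamma> = p / (p - 1)"
  shows "derivative_at (\<lambda>u. (ip u u / ip (K u) u) powr \<gamma> *\<^sub>R K u)
    (\<lambda>x. T x - (p * ip x \<phi> / ip \<phi> \<phi>) *\<^sub>R \<phi>) \<phi>"
proof -
  note T' = sa_opD[OF T(1)]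
  obtain C where C: "0 < C" "\<And>x. x \<in> H \<Longrightarrow> nm (T x) \<le> C * nm x" using sa_op_bound[OF T(1)] by metis
  define s where "s = ip \<phi> \<phi>"
  have s: "0 < s" using ip_pos \<phi> by (simp add: s_def)
  \<comment> \<open>The punctured neighbourhoods of \<open>\<phi>\<close> in \<open>H\<close>; an \<open>o(\<parallel>h\<parallel>)\<close> becomes a quotient by \<open>t\<close> tending to \<open>0\<close> along \<open>F\<close>.\<close>
  define F where "F = (INF \<delta>\<in>{0<..}. principal {u\<in>H. u \<noteq> \<phi> \<and> nm (u - \<phi>) < \<delta>})"
  have evF: "eventually P F \<longleftrightarrow> (\<exists>\<delta>>0. \<forall>u\<in>H. u \<noteq> \<phi> \<longrightarrow> nm (u - \<phi>) < \<delta> \<longrightarrow> P u)" for P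
  proof -
    have "eventually P F \<longleftrightarrow> (\<exists>\<delta>\<in>{0<..}. eventually P (principal {u\<in>H. u \<noteq> \<phi> \<and> nm (u - \<phi>) < \<delta>}))"
      unfolding F_def
    proof (rule eventually_INF_base)
      fix a b :: real assume "a \<in> {0<..}" "b \<in> {0<..}"
      then show "\<exists>x\<in>{0<..}. principal {u \<in> H. u \<noteq> \<phi> \<and> nm (u - \<phi>) < x}
         \<le> inf (principal {u \<in> H. u \<noteq> \<phi> \<and> nm (u - \<phi>) < a}) (principal {u \<in> H. u \<noteq> \<phi> \<and> nm (u - \<phi>) < b})"
        by (intro bexI[of _ "min a b"]) auto
    qed auto
    then show ?thesis by (auto simp: eventually_principal)
  qed
  define h where "h = (\<lambda>u. u - \<phi>)"
  define t where "t = (\<lambda>u. nm (h u))"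
  define e where "e = (\<lambda>u. K u - \<phi> - T (h u))"
  define a where "a = (\<lambda>u. ip \<phi> (h u))"
  have ev: "\<forall>\<^sub>F u in F. u \<in> H \<and> 0 < t u"
    unfolding evF t_def h_def using \<phi> by (intro exI[of _ 1]) (auto intro!: nm_pos)
  have hH: "h u \<in> H" and eH: "e u \<in> H" if "u \<in> H" for u
    using that \<phi> K T' by (auto simp: h_def e_def)
  have t0: "(t \<longlongrightarrow> 0) F"
    unfolding tendsto_iff dist_real_def evF t_def h_def using \<phi> by auto
  have e0: "((\<lambda>u. nm (e u) / t u) \<longlongrightarrow> 0) F"
    unfolding tendsto_iff dist_real_def
  proof (intro allI impI)
    fix \<epsilon> :: real assume eps: "0 < \<epsilon>"
    then obtain \<delta> where d: "0 < \<delta>" "\<And>u. u \<in> H \<Longrightarrow> nm (u - \<phi>) < \<delta> \<Longrightarrow>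
        nm (K u - K \<phi> - T (u - \<phi>)) \<le> \<epsilon> / 2 * nm (u - \<phi>)"
      using KT unfolding derivative_at_def by (metis half_gt_zero)
    show "\<forall>\<^sub>F u in F. \<bar>nm (e u) / t u - 0\<bar> < \<epsilon>"
      unfolding evF
    proof (intro exI[of _ \<delta>] conjI d ballI impI)
      fix u assume u: "u \<in> H" "u \<noteq> \<phi>" "nm (u - \<phi>) < \<delta>"
      have tp: "0 < t u" using u \<phi> by (auto simp: t_def h_def intro!: nm_pos)
      have "nm (e u) \<le> \<epsilon> / 2 * t u" using d(2)[OF u(1,3)] by (simp add: e_def K\<phi> h_def t_def)
      also have "\<dots> < \<epsilon> * t u" using eps tp by simp
      finally have "nm (e u) / t u < \<epsilon>" using tp by (simp add: field_simps)
      then show "\<bar>nm (e u) / t u - 0\<bar> < \<epsilon>" using tp nm_nonneg[OF eH[OF u(1)]] by simp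
    qed
  qed
  have a_le: "\<bar>a u\<bar> \<le> nm \<phi> * t u" if "u \<in> H" for u
    using ip_Cauchy_Schwarz[OF \<phi>(1) hH[OF that]] by (simp add: a_def t_def)
  have a0: "(a \<longlongrightarrow> 0) F"
  proof (rule Lim_null_comparison)
    show "\<forall>\<^sub>F u in F. norm (a u) \<le> nm \<phi> * t u"
      using ev by eventually_elim (use a_le in auto)
    show "((\<lambda>u. nm \<phi> * t u) \<longlongrightarrow> 0) F" using tendsto_mult_left[OF t0, of "nm \<phi>"] by simp
  qed
  have abd: "Bfun (\<lambda>u. a u / t u) F"
    by (rule BfunI[of _ "nm \<phi>"])
      (use ev in \<open>eventually_elim, use a_le in \<open>auto simp: field_simps\<close>\<close>)
  define \<rho> where "\<rho> = (\<lambda>u. ip (T (h u)) (h u) + ip (e u) \<phi> + ip (e u) (h u))"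
  define Q where "Q = (\<lambda>u. ip (K u) u)"
  define M where "M = (\<lambda>u. ip u u / Q u)"
  have uu: "ip u u = s + 2 * a u + (t u)\<^sup>2" and QQ: "Q u = s + (1 + p) * a u + \<rho> u" if u: "u \<in> H" for u
  proof -
    have u': "u = \<phi> + h u" and Ku: "K u = \<phi> + T (h u) + e u" by (auto simp: h_def e_def)
    have hs: "ip (h u) \<phi> = a u" using ip_sym hH[OF u] \<phi> by (simp add: a_def)
    have "ip u u = ip (\<phi> + h u) (\<phi> + h u)" using u' by simp
    also have "\<dots> = s + 2 * a u + (t u)\<^sup>2"
      using hH[OF u] \<phi> hs by (simp add: ip_simps nm_square t_def s_def a_def)
    finally show "ip u u = s + 2 * a u + (t u)\<^sup>2" .
    have "Q u = ip (\<phi> + T (h u) + e u) (\<phi> + h u)" using u' Ku by (simp add: Q_def)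
    moreover have "ip (T (h u)) \<phi> = p * a u" using hH[OF u] \<phi> T' hs T(2) by (simp add: ip_simps)
    ultimately show "Q u = s + (1 + p) * a u + \<rho> u"
      using hH[OF u] eH[OF u] \<phi> T' by (simp add: ip_simps \<rho>_def s_def a_def algebra_simps)
  qed
  have r0: "((\<lambda>u. \<rho> u / t u) \<longlongrightarrow> 0) F"
  proof (rule Lim_null_comparison)
    show "\<forall>\<^sub>F u in F. norm (\<rho> u / t u) \<le> C * t u + nm (e u) / t u * nm \<phi> + nm (e u) / t u * t u"
      using ev
    proof eventually_elim
      case (elim u)
      note u = hH[of u] eH[of u]
      have "\<bar>ip (T (h u)) (h u)\<bar> \<le> nm (T (h u)) * t u" "\<bar>ip (e u) \<phi>\<bar> \<le> nm (e u) * nm \<phi>"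
        "\<bar>ip (e u) (h u)\<bar> \<le> nm (e u) * t u"
        unfolding t_def using elim u \<phi> T'(1) by (auto intro!: ip_Cauchy_Schwarz)
      moreover have "nm (T (h u)) * t u \<le> (C * t u) * t u"
        using elim C(2)[of "h u"] u by (intro mult_right_mono) (auto simp: t_def)
      ultimately have "\<bar>\<rho> u\<bar> \<le> C * t u * t u + nm (e u) * nm \<phi> + nm (e u) * t u"
        unfolding \<rho>_def by linarith
      then show ?case using elim by (simp add: field_simps)
    qed
    have "((\<lambda>u. C * t u + nm (e u) / t u * nm \<phi> + nm (e u) / t u * t u) \<longlongrightarrow> C * 0 + 0 * nm \<phi> + 0 * 0) F"
      by (intro tendsto_intros t0 e0)
    then show "((\<lambda>u. C * t u + nm (e u) / t u * nm \<phi> + nm (e u) / t u * t u) \<longlongrightarrow> 0) F" by simp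
  qed
  have rr0: "(\<rho> \<longlongrightarrow> 0) F"
  proof (rule Lim_transform_eventually)
    show "((\<lambda>u. \<rho> u / t u * t u) \<longlongrightarrow> 0) F" using tendsto_mult[OF r0 t0] by simp
    show "\<forall>\<^sub>F u in F. \<rho> u / t u * t u = \<rho> u" using ev by eventually_elim auto
  qed
  have QF: "(Q \<longlongrightarrow> s) F"
  proof (rule Lim_transform_eventually)
    have "((\<lambda>u. s + (1 + p) * a u + \<rho> u) \<longlongrightarrow> s + (1 + p) * 0 + 0) F" by (intro tendsto_intros a0 rr0)
    then show "((\<lambda>u. s + (1 + p) * a u + \<rho> u) \<longlongrightarrow> s) F" by simp
    show "\<forall>\<^sub>F u in F. s + (1 + p) * a u + \<rho> u = Q u" using ev by eventually_elim (simp add: QQ)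
  qed
  have evQ: "\<forall>\<^sub>F u in F. 0 < Q u" using order_tendstoD(1)[OF QF] s by blast
  have M1: "((\<lambda>u. (M u - 1) / t u - (1 - p) * (a u / t u) / s) \<longlongrightarrow> 0) F"
  proof (rule Lim_transform_eventually)
    have iQ: "((\<lambda>u. inverse (Q u) - inverse s) \<longlongrightarrow> 0) F"
      using tendsto_inverse[OF QF] s by (simp add: LIM_zero)
    have "((\<lambda>u. (inverse (Q u) - inverse s) * (a u / t u)) \<longlongrightarrow> 0) F"
      by (rule null_times_Bfun[OF iQ abd])
    then have "((\<lambda>u. (1 - p) * ((inverse (Q u) - inverse s) * (a u / t u)) + (t u - \<rho> u / t u) / Q u)
        \<longlongrightarrow> (1 - p) * 0 + (0 - 0) / s) F"
      using s by (intro tendsto_intros t0 r0 QF) auto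
    then show "((\<lambda>u. (1 - p) * ((inverse (Q u) - inverse s) * (a u / t u)) + (t u - \<rho> u / t u) / Q u) \<longlongrightarrow> 0) F"
      by simp
    show "\<forall>\<^sub>F u in F. (1 - p) * ((inverse (Q u) - inverse s) * (a u / t u)) + (t u - \<rho> u / t u) / Q u
       = (M u - 1) / t u - (1 - p) * (a u / t u) / s"
      using ev evQ
    proof eventually_elim
      case (elim u)
      then have "M u - 1 = (ip u u - Q u) / Q u" by (simp add: M_def field_simps)
      also have "\<dots> = ((1 - p) * a u + (t u)\<^sup>2 - \<rho> u) / Q u" using elim by (simp add: uu QQ algebra_simps)
      finally have "M u - 1 = ((1 - p) * a u + (t u)\<^sup>2 - \<rho> u) / Q u" .
      then show ?case using elim s by (simp only: inverse_eq_divide) (simp add: divide_simps, simp add: algebra_simps power2_eq_square)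
    qed
  qed
  have M1bd: "Bfun (\<lambda>u. (M u - 1) / t u) F"
  proof -
    have "Bfun (\<lambda>u. ((M u - 1) / t u - (1 - p) * (a u / t u) / s) + ((1 - p) / s) * (a u / t u)) F"
    proof -
      have B1: "\<forall>\<^sub>F u in F. norm ((M u - 1) / t u - (1 - p) * (a u / t u) / s) \<le> 1"
        using tendstoD[OF M1, of 1] by (auto elim!: eventually_mono simp: dist_norm)
      obtain B2 where B2: "\<forall>\<^sub>F u in F. norm (a u / t u) \<le> B2"
        using abd unfolding Bfun_def by auto
      show ?thesis
      proof (rule BfunI)
        show "\<forall>\<^sub>F u in F. norm (((M u - 1) / t u - (1 - p) * (a u / t u) / s) + ((1 - p) / s) * (a u / t u))
            \<le> 1 + \<bar>(1 - p) / s\<bar> * B2"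
          using B1 B2
        proof eventually_elim
          case (elim u)
          have "norm (((1 - p) / s) * (a u / t u)) \<le> \<bar>(1 - p) / s\<bar> * B2"
            using mult_left_mono[OF elim(2), of "\<bar>(1 - p) / s\<bar>"] by (simp add: abs_mult)
          then show ?case using elim(1) norm_triangle_ineq[of "(M u - 1) / t u - (1 - p) * (a u / t u) / s" "((1 - p) / s) * (a u / t u)"]
            by linarith
        qed
      qed
    qed
    then show ?thesis by simp
  qed
  have MF: "(M \<longlongrightarrow> 1) F"
  proof -
    have "((\<lambda>u. t u * ((M u - 1) / t u)) \<longlongrightarrow> 0) F"
      by (rule null_times_Bfun[OF t0 M1bd])
    moreover have "\<forall>\<^sub>F u in F. t u * ((M u - 1) / t u) = M u - 1" using ev by eventually_elim auto
    ultimately have "((\<lambda>u. M u - 1) \<longlongrightarrow> 0) F" by (rule Lim_transform_eventually)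
    then show ?thesis by (simp add: LIM_zero_iff)
  qed
  have "((\<lambda>m. m powr \<gamma>) has_field_derivative \<gamma>) (at (1::real))"
    by (auto intro!: derivative_eq_intros)
  then obtain G :: "real \<Rightarrow> real" where G: "\<And>m. m powr \<gamma> - 1 = G m * (m - 1)" "isCont G 1" "G 1 = \<gamma>"
    using CARAT_DERIV[of "\<lambda>m. m powr \<gamma>" \<gamma> 1] by auto
  have GM: "((\<lambda>u. G (M u)) \<longlongrightarrow> \<gamma>) F"
    using isCont_tendsto_compose[OF G(2) MF] G(3) by simp
  have MP: "((\<lambda>u. (M u powr \<gamma> - 1) / t u + p * (a u / t u) / s) \<longlongrightarrow> 0) F"
  proof (rule Lim_transform_eventually)
    have g0: "((\<lambda>u. G (M u) - \<gamma>) \<longlongrightarrow> 0) F" using GM by (simp add: LIM_zero_iff)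
    have "((\<lambda>u. (G (M u) - \<gamma>) * ((M u - 1) / t u)) \<longlongrightarrow> 0) F"
      by (rule null_times_Bfun[OF g0 M1bd])
    then show "((\<lambda>u. (G (M u) - \<gamma>) * ((M u - 1) / t u) + \<gamma> * ((M u - 1) / t u - (1 - p) * (a u / t u) / s)) \<longlongrightarrow> 0) F"
      using tendsto_add[OF _ tendsto_mult_left[OF M1, of \<gamma>]] by fastforce
    \<comment> \<open>The only place where the value of \<open>\<gamma>\<close> enters.\<close>
    have pg: "\<gamma> * (1 - p) = - p" using p by (simp add: \<gamma> field_simps)
    have "(G (M u) - \<gamma>) * ((M u - 1) / t u) + \<gamma> * ((M u - 1) / t u - (1 - p) * (a u / t u) / s)
       = (G (M u) * (M u - 1)) / t u - (\<gamma> * (1 - p)) * (a u / t u) / s" for u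
      by (simp add: algebra_simps diff_divide_distrib)
    then show "\<forall>\<^sub>F u in F. (G (M u) - \<gamma>) * ((M u - 1) / t u) + \<gamma> * ((M u - 1) / t u - (1 - p) * (a u / t u) / s)
        = (M u powr \<gamma> - 1) / t u + p * (a u / t u) / s"
      unfolding pg G(1) by (intro always_eventually) auto
  qed
  have Mp0: "((\<lambda>u. M u powr \<gamma>) \<longlongrightarrow> 1) F"
    using tendsto_powr[OF MF tendsto_const, of \<gamma>] by simp
  define A where "A = (\<lambda>u. (ip u u / ip (K u) u) powr \<gamma> *\<^sub>R K u)"
  define D where "D = (\<lambda>x. T x - (p * ip x \<phi> / ip \<phi> \<phi>) *\<^sub>R \<phi>)"
  have A\<phi>: "A \<phi> = \<phi>" using s by (simp add: A_def K\<phi> s_def)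
  have lim: "((\<lambda>u. nm (A u - A \<phi> - D (u - \<phi>)) / t u) \<longlongrightarrow> 0) F"
  proof (rule Lim_null_comparison)
    show "\<forall>\<^sub>F u in F. norm (nm (A u - A \<phi> - D (u - \<phi>)) / t u) \<le>
       \<bar>(M u powr \<gamma> - 1) / t u + p * (a u / t u) / s\<bar> * nm \<phi> + \<bar>M u powr \<gamma> - 1\<bar> * C
        + M u powr \<gamma> * (nm (e u) / t u)"
      using ev
    proof eventually_elim
      case (elim u)
      then have u: "u \<in> H" and tp: "0 < t u" by auto
      have hs: "ip (h u) \<phi> = a u" using ip_sym hH[OF u] \<phi> by (simp add: a_def)
      define g where "g = M u powr \<gamma>"
      have "A u - A \<phi> - D (u - \<phi>) = g *\<^sub>R (\<phi> + T (h u) + e u) - \<phi> - (T (h u) - (p * a u / s) *\<^sub>R \<phi>)"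
        unfolding A\<phi> using hs by (simp add: A_def D_def e_def h_def[symmetric] s_def[symmetric] g_def M_def Q_def)
          (simp add: h_def)
      also have "\<dots> = (g - 1 + p * a u / s) *\<^sub>R \<phi> + (g - 1) *\<^sub>R T (h u) + g *\<^sub>R e u"
        by (simp add: algebra_simps)
      finally have eq: "A u - A \<phi> - D (u - \<phi>) = (g - 1 + p * a u / s) *\<^sub>R \<phi> + (g - 1) *\<^sub>R T (h u) + g *\<^sub>R e u" .
      have "nm (A u - A \<phi> - D (u - \<phi>)) \<le> nm ((g - 1 + p * a u / s) *\<^sub>R \<phi>) + nm ((g - 1) *\<^sub>R T (h u)) + nm (g *\<^sub>R e u)"
        unfolding eq using nm_triangle[of "(g - 1 + p * a u / s) *\<^sub>R \<phi> + (g - 1) *\<^sub>R T (h u)" "g *\<^sub>R e u"]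
          nm_triangle[of "(g - 1 + p * a u / s) *\<^sub>R \<phi>" "(g - 1) *\<^sub>R T (h u)"] \<phi> hH[OF u] eH[OF u] T' by auto
      also have "\<dots> \<le> \<bar>g - 1 + p * a u / s\<bar> * nm \<phi> + \<bar>g - 1\<bar> * (C * t u) + g * nm (e u)"
        using \<phi> hH[OF u] eH[OF u] T' C(2)[OF hH[OF u]]
        by (auto simp: nm_scale t_def g_def intro!: add_mono mult_left_mono)
      finally have "nm (A u - A \<phi> - D (u - \<phi>)) / t u \<le>
          (\<bar>g - 1 + p * a u / s\<bar> * nm \<phi> + \<bar>g - 1\<bar> * (C * t u) + g * nm (e u)) / t u"
        using tp by (intro divide_right_mono) auto
      also have "\<dots> = \<bar>(g - 1 + p * a u / s) / t u\<bar> * nm \<phi> + \<bar>g - 1\<bar> * C + g * (nm (e u) / t u)"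
      proof -
        have "(\<bar>X\<bar> * nm \<phi> + \<bar>g - 1\<bar> * (C * t u) + g * nm (e u)) / t u
          = \<bar>X / t u\<bar> * nm \<phi> + \<bar>g - 1\<bar> * C + g * (nm (e u) / t u)" for X
          using tp by (simp add: abs_divide field_simps)
        then show ?thesis .
      qed
      also have "(g - 1 + p * a u / s) / t u = (g - 1) / t u + p * (a u / t u) / s"
        by (simp add: add_divide_distrib)
      finally show ?case using tp \<phi> u K T'
        by (simp add: g_def A_def D_def K\<phi>)
    qed
    have "((\<lambda>u. \<bar>(M u powr \<gamma> - 1) / t u + p * (a u / t u) / s\<bar> * nm \<phi> + \<bar>M u powr \<gamma> - 1\<bar> * C
        + M u powr \<gamma> * (nm (e u) / t u)) \<longlongrightarrow> \<bar>0\<bar> * nm \<phi> + \<bar>1 - 1\<bar> * C + 1 * 0) F"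
      by (intro tendsto_intros MP Mp0 e0)
    then show "((\<lambda>u. \<bar>(M u powr \<gamma> - 1) / t u + p * (a u / t u) / s\<bar> * nm \<phi> + \<bar>M u powr \<gamma> - 1\<bar> * C
        + M u powr \<gamma> * (nm (e u) / t u)) \<longlongrightarrow> 0) F" by simp
  qed
  show ?thesis
    unfolding A_def[symmetric] D_def[symmetric] derivative_at_def
  proof (intro allI impI)
    fix \<epsilon> :: real assume "0 < \<epsilon>"
    then have "\<forall>\<^sub>F u in F. nm (A u - A \<phi> - D (u - \<phi>)) / t u < \<epsilon>" using order_tendstoD(2)[OF lim] by blast
    then obtain \<delta> where d: "0 < \<delta>" "\<And>u. u \<in> H \<Longrightarrow> u \<noteq> \<phi> \<Longrightarrow> nm (u - \<phi>) < \<delta> \<Longrightarrow>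
        nm (A u - A \<phi> - D (u - \<phi>)) / t u < \<epsilon>" unfolding evF by blast
    have "nm (A u - A \<phi> - D (u - \<phi>)) \<le> \<epsilon> * nm (u - \<phi>)" if u: "u \<in> H" "nm (u - \<phi>) < \<delta>" for u
    proof (cases "u = \<phi>")
      case False
      then have "0 < t u" using u \<phi> by (auto simp: t_def h_def intro!: nm_pos)
      then show ?thesis using d(2)[OF u(1) False u(2)] by (simp add: t_def h_def field_simps)
    next
      case True
      have "T 0 = 0" using T'(3)[of 0 0] by simp
      then show ?thesis using True \<phi> by (simp add: D_def)
    qed
    then show "\<exists>\<delta>>0. \<forall>u\<in>H. nm (u - \<phi>) < \<delta> \<longrightarrow> nm (A u - A \<phi> - D (u - \<phi>)) \<le> \<epsilon> * nm (u - \<phi>)"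
      using d(1) by blast
  qed
qed
end

section \<open>Smooth bump functions and the fundamental lemma\<close>

definition smooth :: "('a::euclidean_space \<Rightarrow> real) \<Rightarrow> bool" where
  "smooth f \<longleftrightarrow> (\<forall>k. Ck k f)"

lemma smooth_differentiable: "smooth f \<Longrightarrow> f differentiable (at x)"
  unfolding smooth_def by (metis Ck.simps(2))

lemma smooth_continuous: "smooth f \<Longrightarrow> continuous_on A f"
  unfolding smooth_def by (metis Ck.simps(1) continuous_on_subset subset_UNIV)

lemma smooth_partial:
  "smooth f \<Longrightarrow> b \<in> Basis \<Longrightarrow> smooth (\<lambda>x. frechet_derivative f (at x) b)"
  unfolding smooth_def by (metis Ck.simps(2))

lemma smooth_has_derivative: "smooth f \<Longrightarrow> (f has_derivative frechet_derivative f (at x)) (at x)"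
  using smooth_differentiable frechet_derivative_works by blast

lemma Ck_const: "Ck k (\<lambda>x. c)"
  by (induction k arbitrary: c) (auto simp: frechet_derivative_const)

lemma Ck_add: "Ck k f \<Longrightarrow> Ck k g \<Longrightarrow> Ck k (\<lambda>x. f x + g x)"
proof (induction k arbitrary: f g)
  case (Suc k)
  have "frechet_derivative (\<lambda>x. f x + g x) (at x) = (\<lambda>b. frechet_derivative f (at x) b + frechet_derivative g (at x) b)" for x
    using Suc.prems
    by (intro frechet_derivative_at[symmetric] has_derivative_add) (auto simp: frechet_derivative_works[symmetric])
  then show ?case using Suc by auto
qed (auto intro: continuous_intros)

lemma Ck_mult: "smooth f \<Longrightarrow> smooth g \<Longrightarrow> Ck k (\<lambda>x. f x * g x)"
proof (induction k arbitrary: f g)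
  case (Suc k)
  have "frechet_derivative (\<lambda>x. f x * g x) (at x) =
      (\<lambda>b. f x * frechet_derivative g (at x) b + frechet_derivative f (at x) b * g x)" for x
    by (intro frechet_derivative_at[symmetric] has_derivative_mult smooth_has_derivative Suc.prems)
  then show ?case using Suc
    by (auto intro!: Ck_add smooth_partial differentiable_mult intro: smooth_differentiable)
qed (auto intro!: continuous_on_mult intro: smooth_continuous)

lemma smooth_const: "smooth (\<lambda>x. c)"
  by (simp add: smooth_def Ck_const)

lemma smooth_add: "smooth f \<Longrightarrow> smooth g \<Longrightarrow> smooth (\<lambda>x. f x + g x)"
  by (simp add: smooth_def Ck_add)

lemma smooth_mult: "smooth f \<Longrightarrow> smooth g \<Longrightarrow> smooth (\<lambda>x. f x * g x)"
  unfolding smooth_def[of "\<lambda>x. f x * g x"] by (simp add: Ck_mult)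

lemma smooth_prod: "(\<And>i. i \<in> I \<Longrightarrow> smooth (f i)) \<Longrightarrow> smooth (\<lambda>x. \<Prod>i\<in>I. f i x)"
  by (induction I rule: infinite_finite_induct) (auto simp: smooth_const intro!: smooth_mult)

text \<open>
A partial derivative of \<open>F j (x \<bullet> c + d)\<close> is a multiple of \<open>F (j + 1) (x \<bullet> c + d)\<close>, so the induction stays
inside the family.
\<close>

lemma smooth_of_iterated_derivatives:
  fixes c :: "'a::euclidean_space"
  assumes F: "\<And>j s. (F j has_real_derivative F (Suc j) s) (at s)"
  shows "smooth (\<lambda>x. F j (x \<bullet> c + d))"
  unfolding smooth_def
proof
  fix k show "Ck k (\<lambda>x. F j (x \<bullet> c + d))"
  proof (induction k arbitrary: j)
    case 0
    have "isCont (F j) s" for s using F DERIV_isCont by blast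
    then have c: "continuous_on UNIV (F j)" by (simp add: continuous_on_eq_continuous_at)
    have "continuous_on UNIV (\<lambda>x. x \<bullet> c + d)" by (intro continuous_intros)
    from continuous_on_compose2[OF c this] show ?case by simp
  next
    case (Suc k)
    have D: "((\<lambda>x. F j (x \<bullet> c + d)) has_derivative (\<lambda>h. F (Suc j) (x \<bullet> c + d) * (h \<bullet> c))) (at x)" for x
    proof -
      have "((\<lambda>x. x \<bullet> c + d) has_derivative (\<lambda>h. h \<bullet> c)) (at x)"
        using has_derivative_add[OF bounded_linear_imp_has_derivative[OF bounded_linear_inner_left[of c]] has_derivative_const[of d]]
        by (simp only: add_0_right)
      from DERIV_compose_FDERIV[OF F[of j "x \<bullet> c + d"] this] show ?thesis by (simp only: mult.commute)
    qed
    have "frechet_derivative (\<lambda>x. F j (x \<bullet> c + d)) (at x) = (\<lambda>h. F (Suc j) (x \<bullet> c + d) * (h \<bullet> c))" for x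
      using frechet_derivative_at[OF D] by metis
    moreover have "Ck k (\<lambda>x. F (Suc j) (x \<bullet> c + d) * (b \<bullet> c))" for b
    proof -
      have "Ck k (\<lambda>x. y * F (Suc j) (x \<bullet> c + d))" for y
      proof -
        have "Ck k f \<Longrightarrow> Ck k (\<lambda>x. y * f x)" for f :: "'a \<Rightarrow> real"
        proof (induction k arbitrary: f)
          case (Suc k)
          have "frechet_derivative (\<lambda>x. y * f x) (at x) = (\<lambda>b. y * frechet_derivative f (at x) b)" for x
            using Suc.prems
            by (intro frechet_derivative_at[symmetric] has_derivative_mult_right) (auto simp: frechet_derivative_works[symmetric])
          then show ?case using Suc by (auto intro!: differentiable_mult)
        qed (auto intro!: continuous_intros)
        then show ?thesis using Suc.IH by blast
      qed
      from this[of "b \<bullet> c"] show ?thesis by (simp add: mult.commute)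
    qed
    ultimately show ?case using D by (auto simp: differentiable_def)
  qed
qed

text \<open>
The \<open>j\<close>-th derivative of \<open>exp (- 1 / s)\<close> is \<open>P\<^sub>j(1 / s) exp (- 1 / s)\<close>: with \<open>y = 1 / s\<close>, differentiation in \<open>s\<close>
replaces \<open>P(y)\<close> by \<open>y\<^sup>2 (P(y) - P'(y))\<close>.
\<close>

primrec flat_poly :: "nat \<Rightarrow> real poly" where
  "flat_poly 0 = 1"
| "flat_poly (Suc j) = [:0, 0, 1:] * (flat_poly j - pderiv (flat_poly j))"

definition flat :: "nat \<Rightarrow> real \<Rightarrow> real" where
  "flat j s = (if 0 < s then poly (flat_poly j) (1 / s) * exp (- (1 / s)) else 0)"

lemma poly_times_exp_tendsto_0: "((\<lambda>y. poly P y * exp (- y)) \<longlongrightarrow> (0::real)) at_top"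
proof -
  have "((\<lambda>y. \<Sum>i\<le>degree P. coeff P i * (y ^ i / exp y)) \<longlongrightarrow> (\<Sum>i\<le>degree P. coeff P i * 0)) at_top"
    by (intro tendsto_intros tendsto_power_div_exp_0)
  then show ?thesis
    by (simp add: poly_altdef sum_distrib_right exp_minus field_simps sum_divide_distrib)
qed

lemma flat_DERIV: "(flat j has_real_derivative flat (Suc j) s) (at s)"
proof (cases s "0::real" rule: linorder_cases)
  case less
  have "((\<lambda>s. 0) has_real_derivative 0) (at s)" by simp
  then have "(flat j has_real_derivative 0) (at s)"
    by (rule has_field_derivative_transform_within_open[of _ _ _ "{..<0}"]) (use less in \<open>auto simp: flat_def\<close>)
  then show ?thesis using less by (simp add: flat_def[of "Suc j"])
next
  case greater
  have "((\<lambda>s. poly (flat_poly j) (1 / s) * exp (- (1 / s))) has_real_derivative flat (Suc j) s) (at s)"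
    using greater
    by (auto intro!: derivative_eq_intros DERIV_chain2[where f="poly (flat_poly j)", OF poly_DERIV]
        simp: flat_def field_simps power2_eq_square)
  then show ?thesis
    by (rule has_field_derivative_transform_within_open[of _ _ _ "{0<..}"]) (use greater in \<open>auto simp: flat_def\<close>)
next
  case equal
  have "((\<lambda>h. poly (pCons 0 (flat_poly j)) (inverse h) * exp (- inverse h)) \<longlongrightarrow> 0) (at_right 0)"
    using filterlim_compose[OF poly_times_exp_tendsto_0 filterlim_inverse_at_top_right] .
  then have R: "((\<lambda>h. flat j h / h) \<longlongrightarrow> 0) (at_right 0)"
    by (rule Lim_transform_eventually)
      (auto simp: eventually_at_filter flat_def field_simps)
  have L: "((\<lambda>h. flat j h / h) \<longlongrightarrow> 0) (at_left 0)"
    by (rule Lim_transform_eventually[OF tendsto_const]) (auto simp: eventually_at_filter flat_def)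
  have "((\<lambda>h. flat j h / h) \<longlongrightarrow> 0) (at 0)"
    using L R by (simp add: filterlim_split_at)
  then show ?thesis using equal by (simp add: has_field_derivative_iff flat_def)
qed

lemma flat_0: "flat 0 s = (if 0 < s then exp (- (1 / s)) else 0)"
  by (simp add: flat_def)

text \<open>
The shift by \<open>1\<close> leaves a margin of width \<open>1 / n\<close>, which keeps the closed support inside the open box; as
\<open>n\<close> grows the functions tend to the indicator of the box.
\<close>

definition box_bump :: "'a::euclidean_space \<Rightarrow> 'a \<Rightarrow> nat \<Rightarrow> 'a \<Rightarrow> real" where
  "box_bump a b n x = (\<Prod>i\<in>Basis. flat 0 (real n * ((x - a) \<bullet> i) - 1) * flat 0 (real n * ((b - x) \<bullet> i) - 1))"

lemma smooth_box_bump: "smooth (box_bump a b n)"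
proof -
  have "smooth (\<lambda>x::'a. flat 0 (real n * ((x - a) \<bullet> i) - 1))" "smooth (\<lambda>x::'a. flat 0 (real n * ((b - x) \<bullet> i) - 1))" for i
    using smooth_of_iterated_derivatives[where F=flat and j=0 and c="real n *\<^sub>R i" and d="- real n * (a \<bullet> i) - 1", OF flat_DERIV]
      smooth_of_iterated_derivatives[where F=flat and j=0 and c="- real n *\<^sub>R i" and d="real n * (b \<bullet> i) - 1", OF flat_DERIV]
    by (simp_all add: inner_diff_left algebra_simps)
  then show ?thesis unfolding box_bump_def[abs_def] by (intro smooth_prod smooth_mult)
qed

lemma box_bump_bounds: "0 \<le> box_bump a b n x" "box_bump a b n x \<le> 1"
proof -
  have f: "0 \<le> flat 0 s \<and> flat 0 s \<le> 1" for s by (auto simp: flat_0)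
  show "0 \<le> box_bump a b n x" unfolding box_bump_def using f by (intro prod_nonneg) auto
  show "box_bump a b n x \<le> 1" unfolding box_bump_def using f by (intro prod_le_1) (auto intro!: mult_le_one)
qed

lemma box_bump_test_function:
  assumes "box a b \<subseteq> \<Omega>"
  shows "box_bump a b n \<in> test_functions \<Omega>"
proof (cases "n = 0")
  case True
  then have "box_bump a b n = (\<lambda>x. 0)"
    by (auto simp: box_bump_def flat_0 fun_eq_iff)
  then show ?thesis by (simp add: test_functions_def Ck_const)
next
  case False
  define K where "K = cbox (a + (1 / real n) *\<^sub>R One) (b - (1 / real n) *\<^sub>R One)"
  have "{x. box_bump a b n x \<noteq> 0} \<subseteq> K"
  proof
    fix x assume "x \<in> {x. box_bump a b n x \<noteq> 0}"
    then have "\<forall>i\<in>Basis. 1 < real n * ((x - a) \<bullet> i) \<and> 1 < real n * ((b - x) \<bullet> i)"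
      by (auto simp: box_bump_def flat_0 split: if_splits)
    then show "x \<in> K" using False
      by (fastforce simp: K_def mem_box inner_diff_left inner_add_left inner_Basis field_simps inner_sum_left_Basis)
  qed
  then have cK: "closure {x. box_bump a b n x \<noteq> 0} \<subseteq> K"
    unfolding K_def by (intro closure_minimal closed_cbox)
  have "K \<subseteq> box a b" unfolding K_def using False by (auto simp: subset_box inner_diff_left inner_add_left)
  moreover have "compact (closure {x. box_bump a b n x \<noteq> 0})"
    using cK K_def by (meson bounded_cbox bounded_subset closed_closure compact_eq_bounded_closed)
  ultimately show ?thesis
    using smooth_box_bump[of a b n] assms cK by (auto simp: test_functions_def smooth_def)
qed

lemma box_bump_tendsto: "(\<lambda>n. box_bump a b n x) \<longlonglongrightarrow> indicator (box a b) x"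
proof -
  have lim: "(\<lambda>n. flat 0 (real n * s - 1)) \<longlonglongrightarrow> (if 0 < s then 1 else 0)" for s
  proof (cases "0 < s")
    case True
    have f: "filterlim (\<lambda>n. real n * s - 1) at_top sequentially"
      using True by (intro filterlim_tendsto_add_at_top[of "\<lambda>_. -1" "-1", simplified] filterlim_at_top_mult_tendsto_pos[OF tendsto_const])
        (auto simp: filterlim_real_sequentially)
    have "(\<lambda>n. exp (- (1 / (real n * s - 1)))) \<longlonglongrightarrow> exp (- 0)"
      by (intro tendsto_intros tendsto_divide_0[OF tendsto_const] filterlim_at_top_imp_at_infinity f)
    moreover have "\<forall>\<^sub>F n in sequentially. exp (- (1 / (real n * s - 1))) = flat 0 (real n * s - 1)"
      using f[unfolded filterlim_at_top_dense, rule_format, of 0] by eventually_elim (simp add: flat_0)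
    ultimately have "(\<lambda>n. flat 0 (real n * s - 1)) \<longlonglongrightarrow> exp (- 0)" by (rule Lim_transform_eventually)
    then show ?thesis using True by simp
  next
    case False
    then have "real n * s - 1 \<le> 0" for n using mult_nonneg_nonpos[of "real n" s] by linarith
    then have "flat 0 (real n * s - 1) = 0" for n by (simp add: flat_0 not_less)
    then show ?thesis using False by simp
  qed
  have "(\<lambda>n. box_bump a b n x) \<longlonglongrightarrow> (\<Prod>i\<in>Basis. (if 0 < (x - a) \<bullet> i then 1 else 0) * (if 0 < (b - x) \<bullet> i then 1 else 0))"
    unfolding box_bump_def by (intro tendsto_prod tendsto_mult lim)
  also have "(\<Prod>i\<in>Basis. (if 0 < (x - a) \<bullet> i then 1 else 0) * (if 0 < (b - x) \<bullet> i then 1 else (0::real))) = indicator (box a b) x"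
  proof (cases "x \<in> box a b")
    case False
    then obtain i where "i \<in> Basis" "\<not> (a \<bullet> i < x \<bullet> i \<and> x \<bullet> i < b \<bullet> i)" by (auto simp: mem_box)
    then show ?thesis using False by (auto simp: inner_diff_left intro!: prod_zero bexI[of _ i])
  qed (auto simp: mem_box inner_diff_left)
  finally show ?thesis .
qed

text \<open>
The measures with the positive and the negative part of \<open>f\<close> as densities agree on boxes. Boxes are stable
under intersection and generate the Borel sets, so the two measures, and hence the densities, coincide.
\<close>

lemma AE_zero_of_box_integrals:
  fixes f :: "'a::euclidean_space \<Rightarrow> real"
  assumes f: "integrable lebesgue f" and z: "\<And>a b. (\<integral>x. f x * indicator (box a b) x \<partial>lebesgue) = 0"
  shows "AE x in lebesgue. f x = 0"
proof -
  obtain g where g: "g \<in> borel_measurable lborel" and fg: "AE x in lborel. f x = g x"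
    using completion_ex_borel_measurable_real[OF borel_measurable_integrable[OF f]] by auto
  have gm [measurable]: "g \<in> borel_measurable borel" using g by simp
  have fgL: "AE x in lebesgue. f x = g x" using fg by (rule AE_completion)
  have "integrable lebesgue g"
    using f fgL gm by (subst integrable_cong_AE[of g lebesgue f]) (auto intro: borel_measurable_integrable measurable_completion)
  then have gi: "integrable lborel g" by (simp add: integrable_completion)
  have zg: "(\<integral>x. g x * indicator (box a b) x \<partial>lborel) = 0" for a b
  proof -
    have "(\<integral>x. g x * indicator (box a b) x \<partial>lborel) = (\<integral>x. g x * indicator (box a b) x \<partial>lebesgue)"
      by (simp add: integral_completion)
    also have "\<dots> = (\<integral>x. f x * indicator (box a b) x \<partial>lebesgue)"
    proof (rule integral_cong_AE)
      show "(\<lambda>x. g x * indicator (box a b) x) \<in> borel_measurable lebesgue"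
        by (intro measurable_completion) measurable
      show "(\<lambda>x. f x * indicator (box a b) x) \<in> borel_measurable lebesgue"
        using borel_measurable_integrable[OF f] by (intro borel_measurable_times borel_measurable_indicator) auto
      show "AE x in lebesgue. g x * indicator (box a b) x = f x * indicator (box a b) x"
        using fgL by eventually_elim simp
    qed
    finally show ?thesis using z by simp
  qed
  define P N where "P = (\<lambda>x. ennreal (g x))" and "N = (\<lambda>x. ennreal (- g x))"
  have [measurable]: "P \<in> borel_measurable borel" "N \<in> borel_measurable borel" by (auto simp: P_def N_def)
  have "density lborel P = density lborel N"
  proof (rule measure_eqI_generator_eq)
    let ?E = "range (\<lambda>(a, b). box a b::'a set)"
    show "Int_stable ?E" by (auto simp: Int_stable_def box_Int_box)
    show "?E \<subseteq> Pow UNIV" "sets (density lborel P) = sigma_sets UNIV ?E" "sets (density lborel N) = sigma_sets UNIV ?E"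
      by (simp_all add: borel_eq_box)
    let ?A = "\<lambda>n::nat. box (- (real n *\<^sub>R One)) (real n *\<^sub>R One) :: 'a set"
    show "range ?A \<subseteq> ?E" "(\<Union>i. ?A i) = UNIV" unfolding UN_box_eq_UNIV by auto
    have fin: "(\<integral>\<^sup>+x. P x * indicator A x \<partial>lborel) < \<infinity>" for A
    proof -
      have "(\<integral>\<^sup>+x. P x * indicator A x \<partial>lborel) \<le> (\<integral>\<^sup>+x. ennreal (norm (g x)) \<partial>lborel)"
        by (intro nn_integral_mono) (auto simp: P_def indicator_def ennreal_leI)
      also have "\<dots> < \<infinity>" using gi by (simp add: integrable_iff_bounded)
      finally show ?thesis .
    qed
    show "emeasure (density lborel P) (?A i) \<noteq> \<infinity>" for i
      using fin[of "?A i"] by (simp add: emeasure_density)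
    show "emeasure (density lborel P) X = emeasure (density lborel N) X" if "X \<in> ?E" for X
    proof -
      from \<open>X \<in> ?E\<close> obtain a b where X: "X = box a b" by auto
      define k where "k = (\<lambda>x. g x * indicator (box a b) x)"
      have ki: "integrable lborel k" using integrable_mult_indicator[OF _ gi, of "box a b"] by (simp add: k_def mult.commute)
      have 1: "(\<integral>\<^sup>+x. P x * indicator X x \<partial>lborel) = (\<integral>\<^sup>+x. ennreal (k x) \<partial>lborel)"
        by (intro nn_integral_cong) (auto simp: P_def k_def X indicator_def)
      have 2: "(\<integral>\<^sup>+x. N x * indicator X x \<partial>lborel) = (\<integral>\<^sup>+x. ennreal (- k x) \<partial>lborel)"
        by (intro nn_integral_cong) (auto simp: N_def k_def X indicator_def)
      have "enn2real (\<integral>\<^sup>+x. ennreal (k x) \<partial>lborel) = enn2real (\<integral>\<^sup>+x. ennreal (- k x) \<partial>lborel)"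
        using real_lebesgue_integral_def[OF ki] zg[of a b] by (simp add: k_def)
      moreover have "(\<integral>\<^sup>+x. ennreal (k x) \<partial>lborel) \<noteq> \<infinity>" "(\<integral>\<^sup>+x. ennreal (- k x) \<partial>lborel) \<noteq> \<infinity>"
        using ki unfolding real_integrable_def by auto
      ultimately show ?thesis using X
        by (simp add: emeasure_density 1[unfolded X] 2[unfolded X] ennreal_enn2real_if) (metis ennreal_enn2real_if infinity_ennreal_def)
    qed
  qed
  then have "AE x in lborel. P x = N x"
    by (intro sigma_finite_measure.density_unique[OF sigma_finite_lborel]) auto
  then have "AE x in lborel. g x = 0"
  proof eventually_elim
    case (elim x)
    then show ?case
      by (cases "g x" "0::real" rule: linorder_cases) (auto simp: P_def N_def ennreal_neg)
  qed
  then have "AE x in lebesgue. g x = 0" by (rule AE_completion)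
  then show ?thesis using fgL by eventually_elim simp
qed

text \<open>
Testing with \<^const>\<open>box_bump\<close> and passing to the limit shows that \<open>g\<close> has integral \<open>0\<close> over every box
inside \<open>\<Omega>\<close>. Inside one such box all intersections with further boxes are again of this kind, so \<open>g\<close> vanishes
almost everywhere on it, and countably many boxes exhaust \<open>\<Omega>\<close>.
\<close>

lemma fundamental_lemma_calculus_of_variations:
  fixes g :: "'a::euclidean_space \<Rightarrow> real"
  assumes \<Omega>: "open \<Omega>" and g: "integrable (lebesgue_on \<Omega>) g"
    and z: "\<And>\<psi>. \<psi> \<in> test_functions \<Omega> \<Longrightarrow> (\<integral>x. g x * \<psi> x \<partial>lebesgue_on \<Omega>) = 0"
  shows "AE x in lebesgue_on \<Omega>. g x = 0"
proof -
  have \<Omega>s: "\<Omega> \<in> sets lebesgue" using \<Omega> by (simp add: borel_open)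
  define G where "G = (\<lambda>x. if x \<in> \<Omega> then g x else 0)"
  have G: "integrable lebesgue G" unfolding G_def using g \<Omega>s by (simp add: Lebesgue_Measure.integrable_restrict_UNIV)
  have zb: "(\<integral>x. G x * indicator (box a b) x \<partial>lebesgue) = 0" if ab: "box a b \<subseteq> \<Omega>" for a b
  proof -
    have "(\<lambda>n. \<integral>x. G x * box_bump a b n x \<partial>lebesgue) \<longlonglongrightarrow> (\<integral>x. G x * indicator (box a b) x \<partial>lebesgue)"
    proof (rule integral_dominated_convergence[where w="\<lambda>x. \<bar>G x\<bar>"])
      show "(\<lambda>x. G x * indicator (box a b) x) \<in> borel_measurable lebesgue"
        using borel_measurable_integrable[OF G] by (intro borel_measurable_times borel_measurable_indicator) auto
      show "(\<lambda>x. G x * box_bump a b n x) \<in> borel_measurable lebesgue" for n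
        using borel_measurable_integrable[OF G] borel_measurable_continuous_onI[OF smooth_continuous[OF smooth_box_bump]]
        by (intro borel_measurable_times) (auto intro!: measurable_completion)
      show "integrable lebesgue (\<lambda>x. \<bar>G x\<bar>)" using G by auto
      show "AE x in lebesgue. (\<lambda>n. G x * box_bump a b n x) \<longlonglongrightarrow> G x * indicator (box a b) x"
        by (intro AE_I2 tendsto_intros box_bump_tendsto)
      show "AE x in lebesgue. norm (G x * box_bump a b n x) \<le> \<bar>G x\<bar>" for n
        using mult_left_le[OF box_bump_bounds(2) abs_ge_zero] by (intro AE_I2) (auto simp: abs_mult box_bump_bounds)
    qed
    moreover have "(\<integral>x. G x * box_bump a b n x \<partial>lebesgue) = 0" for n
    proof -
      have "(\<integral>x. G x * box_bump a b n x \<partial>lebesgue) = (\<integral>x. (if x \<in> \<Omega> then g x * box_bump a b n x else 0) \<partial>lebesgue)"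
        by (rule Bochner_Integration.integral_cong) (auto simp: G_def)
      also have "\<dots> = 0" using z[OF box_bump_test_function[OF ab]] \<Omega>s by (simp add: Lebesgue_Measure.integral_restrict_UNIV)
      finally show ?thesis .
    qed
    ultimately show ?thesis by (simp add: LIMSEQ_const_iff)
  qed
  have loc: "AE x in lebesgue. x \<in> box c d \<longrightarrow> g x = 0" if cd: "box c d \<subseteq> \<Omega>" for c d
  proof -
    have "AE x in lebesgue. G x * indicator (box c d) x = 0"
    proof (rule AE_zero_of_box_integrals)
      show "integrable lebesgue (\<lambda>x. G x * indicator (box c d) x)"
        using integrable_mult_indicator[OF _ G, of "box c d"] by (simp add: mult.commute)
      fix a b
      have "(\<integral>x. G x * indicator (box c d) x * indicator (box a b) x \<partial>lebesgue)
          = (\<integral>x. G x * indicator (box c d \<inter> box a b) x \<partial>lebesgue)"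
        by (rule Bochner_Integration.integral_cong) (auto simp: indicator_def)
      also have "\<dots> = 0" using cd unfolding box_Int_box by (intro zb) (auto simp: box_Int_box[symmetric])
      finally show "(\<integral>x. G x * indicator (box c d) x * indicator (box a b) x \<partial>lebesgue) = 0" .
    qed
    then show ?thesis by eventually_elim (use cd in \<open>auto simp: G_def indicator_def split: if_splits\<close>)
  qed
  define a' b' where "a' = (\<lambda>f :: 'a \<Rightarrow> real \<times> real. (\<Sum>(i::'a)\<in>Basis. fst (f i) *\<^sub>R i))"
    and "b' = (\<lambda>f :: 'a \<Rightarrow> real \<times> real. (\<Sum>(i::'a)\<in>Basis. snd (f i) *\<^sub>R i))"
  define I where "I = {f\<in>Basis \<rightarrow>\<^sub>E \<rat> \<times> \<rat>. box (a' f) (b' f) \<subseteq> \<Omega>}"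
  have U: "\<Omega> = (\<Union>f\<in>I. box (a' f) (b' f))"
    using open_UNION_box[OF \<Omega>] unfolding I_def a'_def b'_def .
  have "countable I" unfolding I_def
    by (rule countable_subset[of _ "Basis \<rightarrow>\<^sub>E \<rat> \<times> \<rat>"]) (auto intro!: countable_PiE countable_rat)
  then have "AE x in lebesgue. \<forall>f\<in>I. x \<in> box (a' f) (b' f) \<longrightarrow> g x = 0"
    by (subst AE_ball_countable) (auto simp: I_def intro!: loc)
  then have "AE x in lebesgue. x \<in> \<Omega> \<longrightarrow> g x = 0"
    by eventually_elim (use U in blast)
  then show ?thesis using \<Omega>s by (simp add: AE_restrict_space_iff)
qed

section \<open>Square integrable functions\<close>

lemma square_integrable_measurable: "square_integrable \<Omega> f \<Longrightarrow> f \<in> borel_measurable (lebesgue_on \<Omega>)"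
  by (simp add: square_integrable_def)

lemma square_integrable_bound:
  fixes f :: "'a::euclidean_space \<Rightarrow> 'b::euclidean_space"
  assumes "f \<in> borel_measurable (lebesgue_on \<Omega>)" "integrable (lebesgue_on \<Omega>) w"
    "AE x in lebesgue_on \<Omega>. (norm (f x))\<^sup>2 \<le> w x"
  shows "square_integrable \<Omega> f"
  unfolding square_integrable_def
proof
  show "integrable (lebesgue_on \<Omega>) (\<lambda>x. (norm (f x))\<^sup>2)"
    by (rule Bochner_Integration.integrable_bound[OF assms(2)]) (use assms in auto)
qed (fact assms(1))

lemma square_integrable_inner:
  fixes f g :: "'a::euclidean_space \<Rightarrow> 'b::euclidean_space"
  assumes f: "square_integrable \<Omega> f" and g: "square_integrable \<Omega> g"
  shows "integrable (lebesgue_on \<Omega>) (\<lambda>x. f x \<bullet> g x)"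
proof (rule Bochner_Integration.integrable_bound)
  show "integrable (lebesgue_on \<Omega>) (\<lambda>x. (norm (f x))\<^sup>2 + (norm (g x))\<^sup>2)"
    using f g by (auto simp: square_integrable_def)
  show "(\<lambda>x. f x \<bullet> g x) \<in> borel_measurable (lebesgue_on \<Omega>)"
    using f g by (auto simp: square_integrable_def)
  show "AE x in lebesgue_on \<Omega>. norm (f x \<bullet> g x) \<le> norm ((norm (f x))\<^sup>2 + (norm (g x))\<^sup>2)"
  proof (intro AE_I2)
    fix x
    have "\<bar>f x \<bullet> g x\<bar> \<le> norm (f x) * norm (g x)" by (rule Cauchy_Schwarz_ineq2)
    also have "\<dots> \<le> (norm (f x))\<^sup>2 + (norm (g x))\<^sup>2"
      using sum_squares_bound[of "norm (f x)" "norm (g x)"] mult_nonneg_nonneg[OF norm_ge_zero norm_ge_zero, of "f x" "g x"]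
      by linarith
    finally show "norm (f x \<bullet> g x) \<le> norm ((norm (f x))\<^sup>2 + (norm (g x))\<^sup>2)" by simp
  qed
qed

lemma square_integrable_mult:
  fixes f g :: "'a::euclidean_space \<Rightarrow> real"
  assumes "square_integrable \<Omega> f" "square_integrable \<Omega> g"
  shows "integrable (lebesgue_on \<Omega>) (\<lambda>x. f x * g x)"
  using square_integrable_inner[OF assms] by simp

lemma square_integrable_scaleR:
  "square_integrable \<Omega> f \<Longrightarrow> square_integrable \<Omega> (\<lambda>x. c *\<^sub>R f x)"
  by (auto simp: square_integrable_def power_mult_distrib)

lemma norm_add_square_le: "(norm (a + b))\<^sup>2 \<le> 2 * (norm a)\<^sup>2 + 2 * (norm b :: real)\<^sup>2" for a b :: "'b::real_normed_vector"
proof -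
  have "(norm (a + b))\<^sup>2 \<le> (norm a + norm b)\<^sup>2" by (intro power_mono norm_triangle_ineq) auto
  also have "\<dots> \<le> 2 * (norm a)\<^sup>2 + 2 * (norm b)\<^sup>2"
    using sum_squares_bound[of "norm a" "norm b"] by (simp add: power2_sum)
  finally show ?thesis .
qed

lemma square_integrable_add:
  assumes "square_integrable \<Omega> f" "square_integrable \<Omega> g"
  shows "square_integrable \<Omega> (\<lambda>x. f x + g x)"
  by (rule square_integrable_bound[where w="\<lambda>x. 2 * (norm (f x))\<^sup>2 + 2 * (norm (g x))\<^sup>2"])
    (use assms norm_add_square_le in \<open>auto simp: square_integrable_def intro!: AE_I2\<close>)

lemma square_integrable_diff:
  assumes "square_integrable \<Omega> f" "square_integrable \<Omega> g"
  shows "square_integrable \<Omega> (\<lambda>x. f x - g x)"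
  using square_integrable_add[OF assms(1) square_integrable_scaleR[OF assms(2), of "-1"]] by simp

lemma square_integrable_Pair:
  fixes f :: "'a::euclidean_space \<Rightarrow> 'b::euclidean_space" and g :: "'a \<Rightarrow> 'c::euclidean_space"
  shows "square_integrable \<Omega> (\<lambda>x. (f x, g x)) \<longleftrightarrow> square_integrable \<Omega> f \<and> square_integrable \<Omega> g"
proof
  assume fg: "square_integrable \<Omega> (\<lambda>x. (f x, g x))"
  then have m: "(\<lambda>x. (f x, g x)) \<in> borel_measurable (lebesgue_on \<Omega>)"
    and i: "integrable (lebesgue_on \<Omega>) (\<lambda>x. (norm (f x, g x))\<^sup>2)" by (auto simp: square_integrable_def)
  have "fst \<in> borel_measurable (borel :: ('b \<times> 'c) measure)" "snd \<in> borel_measurable (borel :: ('b \<times> 'c) measure)"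
    by (intro borel_measurable_continuous_onI continuous_on_fst continuous_on_snd continuous_on_id)+
  then have "f \<in> borel_measurable (lebesgue_on \<Omega>)" "g \<in> borel_measurable (lebesgue_on \<Omega>)"
    using measurable_compose[OF m, of fst borel] measurable_compose[OF m, of snd borel] by auto
  then show "square_integrable \<Omega> f \<and> square_integrable \<Omega> g"
    by (auto intro!: square_integrable_bound[OF _ i] AE_I2 simp: norm_Pair)
next
  assume "square_integrable \<Omega> f \<and> square_integrable \<Omega> g"
  then show "square_integrable \<Omega> (\<lambda>x. (f x, g x))"
    by (auto simp: square_integrable_def norm_Pair)
qed

text \<open>
Along a subsequence with squared distances below \<open>4\<^sup>-\<^sup>k\<close>, the increments \<open>d k\<close> have integrable
\<open>\<Sum>k. 2\<^sup>k \<parallel>d k\<parallel>\<^sup>2\<close>. Since \<open>\<parallel>d k\<parallel> \<le> 2\<^sup>-\<^sup>k + 2\<^sup>k \<parallel>d k\<parallel>\<^sup>2\<close>, the increments are summable almost everywhere, and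
Fatou's lemma shows that the pointwise limit is the limit in \<open>L\<^sup>2\<close>.
\<close>

lemma L2_complete:
  fixes f :: "nat \<Rightarrow> 'a::euclidean_space \<Rightarrow> 'b::euclidean_space"
  assumes sq: "\<And>n. square_integrable \<Omega> (f n)"
    and Cauchy: "\<And>e. 0 < e \<Longrightarrow> \<exists>N. \<forall>m\<ge>N. \<forall>n\<ge>N. (\<integral>x. (norm (f m x - f n x))\<^sup>2 \<partial>lebesgue_on \<Omega>) < e"
  obtains g where "square_integrable \<Omega> g" "(\<lambda>n. \<integral>x. (norm (f n x - g x))\<^sup>2 \<partial>lebesgue_on \<Omega>) \<longlonglongrightarrow> 0"
proof -
  let ?M = "lebesgue_on \<Omega>"
  have fm [measurable]: "f n \<in> borel_measurable ?M" for n using sq by (auto simp: square_integrable_def)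
  have nn: "(\<integral>\<^sup>+x. ennreal ((norm (h x))\<^sup>2) \<partial>?M) = ennreal (\<integral>x. (norm (h x))\<^sup>2 \<partial>?M)"
    if "square_integrable \<Omega> h" for h :: "'a \<Rightarrow> 'b"
    using that by (intro nn_integral_eq_integral) (auto simp: square_integrable_def)
  have "\<exists>N. \<forall>m\<ge>N. \<forall>n\<ge>N. (\<integral>x. (norm (f m x - f n x))\<^sup>2 \<partial>?M) < (1 / 4) ^ k" for k :: nat
    by (rule Cauchy) simp
  then obtain N where N: "\<And>k m n. N k \<le> m \<Longrightarrow> N k \<le> n \<Longrightarrow> (\<integral>x. (norm (f m x - f n x))\<^sup>2 \<partial>?M) < (1 / 4) ^ k"
    by metis
  \<comment> \<open>The sum dominates every earlier threshold.\<close>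
  define r where "r = (\<lambda>k. \<Sum>i\<le>k. N i)"
  have rN: "N j \<le> r k" if "j \<le> k" for j k
    unfolding r_def using that by (intro member_le_sum) auto
  define d where "d = (\<lambda>k x. f (r (Suc k)) x - f (r k) x)"
  have dm [measurable]: "d k \<in> borel_measurable ?M" for k unfolding d_def by measurable
  have d_int: "(\<integral>\<^sup>+x. ennreal ((norm (d k x))\<^sup>2) \<partial>?M) \<le> ennreal ((1/4) ^ k)" for k
  proof -
    have "(\<integral>\<^sup>+x. ennreal ((norm (d k x))\<^sup>2) \<partial>?M) = ennreal (\<integral>x. (norm (d k x))\<^sup>2 \<partial>?M)"
      unfolding d_def by (intro nn square_integrable_diff sq)
    also have "\<dots> \<le> ennreal ((1/4) ^ k)"
      unfolding d_def by (intro ennreal_leI less_imp_le[OF N] rN) auto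
    finally show ?thesis .
  qed
  have "(\<integral>\<^sup>+x. (\<Sum>k. ennreal (2 ^ k * (norm (d k x))\<^sup>2)) \<partial>?M) = (\<Sum>k. \<integral>\<^sup>+x. ennreal (2 ^ k * (norm (d k x))\<^sup>2) \<partial>?M)"
    by (intro nn_integral_suminf) measurable
  also have "\<dots> \<le> (\<Sum>k. ennreal ((1/2) ^ k))"
  proof (intro suminf_le summableI)
    fix k
    have "(\<integral>\<^sup>+x. ennreal (2 ^ k * (norm (d k x))\<^sup>2) \<partial>?M) = ennreal (2 ^ k) * (\<integral>\<^sup>+x. ennreal ((norm (d k x))\<^sup>2) \<partial>?M)"
      by (subst nn_integral_cmult[symmetric]) (auto simp: ennreal_mult)
    also have "\<dots> \<le> ennreal (2 ^ k) * ennreal ((1/4) ^ k)" by (intro mult_left_mono d_int) auto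
    also have "\<dots> = ennreal ((1/2) ^ k)" by (simp add: ennreal_mult[symmetric] power_mult_distrib[symmetric])
    finally show "(\<integral>\<^sup>+x. ennreal (2 ^ k * (norm (d k x))\<^sup>2) \<partial>?M) \<le> ennreal ((1/2) ^ k)" .
  qed
  also have "\<dots> = ennreal (\<Sum>k. (1/2) ^ k)"
    by (intro suminf_ennreal2) (auto intro!: summable_geometric)
  also have "\<dots> < \<infinity>" by simp
  finally have "(\<integral>\<^sup>+x. (\<Sum>k. ennreal (2 ^ k * (norm (d k x))\<^sup>2)) \<partial>?M) \<noteq> \<infinity>" by simp
  then have AEfin: "AE x in ?M. (\<Sum>k. ennreal (2 ^ k * (norm (d k x))\<^sup>2)) \<noteq> \<infinity>"
    by (intro nn_integral_PInf_AE) measurable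
  have AEconv: "AE x in ?M. convergent (\<lambda>k. f (r k) x)"
    using AEfin
  proof eventually_elim
    case (elim x)
    then have s1: "summable (\<lambda>k. 2 ^ k * (norm (d k x))\<^sup>2)"
      by (intro summable_suminf_not_top) auto
    have "summable (\<lambda>k. d k x)"
    proof (rule summable_comparison_test')
      show "summable (\<lambda>k. (1/2) ^ k + 2 ^ k * (norm (d k x))\<^sup>2)"
        by (intro summable_add s1 summable_geometric) auto
      fix k
      \<comment> \<open>The arithmetic-geometric mean inequality for \<open>1\<close> and \<open>2\<^sup>k \<parallel>d k x\<parallel>\<close>.\<close>
      have "2 * norm (d k x) = 2 * ((1/2)^k) * (2 ^ k * norm (d k x))" by (simp add: field_simps power_divide)
      also have "\<dots> \<le> (1/2)^k * (1 + (2 ^ k * norm (d k x))\<^sup>2)"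
        using mult_left_mono[OF sum_squares_bound[of 1 "2 ^ k * norm (d k x)"], of "(1/2)^k"] by (simp add: mult_ac)
      also have "\<dots> = (1/2) ^ k + 2 ^ k * (norm (d k x))\<^sup>2"
        by (simp add: field_simps power2_eq_square power_divide)
      also have "\<dots> \<le> 2 * \<dots>" by simp
      finally show "norm (d k x) \<le> (1/2) ^ k + 2 ^ k * (norm (d k x))\<^sup>2" by simp
    qed
    then have "convergent (\<lambda>n. \<Sum>k<n. d k x)" by (simp add: summable_iff_convergent)
    moreover have "(\<Sum>k<n. d k x) = f (r n) x - f (r 0) x" for n
      unfolding d_def by (rule sum_lessThan_telescope)
    ultimately have "convergent (\<lambda>n. (f (r n) x - f (r 0) x) + f (r 0) x)"
      by (intro convergent_add convergent_const) auto
    then show ?case by simp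
  qed
  define g where "g = (\<lambda>x. lim (\<lambda>k. f (r k) x))"
  have gm [measurable]: "g \<in> borel_measurable ?M" unfolding g_def by (rule borel_measurable_lim_metric) measurable
  have AEg: "AE x in ?M. (\<lambda>k. f (r k) x) \<longlonglongrightarrow> g x"
    using AEconv by eventually_elim (simp add: g_def convergent_LIMSEQ_iff)
  have Fatou: "(\<integral>\<^sup>+x. ennreal ((norm (f n x - g x))\<^sup>2) \<partial>?M) \<le> ennreal ((1/4) ^ j)" if n: "N j \<le> n" for n j
  proof -
    have "(\<integral>\<^sup>+x. ennreal ((norm (f n x - g x))\<^sup>2) \<partial>?M) = (\<integral>\<^sup>+x. liminf (\<lambda>k. ennreal ((norm (f n x - f (r k) x))\<^sup>2)) \<partial>?M)"
    proof (rule nn_integral_cong_AE, use AEg in eventually_elim)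
      fix x assume "(\<lambda>k. f (r k) x) \<longlonglongrightarrow> g x"
      then have "(\<lambda>k. ennreal ((norm (f n x - f (r k) x))\<^sup>2)) \<longlonglongrightarrow> ennreal ((norm (f n x - g x))\<^sup>2)"
        by (intro tendsto_ennrealI tendsto_intros)
      then show "ennreal ((norm (f n x - g x))\<^sup>2) = liminf (\<lambda>k. ennreal ((norm (f n x - f (r k) x))\<^sup>2))"
        using lim_imp_Liminf[OF sequentially_bot] by metis
    qed
    also have "\<dots> \<le> liminf (\<lambda>k. \<integral>\<^sup>+x. ennreal ((norm (f n x - f (r k) x))\<^sup>2) \<partial>?M)"
      by (intro nn_integral_liminf) measurable
    also have "\<dots> \<le> limsup (\<lambda>k. \<integral>\<^sup>+x. ennreal ((norm (f n x - f (r k) x))\<^sup>2) \<partial>?M)"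
      by (intro Liminf_le_Limsup) simp
    also have "\<dots> \<le> ennreal ((1/4) ^ j)"
    proof (rule Limsup_bounded, rule eventually_sequentiallyI[of j])
      fix k assume "j \<le> k"
      then show "(\<integral>\<^sup>+x. ennreal ((norm (f n x - f (r k) x))\<^sup>2) \<partial>?M) \<le> ennreal ((1/4) ^ j)"
        using N[OF n rN] by (subst nn) (auto intro!: square_integrable_diff sq ennreal_leI less_imp_le)
    qed
    finally show ?thesis .
  qed
  have sqd: "square_integrable \<Omega> (\<lambda>x. f n x - g x)" if "N 0 \<le> n" for n
    unfolding square_integrable_def
  proof
    show "integrable ?M (\<lambda>x. (norm (f n x - g x))\<^sup>2)"
      using Fatou[OF that] by (intro integrableI_bounded) (auto simp: less_top[symmetric] top_unique)
  qed measurable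
  have "square_integrable \<Omega> (\<lambda>x. f (N 0) x - (f (N 0) x - g x))"
    by (intro square_integrable_diff sq sqd) auto
  then have sqg: "square_integrable \<Omega> g" by simp
  have "(\<lambda>n. \<integral>x. (norm (f n x - g x))\<^sup>2 \<partial>?M) \<longlonglongrightarrow> 0"
  proof (rule LIMSEQ_I)
    fix e :: real assume "0 < e"
    then obtain j where j: "(1/4::real) ^ j < e" using real_arch_pow_inv[of e "1/4"] by auto
    show "\<exists>no. \<forall>n\<ge>no. norm ((\<integral>x. (norm (f n x - g x))\<^sup>2 \<partial>?M) - 0) < e"
    proof (intro exI[of _ "N j"] allI impI)
      fix n assume n: "N j \<le> n"
      have "ennreal (\<integral>x. (norm (f n x - g x))\<^sup>2 \<partial>?M) \<le> ennreal ((1/4) ^ j)"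
        using Fatou[OF n] nn[OF square_integrable_diff[OF sq sqg]] by simp
      then have "(\<integral>x. (norm (f n x - g x))\<^sup>2 \<partial>?M) \<le> (1/4) ^ j"
        by (subst (asm) ennreal_le_iff) auto
      then show "norm ((\<integral>x. (norm (f n x - g x))\<^sup>2 \<partial>?M) - 0) < e" using j by simp
    qed
  qed
  then show thesis using that sqg by blast
qed

section \<open>Test functions and integration by parts\<close>

lemma test_functionsD:
  assumes "\<psi> \<in> test_functions \<Omega>"
  shows "smooth \<psi>" "\<And>x. x \<notin> \<Omega> \<Longrightarrow> \<psi> x = 0"
    "\<exists>R. \<forall>x. R \<le> norm x \<longrightarrow> \<psi> x = 0"
proof -
  show "smooth \<psi>" using assms by (simp add: test_functions_def smooth_def)
  have sub: "{x. \<psi> x \<noteq> 0} \<subseteq> closure {x. \<psi> x \<noteq> 0}" by (rule closure_subset)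
  show "\<psi> x = 0" if "x \<notin> \<Omega>" for x using assms that sub by (auto simp: test_functions_def)
  have "bounded (closure {x. \<psi> x \<noteq> 0})" using assms compact_imp_bounded by (auto simp: test_functions_def)
  then obtain R where "\<forall>x\<in>closure {x. \<psi> x \<noteq> 0}. norm x \<le> R" unfolding bounded_iff by blast
  then have "\<forall>x. R + 1 \<le> norm x \<longrightarrow> \<psi> x = 0" using sub by force
  then show "\<exists>R. \<forall>x. R \<le> norm x \<longrightarrow> \<psi> x = 0" by blast
qed

lemma compact_closure_subset: "closure S \<subseteq> K \<Longrightarrow> compact K \<Longrightarrow> compact (closure S)" for S :: "'a::euclidean_space set"
  using bounded_subset closed_closure compact_eq_bounded_closed by blast

lemma test_functions_closure_mono:
  assumes "\<psi> \<in> test_functions \<Omega>" "smooth f" "{x. f x \<noteq> 0} \<subseteq> closure {x. \<psi> x \<noteq> 0}"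
  shows "f \<in> test_functions \<Omega>"
proof -
  have "closure {x. f x \<noteq> 0} \<subseteq> closure {x. \<psi> x \<noteq> 0}"
    using assms(3) by (intro closure_minimal) auto
  moreover have "compact (closure {x. f x \<noteq> 0})"
    using assms(1) by (intro compact_closure_subset[OF calculation]) (simp add: test_functions_def)
  ultimately show ?thesis using assms by (auto simp: test_functions_def smooth_def)
qed

lemma frechet_derivative_zero_outside:
  assumes "x \<notin> closure {x. f x \<noteq> (0::real)}"
  shows "frechet_derivative f (at x) = (\<lambda>b. 0)"
proof -
  have "((\<lambda>x. 0) has_derivative (\<lambda>b. 0)) (at x)" by simp
  then have "(f has_derivative (\<lambda>b. 0)) (at x)"
    by (rule has_derivative_transform_within_open[of _ _ _ _ "- closure {x. f x \<noteq> 0}"])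
      (use assms closure_subset[of "{x. f x \<noteq> 0}"] in auto)
  from frechet_derivative_at[OF this] show ?thesis by simp
qed

lemma test_functions_partial:
  assumes "\<psi> \<in> test_functions \<Omega>" "b \<in> Basis"
  shows "(\<lambda>x. frechet_derivative \<psi> (at x) b) \<in> test_functions \<Omega>"
  by (rule test_functions_closure_mono[OF assms(1) smooth_partial[OF test_functionsD(1)[OF assms(1)] assms(2)]])
    (use frechet_derivative_zero_outside[of _ \<psi>] in fastforce)

lemma test_functions_add:
  assumes f: "f \<in> test_functions \<Omega>" and g: "g \<in> test_functions \<Omega>"
  shows "(\<lambda>x. f x + g x) \<in> test_functions \<Omega>"
proof -
  have sub: "closure {x. f x + g x \<noteq> 0} \<subseteq> closure {x. f x \<noteq> 0} \<union> closure {x. g x \<noteq> 0}"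
    unfolding closure_Un[symmetric] by (intro closure_mono) auto
  have "compact (closure {x. f x \<noteq> 0} \<union> closure {x. g x \<noteq> 0})"
    using f g by (auto simp: test_functions_def)
  with sub have "compact (closure {x. f x + g x \<noteq> 0})"
    by (rule compact_closure_subset)
  moreover have "closure {x. f x + g x \<noteq> 0} \<subseteq> \<Omega>"
    using f g sub by (auto simp: test_functions_def)
  moreover have "smooth (\<lambda>x. f x + g x)" using f g by (intro smooth_add) (auto simp: test_functions_def smooth_def)
  ultimately show ?thesis by (simp add: test_functions_def smooth_def)
qed

lemma test_functions_scale:
  assumes f: "f \<in> test_functions \<Omega>"
  shows "(\<lambda>x. c * f x) \<in> test_functions \<Omega>"
  by (rule test_functions_closure_mono[OF f])
    (use test_functionsD(1)[OF f] closure_subset[of "{x. f x \<noteq> 0}"] in \<open>auto intro!: smooth_mult smooth_const\<close>)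

lemma integrable_continuous_support:
  fixes f :: "'a::euclidean_space \<Rightarrow> real"
  assumes f: "continuous_on UNIV f" and R: "\<And>x. R \<le> norm x \<Longrightarrow> f x = 0"
  shows "integrable lborel f"
proof -
  have "integrable lborel (\<lambda>x. indicator (cball 0 R) x *\<^sub>R f x)"
    by (rule borel_integrable_compact) (use f continuous_on_subset in auto)
  also have "(\<lambda>x. indicator (cball 0 R) x *\<^sub>R f x) = f"
    using R by (auto simp: fun_eq_iff indicator_def)
  finally show ?thesis .
qed

lemma bounded_continuous_support:
  fixes f :: "'a::euclidean_space \<Rightarrow> real"
  assumes f: "continuous_on UNIV f" and R: "\<And>x. R \<le> norm x \<Longrightarrow> f x = 0"
  obtains B where "0 < B" "\<And>x. \<bar>f x\<bar> \<le> B"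
proof -
  have "compact (f ` cball 0 R)" using f continuous_on_subset by (intro compact_continuous_image) auto
  then obtain B where B: "\<forall>y\<in>f ` cball 0 R. norm y \<le> B" using compact_imp_bounded bounded_iff by metis
  have "\<bar>f x\<bar> \<le> max B 1" for x
  proof (cases "norm x \<le> R")
    case True
    then have "norm (f x) \<le> B" using B by (simp add: dist_norm)
    then show ?thesis by simp
  qed (use R[of x] in auto)
  then show thesis using that[of "max B 1"] by auto
qed

lemma integral_lebesgue_on_support:
  fixes f :: "'a::euclidean_space \<Rightarrow> real"
  assumes \<Omega>: "\<Omega> \<in> sets lebesgue" and f: "integrable lborel f" "\<And>x. x \<notin> \<Omega> \<Longrightarrow> f x = 0"
  shows "integrable (lebesgue_on \<Omega>) f" "(\<integral>x. f x \<partial>lebesgue_on \<Omega>) = (\<integral>x. f x \<partial>lborel)"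
proof -
  have eq: "(\<lambda>x. if x \<in> \<Omega> then f x else 0) = f" using f(2) by auto
  have i: "integrable lebesgue f" using f(1) by (simp add: integrable_completion)
  then show "integrable (lebesgue_on \<Omega>) f"
    using Lebesgue_Measure.integrable_restrict_UNIV[OF \<Omega>, of f] eq by simp
  show "(\<integral>x. f x \<partial>lebesgue_on \<Omega>) = (\<integral>x. f x \<partial>lborel)"
    using Lebesgue_Measure.integral_restrict_UNIV[OF \<Omega>, of f] eq borel_measurable_integrable[OF f(1)]
    by (simp add: integral_completion)
qed

lemma test_function_square_integrable:
  assumes \<Omega>: "\<Omega> \<in> sets lebesgue" and \<psi>: "\<psi> \<in> test_functions \<Omega>"
  shows "square_integrable \<Omega> \<psi>"
proof -
  note T = test_functionsD[OF \<psi>]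
  obtain R where R: "\<And>x. R \<le> norm x \<Longrightarrow> \<psi> x = 0" using T(3) by blast
  have "integrable lborel \<psi>" "integrable lborel (\<lambda>x. (\<psi> x)\<^sup>2)"
    unfolding power2_eq_square using R
    by (auto intro!: integrable_continuous_support[of _ R] continuous_on_mult smooth_continuous[OF T(1)])
  then show ?thesis
    using integral_lebesgue_on_support(1)[OF \<Omega>, of \<psi>] integral_lebesgue_on_support(1)[OF \<Omega>, of "\<lambda>x. (\<psi> x)\<^sup>2"] T(2)
    by (auto simp: square_integrable_def)
qed

text \<open>
Difference quotients of \<open>f\<close> have integral \<open>0\<close> by translation invariance. They are bounded by the maximum of
the derivative and supported in a fixed ball, so dominated convergence applies.
\<close>

lemma integral_partial_derivative_zero:
  fixes f :: "'a::euclidean_space \<Rightarrow> real"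
  assumes f: "smooth f" and R: "\<And>x. R \<le> norm x \<Longrightarrow> f x = 0" and b: "b \<in> Basis"
  shows "(\<integral>x. frechet_derivative f (at x) b \<partial>lborel) = 0"
proof -
  define D where "D = (\<lambda>x. frechet_derivative f (at x) b)"
  have cD: "continuous_on UNIV D" unfolding D_def by (rule smooth_continuous[OF smooth_partial[OF f b]])
  have cf: "continuous_on UNIV f" by (rule smooth_continuous[OF f])
  have [measurable]: "D \<in> borel_measurable borel" "f \<in> borel_measurable borel"
    using cD cf by (auto intro: borel_measurable_continuous_onI)
  have D0: "D x = 0" if "R + 1 \<le> norm x" for x
  proof -
    have "open {x::'a. R < norm x}" by (intro open_Collect_less continuous_intros)
    moreover have "{x. f x \<noteq> 0} \<subseteq> - {x. R < norm x}" using R by (auto simp: not_less)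
    ultimately have "closure {x. f x \<noteq> 0} \<subseteq> - {x. R < norm x}"
      by (intro closure_minimal) (auto simp: closed_Compl)
    then have "x \<notin> closure {x. f x \<noteq> 0}" using that by auto
    from frechet_derivative_zero_outside[OF this] show ?thesis by (simp add: D_def)
  qed
  obtain B where B: "0 < B" "\<And>x. \<bar>D x\<bar> \<le> B" using bounded_continuous_support[OF cD D0] by metis
  define q where "q = (\<lambda>n x. (f (x + (1 / real (Suc n)) *\<^sub>R b) - f x) / (1 / real (Suc n)))"
  have line: "((\<lambda>t. f (x + t *\<^sub>R b)) has_real_derivative D (x + t *\<^sub>R b)) (at t)" for x t
  proof -
    have "((\<lambda>t. f (x + t *\<^sub>R b)) has_derivative (\<lambda>h. frechet_derivative f (at (x + t *\<^sub>R b)) (h *\<^sub>R b))) (at t)"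
    proof (rule has_derivative_compose[of _ _ t _ f])
      show "((\<lambda>t. x + t *\<^sub>R b) has_derivative (\<lambda>h. h *\<^sub>R b)) (at t)" by (auto intro!: derivative_eq_intros)
      show "(f has_derivative frechet_derivative f (at (x + t *\<^sub>R b))) (at (x + t *\<^sub>R b))"
        by (rule smooth_has_derivative[OF f])
    qed
    moreover have "frechet_derivative f (at y) (h *\<^sub>R b) = h * D y" for h y
      using linear_cmul[OF linear_frechet_derivative[OF smooth_differentiable[OF f]]] by (simp add: D_def)
    moreover have "(\<lambda>h. h * D y) = (*) (D y)" for y by (auto simp: mult.commute)
    ultimately show ?thesis by (simp add: has_field_derivative_def)
  qed
  have q_lim: "(\<lambda>n. q n x) \<longlonglongrightarrow> D x" for x
  proof -
    have "((\<lambda>h. (f (x + (0 + h) *\<^sub>R b) - f (x + 0 *\<^sub>R b)) / h) \<longlongrightarrow> D (x + 0 *\<^sub>R b)) (at 0)"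
      using line[of x 0] by (simp add: DERIV_def)
    moreover have "filterlim (\<lambda>n. 1 / real (Suc n)) (at 0) sequentially"
      unfolding filterlim_at using LIMSEQ_Suc[OF lim_1_over_n] by auto
    ultimately have "(\<lambda>n. (f (x + (0 + 1 / real (Suc n)) *\<^sub>R b) - f (x + 0 *\<^sub>R b)) / (1 / real (Suc n))) \<longlonglongrightarrow> D (x + 0 *\<^sub>R b)"
      by (rule filterlim_compose)
    then show ?thesis by (simp add: q_def)
  qed
  have q_bound: "\<bar>q n x\<bar> \<le> B" for n x
  proof -
    have "\<exists>z. z > 0 \<and> z < 1 / real (Suc n) \<and> f (x + (1 / real (Suc n)) *\<^sub>R b) - f (x + 0 *\<^sub>R b)
        = (1 / real (Suc n) - 0) * D (x + z *\<^sub>R b)"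
      by (rule MVT2[of 0 "1 / real (Suc n)" "\<lambda>t. f (x + t *\<^sub>R b)"]) (auto intro!: line)
    then obtain z where "f (x + (1 / real (Suc n)) *\<^sub>R b) - f x = (1 / real (Suc n)) * D (x + z *\<^sub>R b)" by auto
    then have "q n x = D (x + z *\<^sub>R b)" by (simp add: q_def)
    then show ?thesis using B by simp
  qed
  have q0: "q n x = 0" if "\<bar>R\<bar> + 1 \<le> norm x" for n x
  proof -
    have "norm x - norm ((1 / real (Suc n)) *\<^sub>R b) \<le> norm (x + (1 / real (Suc n)) *\<^sub>R b)"
      by (metis add.commute norm_diff_ineq)
    moreover have "norm ((1 / real (Suc n)) *\<^sub>R b) \<le> 1" using b by (simp add: field_simps)
    ultimately have "R \<le> norm (x + (1 / real (Suc n)) *\<^sub>R b)" "R \<le> norm x" using that by linarith+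
    then show ?thesis by (simp add: q_def R)
  qed
  have "(\<lambda>n. \<integral>x. q n x \<partial>lborel) \<longlonglongrightarrow> (\<integral>x. D x \<partial>lborel)"
  proof (rule integral_dominated_convergence[where w="\<lambda>x. B * indicator (cball 0 (\<bar>R\<bar> + 1)) x"])
    show "D \<in> borel_measurable lborel" by simp
    show "q n \<in> borel_measurable lborel" for n unfolding q_def by measurable
    show "integrable lborel (\<lambda>x. B * indicator (cball (0::'a) (\<bar>R\<bar> + 1)) x)"
      using emeasure_bounded_finite[OF bounded_cball, of "0::'a" "\<bar>R\<bar> + 1"]
      by (intro integrable_mult_right integrable_real_indicator) auto
    show "AE x in lborel. (\<lambda>n. q n x) \<longlonglongrightarrow> D x" using q_lim by (intro AE_I2)
    show "AE x in lborel. norm (q n x) \<le> B * indicator (cball 0 (\<bar>R\<bar> + 1)) x" for n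
      using q_bound q0 by (intro AE_I2) (auto simp: indicator_def)
  qed
  moreover have "(\<integral>x. q n x \<partial>lborel) = 0" for n
  proof -
    have fi: "integrable lborel f" by (rule integrable_continuous_support[OF cf R])
    define c where "c = (1 / real (Suc n)) *\<^sub>R b"
    have d: "distr lborel borel ((+) c) = lborel" by (rule lborel_distr_plus)
    have "integrable (distr lborel borel ((+) c)) f" using fi d by simp
    then have fi2: "integrable lborel (\<lambda>x. f (c + x))" by (subst (asm) integrable_distr_eq) auto
    have "(\<integral>x. f x \<partial>distr lborel borel ((+) c)) = (\<integral>x. f (c + x) \<partial>lborel)"
      by (rule integral_distr) auto
    then have "(\<integral>x. f (c + x) \<partial>lborel) = (\<integral>x. f x \<partial>lborel)" by (simp add: d)
    then have "(\<integral>x. f (c + x) - f x \<partial>lborel) = 0" using fi fi2 by simp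
    moreover have "(\<integral>x. q n x \<partial>lborel) = (\<integral>x. f (c + x) - f x \<partial>lborel) / (1 / real (Suc n))"
      unfolding q_def c_def by (simp add: add.commute)
    ultimately show ?thesis by simp
  qed
  ultimately show ?thesis by (simp add: LIMSEQ_const_iff D_def)
qed

lemma integration_by_parts_test_function:
  assumes \<Omega>: "\<Omega> \<in> sets lebesgue" and \<psi>: "\<psi> \<in> test_functions \<Omega>" and \<eta>: "\<eta> \<in> test_functions \<Omega>" and b: "b \<in> Basis"
  shows "(\<integral>x. \<psi> x * frechet_derivative \<eta> (at x) b \<partial>lebesgue_on \<Omega>)
     = - (\<integral>x. frechet_derivative \<psi> (at x) b * \<eta> x \<partial>lebesgue_on \<Omega>)"
proof -
  note T = test_functionsD[OF \<psi>] and U = test_functionsD[OF \<eta>]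
  note T' = test_functionsD[OF test_functions_partial[OF \<psi> b]] and U' = test_functionsD[OF test_functions_partial[OF \<eta> b]]
  obtain R where R: "\<And>x. R \<le> norm x \<Longrightarrow> \<psi> x = 0" using T(3) by blast
  obtain S where S: "\<And>x. S \<le> norm x \<Longrightarrow> \<eta> x = 0" using U(3) by blast
  have D: "frechet_derivative (\<lambda>x. \<psi> x * \<eta> x) (at x) =
      (\<lambda>b. \<psi> x * frechet_derivative \<eta> (at x) b + frechet_derivative \<psi> (at x) b * \<eta> x)" for x
    by (intro frechet_derivative_at[symmetric] has_derivative_mult smooth_has_derivative T U)
  have z: "(\<integral>x. \<psi> x * frechet_derivative \<eta> (at x) b + frechet_derivative \<psi> (at x) b * \<eta> x \<partial>lborel) = 0"
    using integral_partial_derivative_zero[OF smooth_mult[OF T(1) U(1)] _ b, of R] R by (simp add: D)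
  have i1: "integrable lborel (\<lambda>x. \<psi> x * frechet_derivative \<eta> (at x) b)"
    using R by (intro integrable_continuous_support[of _ R] continuous_on_mult smooth_continuous T U') auto
  have i2: "integrable lborel (\<lambda>x. frechet_derivative \<psi> (at x) b * \<eta> x)"
    using S by (intro integrable_continuous_support[of _ S] continuous_on_mult smooth_continuous T' U) auto
  show ?thesis
    using z i1 i2 integral_lebesgue_on_support(2)[OF \<Omega> i1] integral_lebesgue_on_support(2)[OF \<Omega> i2] T(2) U(2) by simp
qed

section \<open>Sobolev spaces as Hilbert spaces\<close>

lemma rep_abs_aefun: "AE x in lebesgue. rep_aefun (abs_aefun f) x = f x"
  using aefun.abs_eq_iff Quotient_abs_rep[OF Quotient_aefun] by metis

lemma aefun_eqI: "(AE x in lebesgue. rep_aefun u x = rep_aefun v x) \<Longrightarrow> u = v"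
  using aefun.abs_eq_iff Quotient_abs_rep[OF Quotient_aefun] by metis

lemma rep_aefun_add: "AE x in lebesgue. rep_aefun (u + v) x = rep_aefun u x + rep_aefun v x"
  using rep_abs_aefun[of "\<lambda>x. rep_aefun u x + rep_aefun v x"]
  by (simp add: plus_aefun.abs_eq[symmetric] Quotient_abs_rep[OF Quotient_aefun])

lemma rep_aefun_scaleR: "AE x in lebesgue. rep_aefun (c *\<^sub>R u) x = c * rep_aefun u x"
  using rep_abs_aefun[of "\<lambda>x. c * rep_aefun u x"]
  by (simp add: scaleR_aefun.abs_eq[symmetric] Quotient_abs_rep[OF Quotient_aefun])

lemma rep_aefun_zero: "AE x in lebesgue. rep_aefun 0 x = 0"
  using rep_abs_aefun[of "\<lambda>x. 0"] by (simp add: zero_aefun_def)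

lemma tendsto_zero_of_square:
  fixes f :: "nat \<Rightarrow> real"
  assumes "(\<lambda>n. (f n)\<^sup>2) \<longlonglongrightarrow> 0"
  shows "f \<longlonglongrightarrow> 0"
  using tendsto_real_sqrt[OF assms] by (simp add: tendsto_rabs_zero_iff)

definition grad :: "('a::euclidean_space \<Rightarrow> real) \<Rightarrow> 'a \<Rightarrow> 'a" where
  "grad f x = (\<Sum>b\<in>Basis. frechet_derivative f (at x) b *\<^sub>R b)"

lemma grad_inner: "b \<in> Basis \<Longrightarrow> grad f x \<bullet> b = frechet_derivative f (at x) b"
  by (simp add: grad_def)

locale bounded_open_set =
  fixes \<Omega> :: "'a::euclidean_space set"
  assumes open_\<Omega>: "open \<Omega>" and bounded_\<Omega>: "bounded \<Omega>"
begin

abbreviation M where "M \<equiv> lebesgue_on \<Omega>"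

lemma sets_\<Omega>: "\<Omega> \<in> sets lebesgue"
  using open_\<Omega> by (simp add: borel_open)

lemma AE_M: "(AE x in lebesgue. P x) \<Longrightarrow> AE x in M. P x"
  using sets_\<Omega> by (auto simp: AE_restrict_space_iff elim: eventually_mono)

lemma measurable_cong_AE_M:
  fixes f g :: "'a \<Rightarrow> 'b::euclidean_space"
  assumes f: "f \<in> borel_measurable M" and fg: "AE x in M. f x = g x"
  shows "g \<in> borel_measurable M"
proof -
  have "(\<lambda>x. if x \<in> \<Omega> then f x else 0) \<in> borel_measurable lebesgue"
    using f by (simp add: borel_measurable_if[OF sets_\<Omega>])
  moreover have "AE x in lebesgue. (if x \<in> \<Omega> then f x else 0) = (if x \<in> \<Omega> then g x else 0)"
    using fg sets_\<Omega> by (auto simp: AE_restrict_space_iff elim: eventually_mono)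
  ultimately have "(\<lambda>x. if x \<in> \<Omega> then g x else 0) \<in> borel_measurable lebesgue" by (rule borel_measurable_AE)
  then show ?thesis by (simp add: borel_measurable_if[OF sets_\<Omega>])
qed

lemma square_integrable_cong:
  fixes f g :: "'a \<Rightarrow> 'b::euclidean_space"
  assumes f: "square_integrable \<Omega> f" and fg: "AE x in M. f x = g x"
  shows "square_integrable \<Omega> g"
proof (rule square_integrable_bound)
  show "g \<in> borel_measurable M" by (rule measurable_cong_AE_M[OF square_integrable_measurable[OF f] fg])
  show "integrable M (\<lambda>x. (norm (f x))\<^sup>2)" using f by (simp add: square_integrable_def)
  show "AE x in M. (norm (g x))\<^sup>2 \<le> (norm (f x))\<^sup>2" using fg by eventually_elim simp
qed

lemma square_integrable_imp_integrable:
  fixes f :: "'a \<Rightarrow> real"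
  assumes "square_integrable \<Omega> f"
  shows "integrable M f"
proof -
  have "finite_measure M"
    using bounded_\<Omega> sets_\<Omega> by (intro finite_measure_lebesgue_on bounded_set_imp_lmeasurable)
  then interpret finite_measure M .
  have "square_integrable \<Omega> (\<lambda>x. 1 :: real)" by (simp add: square_integrable_def)
  from square_integrable_mult[OF assms this] show ?thesis by simp
qed

lemma L2_Cauchy_Schwarz:
  fixes f g :: "'a \<Rightarrow> 'b::euclidean_space"
  assumes f: "square_integrable \<Omega> f" and g: "square_integrable \<Omega> g"
  shows "(\<integral>x. f x \<bullet> g x \<partial>M)\<^sup>2 \<le> (\<integral>x. (norm (f x))\<^sup>2 \<partial>M) * (\<integral>x. (norm (g x))\<^sup>2 \<partial>M)"
proof (rule quadratic_nonneg_imp_discriminant)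
  fix t :: real
  have i: "integrable M (\<lambda>x. (norm (f x))\<^sup>2)" "integrable M (\<lambda>x. (norm (g x))\<^sup>2)" "integrable M (\<lambda>x. f x \<bullet> g x)"
    using f g square_integrable_inner[OF f g] by (auto simp: square_integrable_def)
  have "0 \<le> (\<integral>x. (norm (f x + t *\<^sub>R g x))\<^sup>2 \<partial>M)" by simp
  also have "(\<lambda>x. (norm (f x + t *\<^sub>R g x))\<^sup>2) = (\<lambda>x. (norm (f x))\<^sup>2 + 2 * t * (f x \<bullet> g x) + t\<^sup>2 * (norm (g x))\<^sup>2)"
    by (simp only: power2_norm_eq_inner inner_add_left inner_add_right inner_scaleR_left inner_scaleR_right)
      (simp add: inner_commute algebra_simps power2_eq_square)
  also have "(\<integral>x. (norm (f x))\<^sup>2 + 2 * t * (f x \<bullet> g x) + t\<^sup>2 * (norm (g x))\<^sup>2 \<partial>M) =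
     (\<integral>x. (norm (f x))\<^sup>2 \<partial>M) + 2 * (\<integral>x. f x \<bullet> g x \<partial>M) * t + (\<integral>x. (norm (g x))\<^sup>2 \<partial>M) * t\<^sup>2"
    using i by simp
  finally show "0 \<le> (\<integral>x. (norm (f x))\<^sup>2 \<partial>M) + 2 * (\<integral>x. f x \<bullet> g x \<partial>M) * t + (\<integral>x. (norm (g x))\<^sup>2 \<partial>M) * t\<^sup>2" .
qed simp

lemma L2_limit_inner:
  fixes f :: "nat \<Rightarrow> 'a \<Rightarrow> 'b::euclidean_space"
  assumes f: "\<And>n. square_integrable \<Omega> (f n)" and g: "square_integrable \<Omega> g" and k: "square_integrable \<Omega> k"
    and lim: "(\<lambda>n. \<integral>x. (norm (f n x - g x))\<^sup>2 \<partial>M) \<longlonglongrightarrow> 0"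
  shows "(\<lambda>n. \<integral>x. f n x \<bullet> k x \<partial>M) \<longlonglongrightarrow> (\<integral>x. g x \<bullet> k x \<partial>M)"
proof -
  have "(\<lambda>n. ((\<integral>x. f n x \<bullet> k x \<partial>M) - (\<integral>x. g x \<bullet> k x \<partial>M))\<^sup>2) \<longlonglongrightarrow> 0"
  proof (rule Lim_null_comparison)
    show "\<forall>\<^sub>F n in sequentially. norm (((\<integral>x. f n x \<bullet> k x \<partial>M) - (\<integral>x. g x \<bullet> k x \<partial>M))\<^sup>2)
        \<le> (\<integral>x. (norm (f n x - g x))\<^sup>2 \<partial>M) * (\<integral>x. (norm (k x))\<^sup>2 \<partial>M)"
    proof (intro always_eventually allI)
      fix n
      have "(\<integral>x. f n x \<bullet> k x \<partial>M) - (\<integral>x. g x \<bullet> k x \<partial>M) = (\<integral>x. (f n x - g x) \<bullet> k x \<partial>M)"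
        using square_integrable_inner[OF f k] square_integrable_inner[OF g k] by (simp add: inner_diff_left)
      then show "norm (((\<integral>x. f n x \<bullet> k x \<partial>M) - (\<integral>x. g x \<bullet> k x \<partial>M))\<^sup>2)
        \<le> (\<integral>x. (norm (f n x - g x))\<^sup>2 \<partial>M) * (\<integral>x. (norm (k x))\<^sup>2 \<partial>M)"
        using L2_Cauchy_Schwarz[OF square_integrable_diff[OF f g] k] by simp
    qed
    show "(\<lambda>n. (\<integral>x. (norm (f n x - g x))\<^sup>2 \<partial>M) * (\<integral>x. (norm (k x))\<^sup>2 \<partial>M)) \<longlonglongrightarrow> 0"
      using tendsto_mult_right[OF lim] by simp
  qed
  then have "(\<lambda>n. (\<integral>x. f n x \<bullet> k x \<partial>M) - (\<integral>x. g x \<bullet> k x \<partial>M)) \<longlonglongrightarrow> 0"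
    by (rule tendsto_zero_of_square)
  then show ?thesis by (simp add: LIM_zero_iff)
qed

lemma test_function_in_L2: "\<psi> \<in> test_functions \<Omega> \<Longrightarrow> square_integrable \<Omega> \<psi>"
  by (rule test_function_square_integrable[OF sets_\<Omega>])

lemma square_integrable_component:
  fixes G :: "'a \<Rightarrow> 'b::euclidean_space"
  assumes G: "square_integrable \<Omega> G" and b: "b \<in> Basis"
  shows "square_integrable \<Omega> (\<lambda>x. G x \<bullet> b)"
proof (rule square_integrable_bound[where w="\<lambda>x. (norm (G x))\<^sup>2"])
  show "AE x in M. (norm (G x \<bullet> b))\<^sup>2 \<le> (norm (G x))\<^sup>2"
    using Basis_le_norm[OF b] by (intro AE_I2 power_mono) auto
qed (use G in \<open>auto simp: square_integrable_def\<close>)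

text \<open>
With integration by parts moved to one side, \<open>G\<close> is the weak gradient of \<open>u\<close> precisely when the pair
\<open>(u, G)\<close> is orthogonal in \<open>L\<^sup>2\<close> to all these functions. Written this way the condition is visibly linear and
closed, which is why \<open>H\<^sup>1(\<Omega>)\<close> is a subspace and complete.
\<close>

definition test_jet :: "('a \<Rightarrow> real) \<Rightarrow> 'a \<Rightarrow> 'a \<Rightarrow> real \<times> 'a" where
  "test_jet \<psi> b x = (frechet_derivative \<psi> (at x) b, \<psi> x *\<^sub>R b)"

lemma test_jet_sq: "\<psi> \<in> test_functions \<Omega> \<Longrightarrow> b \<in> Basis \<Longrightarrow> square_integrable \<Omega> (test_jet \<psi> b)"
  unfolding test_jet_def[abs_def] square_integrable_Pair
proof
  assume \<psi>: "\<psi> \<in> test_functions \<Omega>" and b: "b \<in> Basis"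
  show "square_integrable \<Omega> (\<lambda>x. frechet_derivative \<psi> (at x) b)"
    by (intro test_function_in_L2 test_functions_partial \<psi> b)
  show "square_integrable \<Omega> (\<lambda>x. \<psi> x *\<^sub>R b)"
    using test_function_in_L2[OF \<psi>] b by (auto simp: square_integrable_def)
qed

lemma is_weak_gradient_iff:
  assumes u: "square_integrable \<Omega> (rep_aefun u)"
  shows "is_weak_gradient \<Omega> u G \<longleftrightarrow> square_integrable \<Omega> G \<and>
    (\<forall>\<psi>\<in>test_functions \<Omega>. \<forall>b\<in>Basis. (\<integral>x. (rep_aefun u x, G x) \<bullet> test_jet \<psi> b x \<partial>M) = 0)"
proof -
  have "((\<integral>x. rep_aefun u x * frechet_derivative \<psi> (at x) b \<partial>M) = - (\<integral>x. (G x \<bullet> b) * \<psi> x \<partial>M))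
     \<longleftrightarrow> (\<integral>x. (rep_aefun u x, G x) \<bullet> test_jet \<psi> b x \<partial>M) = 0"
    if "square_integrable \<Omega> G" "\<psi> \<in> test_functions \<Omega>" "b \<in> Basis" for \<psi> b
  proof -
    have "integrable M (\<lambda>x. rep_aefun u x * frechet_derivative \<psi> (at x) b)"
      by (intro square_integrable_mult u test_function_in_L2 test_functions_partial that)
    moreover have "integrable M (\<lambda>x. (G x \<bullet> b) * \<psi> x)"
      by (intro square_integrable_mult square_integrable_component test_function_in_L2 that)
    ultimately have "(\<integral>x. (rep_aefun u x, G x) \<bullet> test_jet \<psi> b x \<partial>M) =
       (\<integral>x. rep_aefun u x * frechet_derivative \<psi> (at x) b \<partial>M) + (\<integral>x. (G x \<bullet> b) * \<psi> x \<partial>M)"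
      by (simp add: test_jet_def mult.commute[of "\<psi> _"])
    then show ?thesis by linarith
  qed
  then show ?thesis unfolding is_weak_gradient_def by blast
qed

text \<open>
Two weak gradients have the same pairing with every test function; componentwise this is the hypothesis
of the fundamental lemma.
\<close>

lemma weak_gradient_unique:
  assumes "is_weak_gradient \<Omega> u G" "is_weak_gradient \<Omega> u K"
  shows "AE x in M. G x = K x"
proof -
  have sq: "square_integrable \<Omega> G" "square_integrable \<Omega> K" using assms by (auto simp: is_weak_gradient_def)
  have "AE x in M. (G x - K x) \<bullet> b = 0" if b: "b \<in> Basis" for b
  proof (rule fundamental_lemma_calculus_of_variations[OF open_\<Omega>])
    show "integrable M (\<lambda>x. (G x - K x) \<bullet> b)"
      by (intro square_integrable_imp_integrable square_integrable_component square_integrable_diff sq b)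
    fix \<psi> assume \<psi>: "\<psi> \<in> test_functions \<Omega>"
    have "integrable M (\<lambda>x. (G x \<bullet> b) * \<psi> x)" "integrable M (\<lambda>x. (K x \<bullet> b) * \<psi> x)"
      by (intro square_integrable_mult square_integrable_component sq b test_function_in_L2 \<psi>)+
    then have "(\<integral>x. (G x - K x) \<bullet> b * \<psi> x \<partial>M) = (\<integral>x. (G x \<bullet> b) * \<psi> x \<partial>M) - (\<integral>x. (K x \<bullet> b) * \<psi> x \<partial>M)"
      by (simp add: inner_diff_left left_diff_distrib)
    also have "\<dots> = 0" using assms \<psi> b by (simp add: is_weak_gradient_def)
    finally show "(\<integral>x. (G x - K x) \<bullet> b * \<psi> x \<partial>M) = 0" .
  qed
  then have "AE x in M. \<forall>b\<in>Basis. (G x - K x) \<bullet> b = 0" by (subst AE_finite_all) auto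
  then show ?thesis by eventually_elim (auto intro: euclidean_eqI simp: inner_diff_left)
qed

text \<open>
Pairing a function with its weak gradient turns the inner product of \<open>H\<^sup>1(\<Omega>)\<close> into that of
\<open>L\<^sup>2(\<Omega>; \<real> \<times> \<real>\<^sup>d)\<close>, from which all Hilbert space properties are inherited.
\<close>

definition jet :: "'a aefun \<Rightarrow> 'a \<Rightarrow> real \<times> 'a" where
  "jet u x = (rep_aefun u x, weak_gradient \<Omega> u x)"

lemma H1_inner_jet: "H1_inner \<Omega> u v = (\<integral>x. jet u x \<bullet> jet v x \<partial>M)"
  by (simp add: H1_inner_def jet_def)

lemma H1_sq: "u \<in> H1 \<Omega> \<Longrightarrow> square_integrable \<Omega> (rep_aefun u)"
  by (simp add: H1_def)

lemma H1_outside: "u \<in> H1 \<Omega> \<Longrightarrow> AE x in lebesgue. x \<notin> \<Omega> \<longrightarrow> rep_aefun u x = 0"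
  by (simp add: H1_def)

lemma H1_weak_gradient:
  assumes "u \<in> H1 \<Omega>"
  shows "is_weak_gradient \<Omega> u (weak_gradient \<Omega> u)"
proof -
  obtain G where "is_weak_gradient \<Omega> u G" using assms by (auto simp: H1_def)
  then show ?thesis unfolding weak_gradient_def by (rule someI[where P="is_weak_gradient \<Omega> u"])
qed

lemma jet_sq: "u \<in> H1 \<Omega> \<Longrightarrow> square_integrable \<Omega> (jet u)"
  unfolding jet_def[abs_def] square_integrable_Pair
  using H1_sq H1_weak_gradient by (auto simp: is_weak_gradient_def)

lemma jet_test_jet:
  assumes "u \<in> H1 \<Omega>" "\<psi> \<in> test_functions \<Omega>" "b \<in> Basis"
  shows "(\<integral>x. jet u x \<bullet> test_jet \<psi> b x \<partial>M) = 0"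
  using H1_weak_gradient[OF assms(1)] assms(2,3) unfolding is_weak_gradient_iff[OF H1_sq[OF assms(1)]] jet_def by blast

text \<open>
The passage from \<open>L\<^sup>2\<close> back to \<open>H\<^sup>1(\<Omega>)\<close>: uniqueness of weak gradients identifies a pair that is orthogonal to the test
jets with the jet of its first component. Sums, multiples, test functions and limits are all
handled through it.
\<close>

lemma H1_jetI:
  assumes J: "square_integrable \<Omega> J" and Ju: "AE x in M. fst (J x) = rep_aefun u x"
    and out: "AE x in lebesgue. x \<notin> \<Omega> \<longrightarrow> rep_aefun u x = 0"
    and z: "\<And>\<psi> b. \<psi> \<in> test_functions \<Omega> \<Longrightarrow> b \<in> Basis \<Longrightarrow> (\<integral>x. J x \<bullet> test_jet \<psi> b x \<partial>M) = 0"
  shows "u \<in> H1 \<Omega>" "AE x in M. jet u x = J x"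
proof -
  have sq: "square_integrable \<Omega> (\<lambda>x. fst (J x))" "square_integrable \<Omega> (\<lambda>x. snd (J x))"
    using J square_integrable_Pair[of \<Omega> "\<lambda>x. fst (J x)" "\<lambda>x. snd (J x)"] by auto
  have u: "square_integrable \<Omega> (rep_aefun u)" by (rule square_integrable_cong[OF sq(1) Ju])
  have wg: "is_weak_gradient \<Omega> u (\<lambda>x. snd (J x))"
    unfolding is_weak_gradient_iff[OF u]
  proof (intro conjI ballI sq)
    fix \<psi> and b :: 'a assume a: "\<psi> \<in> test_functions \<Omega>" "b \<in> Basis"
    have "(\<integral>x. (rep_aefun u x, snd (J x)) \<bullet> test_jet \<psi> b x \<partial>M) = (\<integral>x. J x \<bullet> test_jet \<psi> b x \<partial>M)"
    proof (rule integral_cong_AE)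
      show "(\<lambda>x. (rep_aefun u x, snd (J x)) \<bullet> test_jet \<psi> b x) \<in> borel_measurable M"
        using u sq test_jet_sq[OF a] by (intro borel_measurable_inner borel_measurable_Pair square_integrable_measurable)
      show "(\<lambda>x. J x \<bullet> test_jet \<psi> b x) \<in> borel_measurable M"
        using J test_jet_sq[OF a] by (intro borel_measurable_inner square_integrable_measurable)
      show "AE x in M. (rep_aefun u x, snd (J x)) \<bullet> test_jet \<psi> b x = J x \<bullet> test_jet \<psi> b x"
        using Ju by eventually_elim (metis prod.collapse)
    qed
    then show "(\<integral>x. (rep_aefun u x, snd (J x)) \<bullet> test_jet \<psi> b x \<partial>M) = 0" using z[OF a] by simp
  qed
  show uH: "u \<in> H1 \<Omega>" using u out wg by (auto simp: H1_def)
  show "AE x in M. jet u x = J x"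
    using weak_gradient_unique[OF H1_weak_gradient[OF uH] wg] Ju
    by eventually_elim (simp add: jet_def prod_eq_iff)
qed

lemma jet_add:
  assumes u: "u \<in> H1 \<Omega>" and v: "v \<in> H1 \<Omega>"
  shows "u + v \<in> H1 \<Omega>" "AE x in M. jet (u + v) x = jet u x + jet v x"
proof -
  have J: "square_integrable \<Omega> (\<lambda>x. jet u x + jet v x)" by (intro square_integrable_add jet_sq u v)
  have a: "AE x in M. fst (jet u x + jet v x) = rep_aefun (u + v) x"
    using AE_M[OF rep_aefun_add[of u v]] by eventually_elim (simp add: jet_def)
  have o: "AE x in lebesgue. x \<notin> \<Omega> \<longrightarrow> rep_aefun (u + v) x = 0"
    using H1_outside[OF u] H1_outside[OF v] rep_aefun_add[of u v] by eventually_elim auto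
  have z: "(\<integral>x. (jet u x + jet v x) \<bullet> test_jet \<psi> b x \<partial>M) = 0" if "\<psi> \<in> test_functions \<Omega>" "b \<in> Basis" for \<psi> b
    using jet_test_jet[OF u that] jet_test_jet[OF v that] square_integrable_inner[OF jet_sq test_jet_sq[OF that]] u v
    by (simp add: inner_add_left)
  show "u + v \<in> H1 \<Omega>" "AE x in M. jet (u + v) x = jet u x + jet v x"
    using H1_jetI[OF J a o z] by auto
qed

lemma jet_scale:
  assumes u: "u \<in> H1 \<Omega>"
  shows "c *\<^sub>R u \<in> H1 \<Omega>" "AE x in M. jet (c *\<^sub>R u) x = c *\<^sub>R jet u x"
proof -
  have J: "square_integrable \<Omega> (\<lambda>x. c *\<^sub>R jet u x)" by (intro square_integrable_scaleR jet_sq u)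
  have a: "AE x in M. fst (c *\<^sub>R jet u x) = rep_aefun (c *\<^sub>R u) x"
    using AE_M[OF rep_aefun_scaleR[of c u]] by eventually_elim (simp add: jet_def)
  have o: "AE x in lebesgue. x \<notin> \<Omega> \<longrightarrow> rep_aefun (c *\<^sub>R u) x = 0"
    using H1_outside[OF u] rep_aefun_scaleR[of c u] by eventually_elim auto
  have z: "(\<integral>x. (c *\<^sub>R jet u x) \<bullet> test_jet \<psi> b x \<partial>M) = 0" if "\<psi> \<in> test_functions \<Omega>" "b \<in> Basis" for \<psi> b
    using jet_test_jet[OF u that] by simp
  show "c *\<^sub>R u \<in> H1 \<Omega>" "AE x in M. jet (c *\<^sub>R u) x = c *\<^sub>R jet u x"
    using H1_jetI[OF J a o z] by auto
qed

lemma jet_test_function: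
  assumes \<psi>: "\<psi> \<in> test_functions \<Omega>"
  shows "abs_aefun \<psi> \<in> H1 \<Omega>" "AE x in M. jet (abs_aefun \<psi>) x = (\<psi> x, grad \<psi> x)"
proof -
  have sg: "square_integrable \<Omega> (grad \<psi>)"
  proof -
    have "square_integrable \<Omega> (\<lambda>x. \<Sum>b\<in>B. frechet_derivative \<psi> (at x) b *\<^sub>R b)" if "finite B" "B \<subseteq> Basis" for B
      using that
    proof (induction B)
      case (insert b B)
      have "square_integrable \<Omega> (\<lambda>x. frechet_derivative \<psi> (at x) b *\<^sub>R b)"
        using test_function_in_L2[OF test_functions_partial[OF \<psi>, of b]] insert.prems by (auto simp: square_integrable_def)
      then show ?case using insert by (simp add: square_integrable_add)
    qed (simp add: square_integrable_def)
    then show ?thesis unfolding grad_def[abs_def] by simp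
  qed
  have J: "square_integrable \<Omega> (\<lambda>x. (\<psi> x, grad \<psi> x))"
    unfolding square_integrable_Pair using test_function_in_L2[OF \<psi>] sg by simp
  have a: "AE x in M. fst (\<psi> x, grad \<psi> x) = rep_aefun (abs_aefun \<psi>) x"
    using AE_M[OF rep_abs_aefun[of \<psi>]] by eventually_elim simp
  have o: "AE x in lebesgue. x \<notin> \<Omega> \<longrightarrow> rep_aefun (abs_aefun \<psi>) x = 0"
    using rep_abs_aefun[of \<psi>] by eventually_elim (use test_functionsD(2)[OF \<psi>] in auto)
  have z: "(\<integral>x. (\<psi> x, grad \<psi> x) \<bullet> test_jet \<eta> b x \<partial>M) = 0" if \<eta>: "\<eta> \<in> test_functions \<Omega>" and b: "b \<in> Basis" for \<eta> b
  proof -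
    have "integrable M (\<lambda>x. \<psi> x * frechet_derivative \<eta> (at x) b)"
      by (intro square_integrable_mult test_function_in_L2 \<psi> test_functions_partial \<eta> b)
    moreover have "integrable M (\<lambda>x. frechet_derivative \<psi> (at x) b * \<eta> x)"
      by (intro square_integrable_mult test_function_in_L2 \<psi> test_functions_partial \<eta> b)
    ultimately show ?thesis
      using integration_by_parts_test_function[OF sets_\<Omega> \<psi> \<eta> b] b
      by (simp add: test_jet_def grad_inner mult.commute[of "\<eta> _"])
  qed
  show "abs_aefun \<psi> \<in> H1 \<Omega>" "AE x in M. jet (abs_aefun \<psi>) x = (\<psi> x, grad \<psi> x)"
    using H1_jetI[OF J a o z] by auto
qed

lemma zero_test_function: "(\<lambda>x. 0) \<in> test_functions \<Omega>"
  by (simp add: test_functions_def Ck_const)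

lemma subspace_H1: "subspace (H1 \<Omega>)"
  unfolding subspace_def
  using jet_add(1) jet_scale(1) jet_test_function(1)[OF zero_test_function] by (auto simp: zero_aefun_def)

lemma integral_inner_cong:
  fixes f g h k :: "'a \<Rightarrow> 'b::euclidean_space"
  assumes "square_integrable \<Omega> f" "square_integrable \<Omega> h" "AE x in M. f x = g x" "AE x in M. h x = k x"
  shows "(\<integral>x. f x \<bullet> h x \<partial>M) = (\<integral>x. g x \<bullet> k x \<partial>M)"
proof (rule integral_cong_AE)
  show "(\<lambda>x. f x \<bullet> h x) \<in> borel_measurable M"
    using assms by (intro borel_measurable_inner square_integrable_measurable)
  show "(\<lambda>x. g x \<bullet> k x) \<in> borel_measurable M"
    using square_integrable_cong[OF assms(1,3)] square_integrable_cong[OF assms(2,4)]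
    by (intro borel_measurable_inner square_integrable_measurable)
  show "AE x in M. f x \<bullet> h x = g x \<bullet> k x" using assms(3,4) by eventually_elim simp
qed

sublocale H1: psd_form "H1 \<Omega>" "H1_inner \<Omega>"
  rewrites "psd_form.nm (H1_inner \<Omega>) = H1_norm \<Omega>"
proof -
  show *: "psd_form (H1 \<Omega>) (H1_inner \<Omega>)"
  proof
    show "subspace (H1 \<Omega>)" by (rule subspace_H1)
    fix x y z assume x: "x \<in> H1 \<Omega>"
    show "H1_inner \<Omega> x y = H1_inner \<Omega> y x" by (simp add: H1_inner_jet inner_commute)
    show "0 \<le> H1_inner \<Omega> x x" by (simp add: H1_inner_jet)
    show "H1_inner \<Omega> (c *\<^sub>R x) z = c * H1_inner \<Omega> x z" if z: "z \<in> H1 \<Omega>" for c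
    proof -
      have "H1_inner \<Omega> (c *\<^sub>R x) z = (\<integral>x'. c *\<^sub>R jet x x' \<bullet> jet z x' \<partial>M)"
        unfolding H1_inner_jet by (intro integral_inner_cong jet_sq jet_scale x z) auto
      then show ?thesis by (simp add: H1_inner_jet)
    qed
    assume y: "y \<in> H1 \<Omega>" and z: "z \<in> H1 \<Omega>"
    have "H1_inner \<Omega> (x + y) z = (\<integral>x'. (jet x x' + jet y x') \<bullet> jet z x' \<partial>M)"
      unfolding H1_inner_jet by (intro integral_inner_cong jet_sq jet_add x y z) auto
    then show "H1_inner \<Omega> (x + y) z = H1_inner \<Omega> x z + H1_inner \<Omega> y z"
      using square_integrable_inner[OF jet_sq jet_sq] x y z by (simp add: H1_inner_jet inner_add_left)
  qed
  show "psd_form.nm (H1_inner \<Omega>) = H1_norm \<Omega>"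
    by (auto simp: fun_eq_iff psd_form.nm_def[OF *] H1_norm_def)
qed

lemma H1_norm_square: "u \<in> H1 \<Omega> \<Longrightarrow> (H1_norm \<Omega> u)\<^sup>2 = (\<integral>x. (norm (jet u x))\<^sup>2 \<partial>M)"
  using H1.nm_square by (simp add: H1_inner_jet power2_norm_eq_inner)

lemma H1_norm_diff_square:
  assumes u: "u \<in> H1 \<Omega>" and v: "v \<in> H1 \<Omega>"
  shows "(H1_norm \<Omega> (u - v))\<^sup>2 = (\<integral>x. (norm (jet u x - jet v x))\<^sup>2 \<partial>M)"
proof -
  have uv: "u - v \<in> H1 \<Omega>" using u v by auto
  have e: "AE x in M. jet (u - v) x = jet u x - jet v x"
    using jet_add(2)[OF u, of "(-1) *\<^sub>R v"] jet_scale[OF v, of "-1"]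
    by (auto elim!: eventually_elim2)
  show ?thesis
    unfolding H1_norm_square[OF uv] power2_norm_eq_inner
    by (intro integral_inner_cong jet_sq uv e)
qed

text \<open>
The jets of a Cauchy sequence converge in \<open>L\<^sup>2\<close>, and orthogonality to the test jets survives the limit.
\<close>

lemma H1_complete:
  assumes X: "\<And>n. X n \<in> H1 \<Omega>"
    and C: "\<And>e. 0 < e \<Longrightarrow> \<exists>N. \<forall>m\<ge>N. \<forall>n\<ge>N. H1_norm \<Omega> (X m - X n) < e"
  obtains L where "L \<in> H1 \<Omega>" "(\<lambda>n. H1_norm \<Omega> (X n - L)) \<longlonglongrightarrow> 0"
proof -
  have "\<exists>N. \<forall>m\<ge>N. \<forall>n\<ge>N. (\<integral>x. (norm (jet (X m) x - jet (X n) x))\<^sup>2 \<partial>M) < e" if "0 < e" for e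
  proof -
    obtain N where N: "\<And>m n. N \<le> m \<Longrightarrow> N \<le> n \<Longrightarrow> H1_norm \<Omega> (X m - X n) < sqrt e"
      using C[of "sqrt e"] \<open>0 < e\<close> by auto
    have "(H1_norm \<Omega> (X m - X n))\<^sup>2 < e" if "N \<le> m" "N \<le> n" for m n
    proof -
      have "(H1_norm \<Omega> (X m - X n))\<^sup>2 < (sqrt e)\<^sup>2"
        using N[OF that] X by (intro power_strict_mono) auto
      then show ?thesis using \<open>0 < e\<close> by simp
    qed
    then show ?thesis using X by (auto simp: H1_norm_diff_square)
  qed
  then obtain g where g: "square_integrable \<Omega> g" and lim: "(\<lambda>n. \<integral>x. (norm (jet (X n) x - g x))\<^sup>2 \<partial>M) \<longlonglongrightarrow> 0"
    using L2_complete[of \<Omega> "\<lambda>n. jet (X n)"] jet_sq[OF X] by blast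
  define L where "L = abs_aefun (\<lambda>x. if x \<in> \<Omega> then fst (g x) else 0)"
  have r: "AE x in lebesgue. rep_aefun L x = (if x \<in> \<Omega> then fst (g x) else 0)"
    unfolding L_def by (rule rep_abs_aefun)
  have a: "AE x in M. fst (g x) = rep_aefun L x"
    using r sets_\<Omega> by (simp add: AE_restrict_space_iff) (auto elim: eventually_mono)
  have o: "AE x in lebesgue. x \<notin> \<Omega> \<longrightarrow> rep_aefun L x = 0"
    using r by eventually_elim auto
  have z: "(\<integral>x. g x \<bullet> test_jet \<psi> b x \<partial>M) = 0" if "\<psi> \<in> test_functions \<Omega>" "b \<in> Basis" for \<psi> b
    using L2_limit_inner[OF jet_sq[OF X] g test_jet_sq[OF that] lim] jet_test_jet[OF X that]
    by (simp add: LIMSEQ_const_iff)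
  have L: "L \<in> H1 \<Omega>" "AE x in M. jet L x = g x" using H1_jetI[OF g a o z] by auto
  have "(H1_norm \<Omega> (X n - L))\<^sup>2 = (\<integral>x. (norm (jet (X n) x - g x))\<^sup>2 \<partial>M)" for n
  proof -
    have "AE x in M. jet (X n) x - jet L x = jet (X n) x - g x" using L(2) by eventually_elim simp
    then show ?thesis
      unfolding H1_norm_diff_square[OF X L(1)] power2_norm_eq_inner
      by (intro integral_inner_cong square_integrable_diff jet_sq X L(1))
  qed
  then have "(\<lambda>n. (H1_norm \<Omega> (X n - L))\<^sup>2) \<longlonglongrightarrow> 0" using lim by simp
  then have "(\<lambda>n. H1_norm \<Omega> (X n - L)) \<longlonglongrightarrow> 0"
    by (rule tendsto_zero_of_square)
  then show thesis using that L(1) by blast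
qed

lemma H10_H1: "u \<in> H10 \<Omega> \<Longrightarrow> u \<in> H1 \<Omega>"
  by (simp add: H10_def)

lemma H10_approx:
  "u \<in> H10 \<Omega> \<Longrightarrow> 0 < e \<Longrightarrow> \<exists>\<psi>\<in>test_functions \<Omega>. H1_norm \<Omega> (u - abs_aefun \<psi>) < e"
  by (simp add: H10_def)

lemma subspace_H10: "subspace (H10 \<Omega>)"
  unfolding subspace_def
proof (intro conjI ballI allI)
  have "0 \<in> H1 \<Omega>" by simp
  moreover have "(0::'a aefun) - abs_aefun (\<lambda>x. 0) = 0" by (simp add: zero_aefun_def[symmetric])
  ultimately show "0 \<in> H10 \<Omega>" unfolding H10_def using zero_test_function by (auto intro!: bexI[of _ "\<lambda>x. 0"])
next
  fix u v assume u: "u \<in> H10 \<Omega>" and v: "v \<in> H10 \<Omega>"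
  have "\<exists>\<psi>\<in>test_functions \<Omega>. H1_norm \<Omega> (u + v - abs_aefun \<psi>) < e" if "0 < e" for e
  proof -
    obtain \<psi> where p: "\<psi> \<in> test_functions \<Omega>" "H1_norm \<Omega> (u - abs_aefun \<psi>) < e / 2" using H10_approx[OF u, of "e/2"] \<open>0 < e\<close> by auto
    obtain \<eta> where q: "\<eta> \<in> test_functions \<Omega>" "H1_norm \<Omega> (v - abs_aefun \<eta>) < e / 2" using H10_approx[OF v, of "e/2"] \<open>0 < e\<close> by auto
    have "u + v - abs_aefun (\<lambda>x. \<psi> x + \<eta> x) = (u - abs_aefun \<psi>) + (v - abs_aefun \<eta>)"
      by (simp add: plus_aefun.abs_eq[symmetric])
    moreover have "u - abs_aefun \<psi> \<in> H1 \<Omega>" "v - abs_aefun \<eta> \<in> H1 \<Omega>"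
      using u v p(1) q(1) H10_H1 jet_test_function(1) by auto
    ultimately have "H1_norm \<Omega> (u + v - abs_aefun (\<lambda>x. \<psi> x + \<eta> x))
        \<le> H1_norm \<Omega> (u - abs_aefun \<psi>) + H1_norm \<Omega> (v - abs_aefun \<eta>)"
      by (simp only: H1.nm_triangle)
    then have "H1_norm \<Omega> (u + v - abs_aefun (\<lambda>x. \<psi> x + \<eta> x)) < e" using p(2) q(2) by linarith
    then show ?thesis using test_functions_add[OF p(1) q(1)] by blast
  qed
  then show "u + v \<in> H10 \<Omega>" using u v by (auto simp: H10_def)
next
  fix c u assume u: "u \<in> H10 \<Omega>"
  have "\<exists>\<psi>\<in>test_functions \<Omega>. H1_norm \<Omega> (c *\<^sub>R u - abs_aefun \<psi>) < e" if "0 < e" for e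
  proof -
    obtain \<psi> where p: "\<psi> \<in> test_functions \<Omega>" "H1_norm \<Omega> (u - abs_aefun \<psi>) < e / (\<bar>c\<bar> + 1)"
      using H10_approx[OF u, of "e / (\<bar>c\<bar> + 1)"] \<open>0 < e\<close> by auto
    have "c *\<^sub>R u - abs_aefun (\<lambda>x. c * \<psi> x) = c *\<^sub>R (u - abs_aefun \<psi>)"
      by (simp add: scaleR_aefun.abs_eq[symmetric] scaleR_diff_right)
    then have "H1_norm \<Omega> (c *\<^sub>R u - abs_aefun (\<lambda>x. c * \<psi> x)) = \<bar>c\<bar> * H1_norm \<Omega> (u - abs_aefun \<psi>)"
      using H1.nm_scale[of "u - abs_aefun \<psi>" c] p u jet_test_function(1) H10_H1 by simp
    also have "\<dots> \<le> \<bar>c\<bar> * (e / (\<bar>c\<bar> + 1))" using p(2) by (intro mult_left_mono) auto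
    also have "\<dots> < e" using \<open>0 < e\<close> by (simp add: field_simps)
    finally show ?thesis using test_functions_scale[OF p(1)] by blast
  qed
  then show "c *\<^sub>R u \<in> H10 \<Omega>" using u by (auto simp: H10_def)
qed

sublocale H10: hilbert_subspace "H10 \<Omega>" "H1_inner \<Omega>"
  rewrites "psd_form.nm (H1_inner \<Omega>) = H1_norm \<Omega>"
proof -
  interpret P: psd_form "H10 \<Omega>" "H1_inner \<Omega>"
    by standard (use subspace_H10 H10_H1 H1.ip_sym H1.ip_add_left H1.ip_scale_left H1.ip_nonneg in auto)
  show nm: "psd_form.nm (H1_inner \<Omega>) = H1_norm \<Omega>"
    by (auto simp: fun_eq_iff P.nm_def H1_norm_def)
  show "hilbert_subspace (H10 \<Omega>) (H1_inner \<Omega>)"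
  proof
    fix u assume u: "u \<in> H10 \<Omega>" and z: "H1_inner \<Omega> u u = 0"
    have i: "integrable M (\<lambda>x. jet u x \<bullet> jet u x)" using u by (intro square_integrable_inner jet_sq H10_H1)
    have "AE x in M. jet u x \<bullet> jet u x = 0"
      using integral_nonneg_eq_0_iff_AE[OF i] z by (simp add: H1_inner_jet)
    then have "AE x in lebesgue. x \<in> \<Omega> \<longrightarrow> rep_aefun u x = 0"
      using sets_\<Omega> by (simp add: AE_restrict_space_iff) (auto elim!: eventually_mono simp: jet_def prod_eq_iff)
    then have "AE x in lebesgue. rep_aefun u x = rep_aefun 0 x"
      using H1_outside[OF H10_H1[OF u]] rep_aefun_zero by eventually_elim auto
    then show "u = 0" by (rule aefun_eqI)
  next
    fix X :: "nat \<Rightarrow> 'a aefun"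
    assume X: "\<And>n. X n \<in> H10 \<Omega>" and C: "\<And>e. 0 < e \<Longrightarrow> \<exists>N. \<forall>m\<ge>N. \<forall>n\<ge>N. P.nm (X m - X n) < e"
    obtain L where L: "L \<in> H1 \<Omega>" and lim: "(\<lambda>n. H1_norm \<Omega> (X n - L)) \<longlonglongrightarrow> 0"
      using H1_complete[of X] X C H10_H1 unfolding nm by metis
    have "\<exists>\<psi>\<in>test_functions \<Omega>. H1_norm \<Omega> (L - abs_aefun \<psi>) < e" if "0 < e" for e
    proof -
      obtain n where n: "H1_norm \<Omega> (X n - L) < e / 2"
        using order_tendstoD(2)[OF lim, of "e / 2"] \<open>0 < e\<close> by (auto simp: eventually_sequentially)
      obtain \<psi> where p: "\<psi> \<in> test_functions \<Omega>" "H1_norm \<Omega> (X n - abs_aefun \<psi>) < e / 2"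
        using H10_approx[OF X, of "e/2"] \<open>0 < e\<close> by (metis half_gt_zero)
      have "H1_norm \<Omega> (L - abs_aefun \<psi>) \<le> H1_norm \<Omega> (L - X n) + H1_norm \<Omega> (X n - abs_aefun \<psi>)"
        using H1.nm_triangle[of "L - X n" "X n - abs_aefun \<psi>"] L X p H10_H1 jet_test_function(1) by simp
      moreover have "H1_norm \<Omega> (L - X n) = H1_norm \<Omega> (X n - L)"
        using H1.nm_diff_commute[of L "X n"] L H10_H1[OF X] by auto
      ultimately have "H1_norm \<Omega> (L - abs_aefun \<psi>) < e" using n p(2) by linarith
      then show ?thesis using p(1) by blast
    qed
    then have "L \<in> H10 \<Omega>" using L by (auto simp: H10_def)
    then show "\<exists>L\<in>H10 \<Omega>. (\<lambda>n. P.nm (X n - L)) \<longlonglongrightarrow> 0" using lim unfolding nm by blast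
  qed
qed

end

section \<open>The subcritical Sobolev embedding\<close>

lemma Jensen_square:
  fixes F :: "'b::euclidean_space \<Rightarrow> real"
  assumes F: "continuous_on UNIV F" and B: "B \<in> sets borel" "bounded B"
  shows "ennreal ((\<integral>x. F x * indicator B x \<partial>lborel)\<^sup>2)
    \<le> ennreal (measure lborel B) * (\<integral>\<^sup>+x. ennreal ((F x)\<^sup>2) * indicator B x \<partial>lborel)"
    and "integrable lborel (\<lambda>x. F x * indicator B x)"
proof -
  have fin: "emeasure lborel B < \<infinity>" using emeasure_bounded_finite[OF B(2)] .
  have int: "integrable lborel (\<lambda>x. K x * indicator B x)" if K: "continuous_on UNIV K" for K :: "'b \<Rightarrow> real"
  proof -
    have "compact (closure B)" using B(2) by (simp add: compact_closure)
    then have "compact (K ` closure B)" using K continuous_on_subset by (intro compact_continuous_image) auto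
    then obtain c where c: "\<forall>y\<in>K ` closure B. norm y \<le> c" using compact_imp_bounded bounded_iff by metis
    show ?thesis
    proof (rule Bochner_Integration.integrable_bound[of _ "\<lambda>x. \<bar>c\<bar> * indicator B x"])
      show "integrable lborel (\<lambda>x. \<bar>c\<bar> * indicator B x)"
        using B fin by (intro integrable_mult_right integrable_real_indicator) auto
      show "(\<lambda>x. K x * indicator B x) \<in> borel_measurable lborel"
        using borel_measurable_continuous_onI[OF K] B by measurable
      have "\<bar>K x\<bar> \<le> \<bar>c\<bar>" if "x \<in> B" for x using c closure_subset[of B] that by fastforce
      then show "AE x in lborel. norm (K x * indicator B x) \<le> norm (\<bar>c\<bar> * indicator B x)"
        by (intro AE_I2) (auto simp: indicator_def)
    qed
  qed
  show iF: "integrable lborel (\<lambda>x. F x * indicator B x)" by (rule int[OF F])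
  have iF2: "integrable lborel (\<lambda>x. (F x)\<^sup>2 * indicator B x)" using F by (intro int continuous_intros)
  have i1: "integrable lborel (\<lambda>x. indicator B x :: real)" using int[of "\<lambda>x. 1"] by simp
  have "(\<integral>x. F x * indicator B x \<partial>lborel)\<^sup>2 \<le> (\<integral>x. (F x)\<^sup>2 * indicator B x \<partial>lborel) * measure lborel B"
  proof (rule quadratic_nonneg_imp_discriminant)
    fix t :: real
    have "0 \<le> (\<integral>x. (F x + t)\<^sup>2 * indicator B x \<partial>lborel)" by simp
    also have "(\<lambda>x. (F x + t)\<^sup>2 * indicator B x) = (\<lambda>x. (F x)\<^sup>2 * indicator B x + 2 * t * (F x * indicator B x) + t\<^sup>2 * indicator B x)"
      by (auto simp: power2_eq_square algebra_simps)
    also have "(\<integral>x. (F x)\<^sup>2 * indicator B x + 2 * t * (F x * indicator B x) + t\<^sup>2 * indicator B x \<partial>lborel)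
       = (\<integral>x. (F x)\<^sup>2 * indicator B x \<partial>lborel) + 2 * (\<integral>x. F x * indicator B x \<partial>lborel) * t + measure lborel B * t\<^sup>2"
      using iF iF2 i1 B by simp
    finally show "0 \<le> (\<integral>x. (F x)\<^sup>2 * indicator B x \<partial>lborel) + 2 * (\<integral>x. F x * indicator B x \<partial>lborel) * t + measure lborel B * t\<^sup>2" .
  qed simp
  then have "ennreal ((\<integral>x. F x * indicator B x \<partial>lborel)\<^sup>2) \<le> ennreal (measure lborel B) * ennreal (\<integral>x. (F x)\<^sup>2 * indicator B x \<partial>lborel)"
    by (subst ennreal_mult[symmetric]) (auto intro: ennreal_leI simp: mult.commute)
  also have "ennreal (\<integral>x. (F x)\<^sup>2 * indicator B x \<partial>lborel) = (\<integral>\<^sup>+x. ennreal ((F x)\<^sup>2 * indicator B x) \<partial>lborel)"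
    by (rule nn_integral_eq_integral[symmetric, OF iF2]) auto
  also have "\<dots> = (\<integral>\<^sup>+x. ennreal ((F x)\<^sup>2) * indicator B x \<partial>lborel)"
    by (intro nn_integral_cong) (auto simp: indicator_def)
  finally show "ennreal ((\<integral>x. F x * indicator B x \<partial>lborel)\<^sup>2)
    \<le> ennreal (measure lborel B) * (\<integral>\<^sup>+x. ennreal ((F x)\<^sup>2) * indicator B x \<partial>lborel)" .
qed

lemma nn_integral_dilation:
  fixes h :: "'a::euclidean_space \<Rightarrow> ennreal"
  assumes [measurable]: "h \<in> borel_measurable borel" and r: "0 < r"
  shows "(\<integral>\<^sup>+y. h (x + r *\<^sub>R y) \<partial>lborel) = ennreal ((1 / r) ^ DIM('a)) * (\<integral>\<^sup>+y. h y \<partial>lborel)"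
proof -
  have "(\<integral>\<^sup>+y. h y \<partial>lborel) = (\<integral>\<^sup>+y. h y \<partial>density (distr lborel borel (\<lambda>y. x + r *\<^sub>R y)) (\<lambda>_. \<bar>r\<bar> ^ DIM('a)))"
    using lborel_affine[of r x] r by simp
  also have "\<dots> = ennreal (r ^ DIM('a)) * (\<integral>\<^sup>+y. h (x + r *\<^sub>R y) \<partial>lborel)"
    using r by (simp add: nn_integral_density nn_integral_distr nn_integral_cmult)
  finally have "ennreal ((1 / r) ^ DIM('a)) * (\<integral>\<^sup>+y. h y \<partial>lborel)
     = (ennreal ((1 / r) ^ DIM('a)) * ennreal (r ^ DIM('a))) * (\<integral>\<^sup>+y. h (x + r *\<^sub>R y) \<partial>lborel)"
    by (simp add: mult.assoc)
  also have "ennreal ((1 / r) ^ DIM('a)) * ennreal (r ^ DIM('a)) = 1"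
    using r by (simp add: ennreal_mult[symmetric] power_mult_distrib[symmetric])
  finally show ?thesis by simp
qed

lemma nn_integral_translation:
  fixes h :: "'a::euclidean_space \<Rightarrow> ennreal"
  assumes "h \<in> borel_measurable borel"
  shows "(\<integral>\<^sup>+x. h (x + v) \<partial>lborel) = (\<integral>\<^sup>+x. h x \<partial>lborel)"
  using nn_integral_dilation[OF assms, of 1 v] by (simp add: add.commute)

text \<open>
Let \<open>g k\<close> be the increments and \<open>b = 1 - d (1/2 - 1/q) > 0\<close>. Interpolation between the two hypotheses gives
\<open>\<integral> (g k)\<^sup>q \<le> (sup (g k)\<^sup>2)\<^sup>(\<^sup>q\<^sup>-\<^sup>2\<^sup>)\<^sup>/\<^sup>2 \<integral> (g k)\<^sup>2\<close>, which is of order \<open>2\<^sup>-\<^sup>k\<^sup>q\<^sup>b\<close>. To sum over \<open>k\<close>, half of this decay is spent on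
geometric weights: with \<open>\<theta> = 2\<^sup>-\<^sup>b\<^sup>/\<^sup>2\<close>, \<open>\<Sum>k. g k\<close> is at most the maximum of \<open>g k / \<theta>\<^sup>k\<close> times \<open>1 / (1 - \<theta>)\<close>, and the
\<open>q\<close>-th power of a maximum is at most the sum of the \<open>q\<close>-th powers.
\<close>

lemma telescoping_Lq_bound:
  fixes a :: "nat \<Rightarrow> 'x \<Rightarrow> real" and d q c G :: real
  assumes am: "\<And>k. a k \<in> borel_measurable M" and q: "2 < q" and d: "d * (1/2 - 1/q) < 1"
    and c: "0 \<le> c" and G: "0 \<le> G"
    and sup: "\<And>k x. (a k x - (if k = 0 then 0 else a (k - 1) x))\<^sup>2 \<le> c * ((1/2) ^ k) powr (2 - d) * G"
    and int: "\<And>k. (\<integral>\<^sup>+x. ennreal ((a k x - (if k = 0 then 0 else a (k - 1) x))\<^sup>2) \<partial>M) \<le> ennreal ((1/4) ^ k * G)"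
  defines "\<theta> \<equiv> 2 powr (- (1 - d * (1/2 - 1/q)) / 2)"
  shows "(\<integral>\<^sup>+x. ennreal (\<bar>a n x\<bar> powr q) \<partial>M)
    \<le> ennreal ((1 / (1 - \<theta>)) powr q * c powr ((q - 2) / 2) * (1 / (1 - \<theta> powr q)) * G powr (q / 2))"
proof -
  define b where "b = 1 - d * (1/2 - 1/q)"
  have b: "0 < b" using d by (simp add: b_def)
  have th: "0 < \<theta>" "\<theta> < 1"
    using b powr_less_mono[of "- b / 2" 0 2] by (auto simp: \<theta>_def b_def[symmetric])
  have thq: "\<theta> powr q < 1" using powr_less_mono2[of q \<theta> 1] th q by simp
  define g where "g = (\<lambda>k x. \<bar>a k x - (if k = 0 then 0 else a (k - 1) x)\<bar>)"
  have gm [measurable]: "g k \<in> borel_measurable M" for k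
    unfolding g_def using am by (cases "k = 0") auto
  have g0: "0 \<le> g k x" for k x by (simp add: g_def)
  have tel: "\<bar>a n x\<bar> \<le> (\<Sum>k\<le>n. g k x)" for n x
  proof (induction n)
    case (Suc n)
    have "\<bar>a (Suc n) x\<bar> \<le> \<bar>a n x\<bar> + g (Suc n) x" by (simp add: g_def)
    then show ?case using Suc by simp
  qed (simp add: g_def)
  have pt: "\<bar>a n x\<bar> powr q \<le> (1 / (1 - \<theta>)) powr q * (\<Sum>k\<le>n. (g k x / \<theta> ^ k) powr q)" for x
  proof -
    define m where "m = Max ((\<lambda>k. g k x / \<theta> ^ k) ` {..n})"
    have mk: "g k x / \<theta> ^ k \<le> m" if "k \<le> n" for k unfolding m_def using that by (intro Max_ge) auto
    have "m \<in> (\<lambda>k. g k x / \<theta> ^ k) ` {..n}" unfolding m_def by (intro Max_in) auto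
    then obtain j where j: "j \<le> n" "m = g j x / \<theta> ^ j" by auto
    have m0: "0 \<le> m" using j g0 th by simp
    have "(\<Sum>k\<le>n. g k x) \<le> (\<Sum>k\<le>n. m * \<theta> ^ k)"
      using mk th by (intro sum_mono) (simp add: pos_divide_le_eq)
    also have "\<dots> = m * (\<Sum>k\<le>n. \<theta> ^ k)" by (simp add: sum_distrib_left)
    also have "\<dots> \<le> m * (1 / (1 - \<theta>))"
    proof (rule mult_left_mono[OF _ m0])
      have "(\<Sum>k\<le>n. \<theta> ^ k) \<le> (\<Sum>k. \<theta> ^ k)"
        using th by (intro sum_le_suminf summable_geometric) auto
      also have "\<dots> = 1 / (1 - \<theta>)" using th by (intro suminf_geometric) auto
      finally show "(\<Sum>k\<le>n. \<theta> ^ k) \<le> 1 / (1 - \<theta>)" .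
    qed
    finally have "\<bar>a n x\<bar> \<le> 1 / (1 - \<theta>) * m" using tel[of n x] by (simp add: mult.commute)
    then have "\<bar>a n x\<bar> powr q \<le> (1 / (1 - \<theta>) * m) powr q" using q by (intro powr_mono2) auto
    also have "\<dots> = (1 / (1 - \<theta>)) powr q * m powr q" using th m0 by (intro powr_mult)
    also have "m powr q \<le> (\<Sum>k\<le>n. (g k x / \<theta> ^ k) powr q)"
      unfolding j(2) using j(1) by (intro member_le_sum) auto
    finally show ?thesis by (simp add: mult_left_mono)
  qed
  have gq: "(\<integral>\<^sup>+x. ennreal ((g k x / \<theta> ^ k) powr q) \<partial>M) \<le> ennreal (c powr ((q - 2) / 2) * G powr (q / 2) * (\<theta> powr q) ^ k)" for k
  proof -
    define T where "T = ((1/2::real) ^ k)"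
    have T: "T = 2 powr (- real k)" by (simp add: T_def powr_minus powr_realpow power_one_over inverse_eq_divide)
    define \<sigma> where "\<sigma> = c * T powr (2 - d) * G"
    have s0: "0 \<le> \<sigma>" using c G by (simp add: \<sigma>_def)
    define L where "L = (\<theta> ^ k) powr (- q) * \<sigma> powr ((q - 2) / 2)"
    have L0: "0 \<le> L" by (simp add: L_def)
    have "(g k x / \<theta> ^ k) powr q \<le> L * (g k x)\<^sup>2" for x
    proof -
      have sq: "(g k x)\<^sup>2 \<le> \<sigma>" using sup[of k x] by (simp add: g_def \<sigma>_def T_def)
      have "(g k x / \<theta> ^ k) powr q = (\<theta> ^ k) powr (- q) * g k x powr q"
        using g0[of k x] th by (simp add: powr_divide powr_minus field_simps)
      also have "g k x powr q = ((g k x)\<^sup>2) powr ((q - 2) / 2) * (g k x)\<^sup>2"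
      proof (cases "g k x = 0")
        case False
        then have "0 < g k x" using g0[of k x] by linarith
        then have "((g k x)\<^sup>2) powr ((q - 2) / 2) * (g k x)\<^sup>2 = g k x powr (q - 2) * g k x powr 2"
        proof -
          have "((g k x)\<^sup>2) powr ((q - 2) / 2) = (g k x powr 2) powr ((q - 2) / 2)" using \<open>0 < g k x\<close> by simp
          also have "\<dots> = g k x powr (2 * ((q - 2) / 2))" by (rule powr_powr)
          also have "2 * ((q - 2) / 2) = q - 2" by simp
          finally show ?thesis using \<open>0 < g k x\<close> by simp
        qed
        then show ?thesis using \<open>0 < g k x\<close> by (simp add: powr_add[symmetric] del: powr_numeral)
      qed simp
      also have "((g k x)\<^sup>2) powr ((q - 2) / 2) * (g k x)\<^sup>2 \<le> \<sigma> powr ((q - 2) / 2) * (g k x)\<^sup>2"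
        using sq q by (intro mult_right_mono powr_mono2) auto
      finally show ?thesis by (simp add: L_def mult.assoc mult_left_mono)
    qed
    then have "(\<integral>\<^sup>+x. ennreal ((g k x / \<theta> ^ k) powr q) \<partial>M) \<le> (\<integral>\<^sup>+x. ennreal L * ennreal ((g k x)\<^sup>2) \<partial>M)"
      using L0 by (intro nn_integral_mono) (auto simp: ennreal_mult[symmetric] intro!: ennreal_leI)
    also have "\<dots> = ennreal L * (\<integral>\<^sup>+x. ennreal ((g k x)\<^sup>2) \<partial>M)" by (rule nn_integral_cmult) measurable
    also have "\<dots> \<le> ennreal L * ennreal ((1/4) ^ k * G)"
      using int[of k] by (intro mult_left_mono) (auto simp: g_def)
    also have "\<dots> = ennreal (L * ((1/4) ^ k * G))" using L0 G by (simp add: ennreal_mult)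
    also have "L * ((1/4) ^ k * G) = c powr ((q - 2) / 2) * G powr (q / 2) * (\<theta> powr q) ^ k"
    proof -
      have Tp: "0 < T" by (simp add: T_def)
      have f1: "\<sigma> powr ((q - 2) / 2) = c powr ((q - 2) / 2) * (T powr (2 - d)) powr ((q - 2) / 2) * G powr ((q - 2) / 2)"
        unfolding \<sigma>_def using c G by (simp add: powr_mult)
      have f2: "G powr ((q - 2) / 2) * G = G powr (q / 2)"
      proof (cases "G = 0")
        case False
        have "G powr ((q - 2) / 2) * G powr 1 = G powr (q / 2)"
          unfolding powr_add[symmetric] by (simp add: field_simps)
        then show ?thesis using G False by simp
      qed (use q in simp)
      have f3: "(\<theta> ^ k) powr (- q) * (T powr (2 - d)) powr ((q - 2) / 2) * (1/4) ^ k = (\<theta> powr q) ^ k"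
      proof -
        have 1: "(\<theta> ^ k) powr (- q) = 2 powr (b / 2 * real k * q)"
          unfolding \<theta>_def b_def[symmetric] by (simp add: powr_realpow[symmetric] powr_powr)
        have 2: "(T powr (2 - d)) powr ((q - 2) / 2) = 2 powr (- real k * (2 - d) * ((q - 2) / 2))"
          by (simp add: T powr_powr)
        have 3: "(1/4::real) ^ k = 2 powr (- real k * 2)"
        proof -
          have "(1/4::real) ^ k = T ^ 2" by (simp add: T_def power_mult[symmetric] power2_eq_square power_mult_distrib[symmetric])
          also have "\<dots> = T powr 2" using Tp by simp
          finally show ?thesis by (simp add: T powr_powr)
        qed
        have 4: "(\<theta> powr q) ^ k = 2 powr (- b / 2 * q * real k)"
          unfolding \<theta>_def b_def[symmetric] by (simp add: powr_realpow[symmetric] powr_powr)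
        have bq: "b * q = q - d * ((q - 2) / 2)" using q by (simp add: b_def field_simps)
        have "b / 2 * real k * q + - real k * (2 - d) * z + - real k * 2
          = real k * ((b * q) / 2 - ((2 - d) * z + 2))" for z by (simp add: algebra_simps)
        then have "b / 2 * real k * q + - real k * (2 - d) * ((q - 2) / 2) + - real k * 2
          = real k * ((b * q) / 2 - ((2 - d) * ((q - 2) / 2) + 2))" .
        also have "(2 - d) * ((q - 2) / 2) + 2 = b * q" unfolding bq by (simp add: field_simps)
        finally have e: "b / 2 * real k * q + - real k * (2 - d) * ((q - 2) / 2) + - real k * 2 = - b / 2 * q * real k"
          by (simp add: algebra_simps)
        show ?thesis unfolding 1 2 3 4 powr_add[symmetric] e ..
      qed
      have "L * ((1/4) ^ k * G) = c powr ((q - 2) / 2) * (G powr ((q - 2) / 2) * G) *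
          ((\<theta> ^ k) powr (- q) * (T powr (2 - d)) powr ((q - 2) / 2) * (1/4) ^ k)"
        unfolding L_def f1 by (simp only: mult_ac)
      then show ?thesis unfolding f2 f3 .
    qed
    finally show ?thesis .
  qed
  define Cq where "Cq = c powr ((q - 2) / 2) * G powr (q / 2)"
  have Cq: "0 \<le> Cq" by (simp add: Cq_def)
  define W where "W = (1 / (1 - \<theta>)) powr q"
  have W: "0 \<le> W" by (simp add: W_def)
  have "(\<integral>\<^sup>+x. ennreal (\<bar>a n x\<bar> powr q) \<partial>M) \<le> (\<integral>\<^sup>+x. ennreal W * (\<Sum>k\<le>n. ennreal ((g k x / \<theta> ^ k) powr q)) \<partial>M)"
    using pt W by (intro nn_integral_mono) (auto simp: W_def[symmetric] ennreal_mult[symmetric] sum_nonneg intro!: ennreal_leI)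
  also have "\<dots> = ennreal W * (\<Sum>k\<le>n. \<integral>\<^sup>+x. ennreal ((g k x / \<theta> ^ k) powr q) \<partial>M)"
    by (simp add: nn_integral_cmult nn_integral_sum del: sum_ennreal)
  also have "\<dots> \<le> ennreal W * (\<Sum>k\<le>n. ennreal (Cq * (\<theta> powr q) ^ k))"
    using gq by (intro mult_left_mono sum_mono) (auto simp: Cq_def)
  also have "\<dots> = ennreal (W * (\<Sum>k\<le>n. Cq * (\<theta> powr q) ^ k))"
    using W Cq by (subst ennreal_mult) (auto simp: sum_nonneg)
  also have "\<dots> \<le> ennreal (W * (Cq * (1 / (1 - \<theta> powr q))))"
  proof (intro ennreal_leI mult_left_mono W)
    have "(\<Sum>k\<le>n. Cq * (\<theta> powr q) ^ k) = Cq * (\<Sum>k\<le>n. (\<theta> powr q) ^ k)" by (simp add: sum_distrib_left)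
    also have "\<dots> \<le> Cq * (\<Sum>k. (\<theta> powr q) ^ k)"
      using thq by (intro mult_left_mono Cq sum_le_suminf summable_geometric) auto
    also have "(\<Sum>k. (\<theta> powr q) ^ k) = 1 / (1 - \<theta> powr q)" using thq by (intro suminf_geometric) auto
    finally show "(\<Sum>k\<le>n. Cq * (\<theta> powr q) ^ k) \<le> Cq * (1 / (1 - \<theta> powr q))" .
  qed
  finally show ?thesis by (simp add: W_def Cq_def mult_ac)
qed

lemma frechet_derivative_grad:
  assumes "smooth f"
  shows "frechet_derivative f (at x) v = grad f x \<bullet> v"
proof -
  have l: "linear (frechet_derivative f (at x))" by (rule linear_frechet_derivative[OF smooth_differentiable[OF assms]])
  have "frechet_derivative f (at x) v = frechet_derivative f (at x) (\<Sum>b\<in>Basis. (v \<bullet> b) *\<^sub>R b)"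
    by (simp add: euclidean_representation)
  also have "\<dots> = (\<Sum>b\<in>Basis. (v \<bullet> b) * frechet_derivative f (at x) b)"
    by (simp add: linear_sum[OF l] linear_cmul[OF l])
  also have "\<dots> = grad f x \<bullet> v" by (simp add: grad_def inner_sum_left inner_commute[of v] mult.commute)
  finally show ?thesis .
qed

lemma continuous_grad: "smooth f \<Longrightarrow> continuous_on A (grad f)"
  unfolding grad_def[abs_def] by (intro continuous_intros smooth_continuous smooth_partial)

text \<open>
The fundamental theorem of calculus on the segment from \<open>x + \<tau> y\<close> to \<open>x + 2 \<tau> y\<close>, followed by Jensen's inequality in
the parameter of the segment.
\<close>

lemma dyadic_difference_square_le:
  fixes \<psi> :: "'a::euclidean_space \<Rightarrow> real"
  assumes \<psi>: "smooth \<psi>" and y: "norm y \<le> 1" and \<tau>: "0 \<le> \<tau>"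
  shows "ennreal ((\<psi> (x + \<tau> *\<^sub>R y) - \<psi> (x + (2 * \<tau>) *\<^sub>R y))\<^sup>2)
    \<le> ennreal (\<tau>\<^sup>2) * (\<integral>\<^sup>+s. ennreal ((norm (grad \<psi> (x + (s * \<tau>) *\<^sub>R y)))\<^sup>2) * indicator {1..2::real} s \<partial>lborel)"
proof -
  define f where "f = (\<lambda>s. \<psi> (x + (s * \<tau>) *\<^sub>R y))"
  define f' where "f' = (\<lambda>s. grad \<psi> (x + (s * \<tau>) *\<^sub>R y) \<bullet> (\<tau> *\<^sub>R y))"
  have D: "(f has_real_derivative f' s) (at s)" for s
  proof -
    have "((\<lambda>s. \<psi> (x + (s * \<tau>) *\<^sub>R y)) has_derivative (\<lambda>h. frechet_derivative \<psi> (at (x + (s * \<tau>) *\<^sub>R y)) ((h * \<tau>) *\<^sub>R y))) (at s)"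
    proof (rule has_derivative_compose[of _ _ s _ \<psi>])
      show "((\<lambda>s. x + (s * \<tau>) *\<^sub>R y) has_derivative (\<lambda>h. (h * \<tau>) *\<^sub>R y)) (at s)" by (auto intro!: derivative_eq_intros)
    qed (rule smooth_has_derivative[OF \<psi>])
    then have "(f has_derivative (\<lambda>h. f' s * h)) (at s)"
      unfolding f_def f'_def by (rule has_derivative_eq_rhs) (auto simp: frechet_derivative_grad[OF \<psi>])
    then show ?thesis by (simp add: has_field_derivative_def)
  qed
  have c: "continuous_on UNIV f'"
    unfolding f'_def by (intro continuous_intros continuous_on_compose2[OF continuous_grad[OF \<psi>, of UNIV]]) auto
  have "has_bochner_integral lborel (\<lambda>x. f' x * indicator {1..2} x) (f 2 - f 1)"
    by (rule has_bochner_integral_FTC_Icc_real) (use D c in \<open>auto simp: continuous_on_eq_continuous_at\<close>)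
  then have "(\<integral>x. f' x * indicator {1..2} x \<partial>lborel) = f 2 - f 1" by (rule has_bochner_integral_integral_eq)
  then have "ennreal ((f 2 - f 1)\<^sup>2) \<le> ennreal (measure lborel {1..2::real}) * (\<integral>\<^sup>+x. ennreal ((f' x)\<^sup>2) * indicator {1..2} x \<partial>lborel)"
    using Jensen_square(1)[OF c, of "{1..2}"] by simp
  also have "\<dots> = (\<integral>\<^sup>+x. ennreal ((f' x)\<^sup>2) * indicator {1..2} x \<partial>lborel)" by simp
  also have "\<dots> \<le> (\<integral>\<^sup>+s. ennreal (\<tau>\<^sup>2) * (ennreal ((norm (grad \<psi> (x + (s * \<tau>) *\<^sub>R y)))\<^sup>2) * indicator {1..2::real} s) \<partial>lborel)"
  proof (rule nn_integral_mono)
    fix s :: real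
    have "\<bar>f' s\<bar> \<le> norm (grad \<psi> (x + (s * \<tau>) *\<^sub>R y)) * norm (\<tau> *\<^sub>R y)"
      unfolding f'_def by (rule Cauchy_Schwarz_ineq2)
    also have "\<dots> \<le> norm (grad \<psi> (x + (s * \<tau>) *\<^sub>R y)) * \<tau>"
      using y \<tau> by (intro mult_left_mono) (auto simp: mult_left_le)
    finally have "\<bar>f' s\<bar>\<^sup>2 \<le> (norm (grad \<psi> (x + (s * \<tau>) *\<^sub>R y)) * \<tau>)\<^sup>2" by (intro power_mono) auto
    then have "(f' s)\<^sup>2 \<le> \<tau>\<^sup>2 * (norm (grad \<psi> (x + (s * \<tau>) *\<^sub>R y)))\<^sup>2" by (simp add: power_mult_distrib mult.commute)
    then show "ennreal ((f' s)\<^sup>2) * indicator {1..2::real} s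
      \<le> ennreal (\<tau>\<^sup>2) * (ennreal ((norm (grad \<psi> (x + (s * \<tau>) *\<^sub>R y)))\<^sup>2) * indicator {1..2::real} s)"
      by (auto simp: indicator_def ennreal_mult[symmetric] intro!: ennreal_leI)
  qed
  also have "\<dots> = ennreal (\<tau>\<^sup>2) * (\<integral>\<^sup>+s. ennreal ((norm (grad \<psi> (x + (s * \<tau>) *\<^sub>R y)))\<^sup>2) * indicator {1..2::real} s \<partial>lborel)"
  proof (rule nn_integral_cmult)
    have "continuous_on UNIV (\<lambda>s. (norm (grad \<psi> (x + (s * \<tau>) *\<^sub>R y)))\<^sup>2)"
      by (intro continuous_intros continuous_on_compose2[OF continuous_grad[OF \<psi>, of UNIV]]) auto
    then have [measurable]: "(\<lambda>s. (norm (grad \<psi> (x + (s * \<tau>) *\<^sub>R y)))\<^sup>2) \<in> borel_measurable borel"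
      by (rule borel_measurable_continuous_onI)
    show "(\<lambda>s. ennreal ((norm (grad \<psi> (x + (s * \<tau>) *\<^sub>R y)))\<^sup>2) * indicator {1..2::real} s) \<in> borel_measurable lborel"
      by measurable
  qed
  finally show ?thesis by (simp add: f_def power2_commute)
qed

text \<open>
Let \<open>a k x\<close> be the mean of \<open>\<psi>\<close> over the ball of radius \<open>\<tau> = 2\<^sup>-\<^sup>k\<close> around \<open>x\<close>. By the segment estimate, \<open>(a (k + 1) x - a k x)\<^sup>2\<close> is
\<open>\<tau>\<^sup>2\<close> times a mean of \<open>\<bar>\<nabla>\<psi>\<bar>\<^sup>2\<close> over balls of radius comparable to \<open>\<tau>\<close> (here \<open>\<tau>\<close> is the smaller radius). Dilation bounds this
uniformly in \<open>x\<close> by a constant times \<open>\<tau>\<^sup>2\<^sup>-\<^sup>d \<parallel>\<nabla>\<psi>\<parallel>\<^sup>2\<close>, translation invariance bounds its integral over \<open>x\<close> by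
\<open>\<tau>\<^sup>2 \<parallel>\<nabla>\<psi>\<parallel>\<^sup>2\<close>, and the initial mean \<open>a 0\<close> obeys the same bounds with \<open>\<psi>\<close> in place of its gradient. So \<open>telescoping_Lq_bound\<close> applies. As \<open>k\<close> grows, the means tend to \<open>\<psi>\<close>.
\<close>

lemma test_function_Lq_bound:
  fixes q :: real
  assumes q: "2 < q" and d: "real DIM('a::euclidean_space) * (1/2 - 1/q) < 1"
  obtains C where "0 \<le> C"
    "\<And>(\<psi> :: 'a \<Rightarrow> real) G R. smooth \<psi> \<Longrightarrow> (\<And>x. R \<le> norm x \<Longrightarrow> \<psi> x = 0) \<Longrightarrow> 0 \<le> G \<Longrightarrow>
       (\<integral>\<^sup>+x. ennreal ((\<psi> x)\<^sup>2) \<partial>lborel) \<le> ennreal G \<Longrightarrow>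
       (\<integral>\<^sup>+x. ennreal ((norm (grad \<psi> x))\<^sup>2) \<partial>lborel) \<le> ennreal G \<Longrightarrow>
       (\<integral>\<^sup>+x. ennreal (\<bar>\<psi> x\<bar> powr q) \<partial>lborel) \<le> ennreal (C * G powr (q / 2))"
proof -
  define B where "B = ball (0::'a) 1"
  have B: "B \<in> sets borel" "bounded B" by (auto simp: B_def)
  have Bm [measurable]: "B \<in> sets borel" by (fact B)
  define \<beta> where "\<beta> = measure lborel B"
  have \<beta>: "0 < \<beta>" unfolding \<beta>_def B_def by (rule content_ball_pos) simp
  have eB: "emeasure lborel B = ennreal \<beta>"
    unfolding \<beta>_def using emeasure_bounded_finite[OF B(2)] by (intro emeasure_eq_ennreal_measure) auto
  have bb: "ennreal (1 / \<beta>) * ennreal \<beta> = 1" using \<beta> by (simp add: ennreal_mult[symmetric])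
  define d where "d = real DIM('a)"
  define \<theta> where "\<theta> = 2 powr (- (1 - d * (1/2 - 1/q)) / 2)"
  define C where "C = (1 / (1 - \<theta>)) powr q * (1 / \<beta>) powr ((q - 2) / 2) * (1 / (1 - \<theta> powr q))"
  have th: "0 < \<theta>" "\<theta> < 1"
    using d powr_less_mono[of "- (1 - d * (1/2 - 1/q)) / 2" 0 2] by (auto simp: \<theta>_def d_def)
  have thq: "\<theta> powr q < 1" using powr_less_mono2[of q \<theta> 1] th q by simp
  have C0: "0 \<le> C" using thq by (simp add: C_def)
  show thesis
  proof (rule that[OF C0])
    fix \<psi> :: "'a \<Rightarrow> real" and G R :: real
    assume \<psi>: "smooth \<psi>" and R: "\<And>x. R \<le> norm x \<Longrightarrow> \<psi> x = 0" and G: "0 \<le> G"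
      and G0: "(\<integral>\<^sup>+x. ennreal ((\<psi> x)\<^sup>2) \<partial>lborel) \<le> ennreal G"
      and G1: "(\<integral>\<^sup>+x. ennreal ((norm (grad \<psi> x))\<^sup>2) \<partial>lborel) \<le> ennreal G"
    have [measurable]: "\<psi> \<in> borel_measurable borel" "grad \<psi> \<in> borel_measurable borel"
      by (intro borel_measurable_continuous_onI smooth_continuous continuous_grad \<psi>)+
    define h0 where "h0 = (\<lambda>x. ennreal ((\<psi> x)\<^sup>2))"
    define h where "h = (\<lambda>x. ennreal ((norm (grad \<psi> x))\<^sup>2))"
    have hm [measurable]: "h0 \<in> borel_measurable borel" "h \<in> borel_measurable borel"
      unfolding h0_def h_def by measurable
    define a where "a = (\<lambda>k x. (1 / \<beta>) * (\<integral>y. \<psi> (x + (1/2) ^ k *\<^sub>R y) * indicator B y \<partial>lborel))"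
    have am [measurable]: "a k \<in> borel_measurable lborel" for k
      unfolding a_def by measurable
    have avg: "ennreal (((1 / \<beta>) * (\<integral>y. F y * indicator B y \<partial>lborel))\<^sup>2)
        \<le> ennreal (1 / \<beta>) * (\<integral>\<^sup>+y. ennreal ((F y)\<^sup>2) * indicator B y \<partial>lborel)" if F: "continuous_on UNIV F" for F :: "'a \<Rightarrow> real"
    proof -
      have "ennreal (((1 / \<beta>) * (\<integral>y. F y * indicator B y \<partial>lborel))\<^sup>2)
          = ennreal (1 / \<beta>) * (ennreal (1 / \<beta>) * ennreal ((\<integral>y. F y * indicator B y \<partial>lborel)\<^sup>2))"
        using \<beta> by (simp add: ennreal_mult[symmetric] power2_eq_square)
      also have "\<dots> \<le> ennreal (1 / \<beta>) * (ennreal (1 / \<beta>) * (ennreal \<beta> * (\<integral>\<^sup>+y. ennreal ((F y)\<^sup>2) * indicator B y \<partial>lborel)))"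
        using Jensen_square(1)[OF F B] by (intro mult_left_mono) (auto simp: \<beta>_def)
      also have "\<dots> = ennreal (1 / \<beta>) * (\<integral>\<^sup>+y. ennreal ((F y)\<^sup>2) * indicator B y \<partial>lborel)"
        by (simp add: mult.assoc[symmetric] bb)
      finally show ?thesis .
    qed
    define g2 where "g2 = (\<lambda>k x. (a k x - (if k = 0 then 0 else a (k - 1) x))\<^sup>2)"
    define \<Phi> where "\<Phi> = (\<lambda>k x. \<integral>\<^sup>+y. \<integral>\<^sup>+s. h (x + (s * (1/2) ^ k) *\<^sub>R y) * indicator {1..2::real} s * indicator B y \<partial>lborel \<partial>lborel)"
    have contpsi: "continuous_on UNIV (\<lambda>y. \<psi> (x + c *\<^sub>R y))" for x c
      by (intro continuous_on_compose2[OF smooth_continuous[OF \<psi>, of UNIV]] continuous_intros) auto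
    have g2_0: "ennreal (g2 0 x) \<le> ennreal (1 / \<beta>) * (\<integral>\<^sup>+y. h0 (x + y) * indicator B y \<partial>lborel)" for x
      using avg[OF contpsi[of x 1]] by (simp add: g2_def a_def h0_def)
    have g2_Suc: "ennreal (g2 (Suc k) x) \<le> ennreal (1 / \<beta>) * (ennreal (((1/2) ^ Suc k)\<^sup>2) * \<Phi> (Suc k) x)" for k x
    proof -
      define \<tau> where "\<tau> = (1/2::real) ^ Suc k"
      have \<tau>: "0 \<le> \<tau>" "(1/2) ^ k = 2 * \<tau>" by (auto simp: \<tau>_def)
      define F where "F = (\<lambda>y. \<psi> (x + \<tau> *\<^sub>R y) - \<psi> (x + (2 * \<tau>) *\<^sub>R y))"
      have F: "continuous_on UNIV F" unfolding F_def by (intro continuous_on_diff contpsi)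
      have "a (Suc k) x - a k x = (1 / \<beta>) * (\<integral>y. F y * indicator B y \<partial>lborel)"
        unfolding a_def \<tau>_def[symmetric] \<tau>(2) F_def left_diff_distrib
        using Jensen_square(2)[OF contpsi B, of x \<tau>] Jensen_square(2)[OF contpsi B, of x "2 * \<tau>"]
        by (simp add: right_diff_distrib)
      then have "g2 (Suc k) x = ((1 / \<beta>) * (\<integral>y. F y * indicator B y \<partial>lborel))\<^sup>2" by (simp add: g2_def)
      then have "ennreal (g2 (Suc k) x) \<le> ennreal (1 / \<beta>) * (\<integral>\<^sup>+y. ennreal ((F y)\<^sup>2) * indicator B y \<partial>lborel)"
        using avg[OF F] by simp
      also have "\<dots> \<le> ennreal (1 / \<beta>) * (\<integral>\<^sup>+y. ennreal (\<tau>\<^sup>2) * (\<integral>\<^sup>+s. h (x + (s * \<tau>) *\<^sub>R y) * indicator {1..2::real} s * indicator B y \<partial>lborel) \<partial>lborel)"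
      proof (intro mult_left_mono nn_integral_mono)
        fix y
        show "ennreal ((F y)\<^sup>2) * indicator B y \<le> ennreal (\<tau>\<^sup>2) * (\<integral>\<^sup>+s. h (x + (s * \<tau>) *\<^sub>R y) * indicator {1..2::real} s * indicator B y \<partial>lborel)"
          using dyadic_difference_square_le[OF \<psi> _ \<tau>(1), of y x]
          by (auto simp: F_def h_def B_def indicator_def[of "ball 0 1"])
      qed auto
      also have "\<dots> = ennreal (1 / \<beta>) * (ennreal (\<tau>\<^sup>2) * \<Phi> (Suc k) x)"
        unfolding \<Phi>_def \<tau>_def[symmetric] by (subst nn_integral_cmult) auto
      finally show ?thesis by (simp add: \<tau>_def)
    qed
    have \<Phi>_sup: "\<Phi> k x \<le> ennreal ((1 / (1/2) ^ k) ^ DIM('a)) * ennreal G" for k x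
    proof -
      define \<tau> where "\<tau> = (1/2::real) ^ k"
      have \<tau>: "0 < \<tau>" by (simp add: \<tau>_def)
      have "\<Phi> k x = (\<integral>\<^sup>+s. \<integral>\<^sup>+y. h (x + (s * \<tau>) *\<^sub>R y) * indicator {1..2::real} s * indicator B y \<partial>lborel \<partial>lborel)"
        unfolding \<Phi>_def \<tau>_def[symmetric] by (subst lborel_pair.Fubini') auto
      also have "\<dots> \<le> (\<integral>\<^sup>+s. ennreal ((1 / \<tau>) ^ DIM('a)) * ennreal G * indicator {1..2::real} s \<partial>lborel)"
      proof (rule nn_integral_mono)
        fix s :: real
        have "(\<integral>\<^sup>+y. h (x + (s * \<tau>) *\<^sub>R y) * indicator {1..2::real} s * indicator B y \<partial>lborel)
            \<le> (\<integral>\<^sup>+y. h (x + (s * \<tau>) *\<^sub>R y) \<partial>lborel) * indicator {1..2::real} s"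
          by (subst nn_integral_multc[symmetric]) (auto intro!: nn_integral_mono simp: indicator_def)
        also have "\<dots> \<le> ennreal ((1 / \<tau>) ^ DIM('a)) * ennreal G * indicator {1..2::real} s"
        proof (cases "s \<in> {1..2}")
          case True
          then have st: "0 < s * \<tau>" using \<tau> by simp
          have "(1 / (s * \<tau>)) ^ DIM('a) \<le> (1 / \<tau>) ^ DIM('a)"
            using True \<tau> by (intro power_mono divide_left_mono) auto
          then have "(\<integral>\<^sup>+y. h (x + (s * \<tau>) *\<^sub>R y) \<partial>lborel) \<le> ennreal ((1 / \<tau>) ^ DIM('a)) * ennreal G"
            unfolding nn_integral_dilation[OF hm(2) st] using G1
            by (intro mult_mono ennreal_leI) (auto simp: h_def)
          then show ?thesis using True by simp
        qed simp
        finally show "(\<integral>\<^sup>+y. h (x + (s * \<tau>) *\<^sub>R y) * indicator {1..2::real} s * indicator B y \<partial>lborel)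
          \<le> ennreal ((1 / \<tau>) ^ DIM('a)) * ennreal G * indicator {1..2::real} s" .
      qed
      also have "\<dots> = ennreal ((1 / \<tau>) ^ DIM('a)) * ennreal G" by (subst nn_integral_cmult) auto
      finally show ?thesis by (simp add: \<tau>_def)
    qed
    have \<Phi>_int: "(\<integral>\<^sup>+x. \<Phi> k x \<partial>lborel) \<le> ennreal \<beta> * ennreal G" for k
    proof -
      define \<tau> where "\<tau> = (1/2::real) ^ k"
      have "(\<integral>\<^sup>+x. \<Phi> k x \<partial>lborel) = (\<integral>\<^sup>+y. \<integral>\<^sup>+x. \<integral>\<^sup>+s. h (x + (s * \<tau>) *\<^sub>R y) * indicator {1..2::real} s * indicator B y \<partial>lborel \<partial>lborel \<partial>lborel)"
        unfolding \<Phi>_def \<tau>_def[symmetric] by (subst lborel_pair.Fubini') auto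
      also have "\<dots> = (\<integral>\<^sup>+y. \<integral>\<^sup>+s. \<integral>\<^sup>+x. h (x + (s * \<tau>) *\<^sub>R y) * indicator {1..2::real} s * indicator B y \<partial>lborel \<partial>lborel \<partial>lborel)"
        by (intro nn_integral_cong, subst lborel_pair.Fubini') auto
      also have "\<dots> = (\<integral>\<^sup>+y. \<integral>\<^sup>+s. (\<integral>\<^sup>+x. h x \<partial>lborel) * indicator {1..2::real} s * indicator B y \<partial>lborel \<partial>lborel)"
        by (simp add: nn_integral_multc nn_integral_translation)
      also have "\<dots> = (\<integral>\<^sup>+x. h x \<partial>lborel) * ennreal \<beta>"
        using eB by (simp add: nn_integral_multc nn_integral_cmult mult.assoc)
      also have "\<dots> \<le> ennreal G * ennreal \<beta>" using G1 by (intro mult_right_mono) (auto simp: h_def)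
      finally show ?thesis by (simp add: mult.commute)
    qed
    have \<Phi>m [measurable]: "\<Phi> k \<in> borel_measurable lborel" for k unfolding \<Phi>_def by measurable
    have bG: "ennreal (1 / \<beta>) * (ennreal \<beta> * x) = x" for x by (simp add: mult.assoc[symmetric] bb)
    have sup: "g2 k x \<le> (1 / \<beta>) * ((1/2) ^ k) powr (2 - d) * G" for k x
    proof (cases k)
      case 0
      have "ennreal (g2 0 x) \<le> ennreal (1 / \<beta>) * (\<integral>\<^sup>+y. h0 (x + 1 *\<^sub>R y) \<partial>lborel)"
        by (rule order_trans[OF g2_0]) (auto intro!: mult_left_mono nn_integral_mono simp: indicator_def)
      also have "\<dots> \<le> ennreal (1 / \<beta>) * ennreal G"
        using G0 by (subst nn_integral_dilation) (auto intro!: mult_left_mono simp: h0_def)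
      also have "\<dots> = ennreal ((1 / \<beta>) * G)" using \<beta> by (intro ennreal_mult[symmetric]) (auto intro: G)
      finally show ?thesis using 0 \<beta> G by (subst (asm) ennreal_le_iff) auto
    next
      case (Suc j)
      define \<tau> where "\<tau> = (1/2::real) ^ k"
      have \<tau>: "0 < \<tau>" by (simp add: \<tau>_def)
      have "ennreal (g2 k x) \<le> ennreal (1 / \<beta>) * (ennreal (\<tau>\<^sup>2) * (ennreal ((1 / \<tau>) ^ DIM('a)) * ennreal G))"
        unfolding Suc \<tau>_def by (rule order_trans[OF g2_Suc]) (intro mult_left_mono \<Phi>_sup, auto)
      also have "\<dots> = ennreal ((1 / \<beta>) * (\<tau>\<^sup>2 * ((1 / \<tau>) ^ DIM('a) * G)))"
        using \<beta> G \<tau> by (simp add: ennreal_mult[symmetric])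
      finally have "g2 k x \<le> (1 / \<beta>) * (\<tau>\<^sup>2 * ((1 / \<tau>) ^ DIM('a) * G))"
        using \<beta> G \<tau> by (subst (asm) ennreal_le_iff) auto
      also have "\<tau>\<^sup>2 * ((1 / \<tau>) ^ DIM('a) * G) = \<tau> powr (2 - d) * G"
        using \<tau> by (simp add: d_def powr_diff powr_realpow power_one_over field_simps)
      finally show ?thesis by (simp add: \<tau>_def)
    qed
    have int: "(\<integral>\<^sup>+x. ennreal (g2 k x) \<partial>lborel) \<le> ennreal ((1/4) ^ k * G)" for k
    proof (cases k)
      case 0
      have "(\<integral>\<^sup>+x. ennreal (g2 0 x) \<partial>lborel) \<le> (\<integral>\<^sup>+x. ennreal (1 / \<beta>) * (\<integral>\<^sup>+y. h0 (x + y) * indicator B y \<partial>lborel) \<partial>lborel)"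
        by (intro nn_integral_mono g2_0)
      also have "\<dots> = ennreal (1 / \<beta>) * (\<integral>\<^sup>+x. \<integral>\<^sup>+y. h0 (x + y) * indicator B y \<partial>lborel \<partial>lborel)"
        by (rule nn_integral_cmult) measurable
      also have "(\<integral>\<^sup>+x. \<integral>\<^sup>+y. h0 (x + y) * indicator B y \<partial>lborel \<partial>lborel) = (\<integral>\<^sup>+y. \<integral>\<^sup>+x. h0 (x + y) * indicator B y \<partial>lborel \<partial>lborel)"
        by (subst lborel_pair.Fubini') auto
      also have "\<dots> = ennreal \<beta> * (\<integral>\<^sup>+x. h0 x \<partial>lborel)"
        using eB by (simp add: nn_integral_multc nn_integral_translation nn_integral_cmult mult.commute)
      also have "ennreal (1 / \<beta>) * \<dots> \<le> ennreal G" unfolding bG using G0 by (simp add: h0_def)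
      finally show ?thesis using 0 by simp
    next
      case (Suc j)
      have "(\<integral>\<^sup>+x. ennreal (g2 k x) \<partial>lborel) \<le> (\<integral>\<^sup>+x. ennreal (1 / \<beta>) * (ennreal (((1/2) ^ k)\<^sup>2) * \<Phi> k x) \<partial>lborel)"
        unfolding Suc by (intro nn_integral_mono g2_Suc)
      also have "\<dots> = ennreal (1 / \<beta>) * (ennreal (((1/2) ^ k)\<^sup>2) * (\<integral>\<^sup>+x. \<Phi> k x \<partial>lborel))"
        by (simp add: nn_integral_cmult)
      also have "\<dots> \<le> ennreal (1 / \<beta>) * (ennreal (((1/2) ^ k)\<^sup>2) * (ennreal \<beta> * ennreal G))"
        by (intro mult_left_mono \<Phi>_int) auto
      also have "\<dots> = ennreal (1 / \<beta>) * (ennreal \<beta> * (ennreal (((1/2) ^ k)\<^sup>2) * ennreal G))" by (simp only: mult_ac)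
      also have "\<dots> = ennreal ((1/4) ^ k * G)"
      proof -
        have "((1/2) ^ k)\<^sup>2 = (1/4::real) ^ k" by (simp add: power2_eq_square power_mult_distrib[symmetric])
        then show ?thesis unfolding bG using G by (simp add: ennreal_mult)
      qed
      finally show ?thesis .
    qed
    have an: "(\<integral>\<^sup>+x. ennreal (\<bar>a n x\<bar> powr q) \<partial>lborel) \<le> ennreal (C * G powr (q / 2))" for n
      unfolding C_def \<theta>_def
      by (rule telescoping_Lq_bound[OF am q _ _ G]) (use d \<beta> sup int in \<open>auto simp: d_def g2_def\<close>)
    have lim: "(\<lambda>n. a n x) \<longlonglongrightarrow> \<psi> x" for x
    proof -
      obtain K where K: "\<And>x. \<bar>\<psi> x\<bar> \<le> K" using bounded_continuous_support[OF smooth_continuous[OF \<psi>] R] by metis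
      have "(\<lambda>n. \<integral>y. \<psi> (x + (1/2) ^ n *\<^sub>R y) * indicator B y \<partial>lborel) \<longlonglongrightarrow> (\<integral>y. \<psi> x * indicator B y \<partial>lborel)"
      proof (rule integral_dominated_convergence[where w="\<lambda>y. K * indicator B y"])
        show "integrable lborel (\<lambda>y. K * indicator B y)"
          using B eB by (intro integrable_mult_right integrable_real_indicator) auto
        show "AE y in lborel. (\<lambda>n. \<psi> (x + (1/2) ^ n *\<^sub>R y) * indicator B y) \<longlonglongrightarrow> \<psi> x * indicator B y"
        proof (intro AE_I2)
          fix y
          have "(\<lambda>n. x + (1/2) ^ n *\<^sub>R y) \<longlonglongrightarrow> x + 0 *\<^sub>R y"
            by (intro tendsto_intros LIMSEQ_realpow_zero) auto
          then have "(\<lambda>n. \<psi> (x + (1/2) ^ n *\<^sub>R y)) \<longlonglongrightarrow> \<psi> x"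
            by (intro continuous_on_tendsto_compose[OF smooth_continuous[OF \<psi>, of UNIV]]) auto
          then show "(\<lambda>n. \<psi> (x + (1/2) ^ n *\<^sub>R y) * indicator B y) \<longlonglongrightarrow> \<psi> x * indicator B y"
            by (intro tendsto_intros)
        qed
        show "AE y in lborel. norm (\<psi> (x + (1/2) ^ n *\<^sub>R y) * indicator B y) \<le> K * indicator B y" for n
          using K by (intro AE_I2) (auto simp: indicator_def)
      qed measurable
      then have "(\<lambda>n. a n x) \<longlonglongrightarrow> (1 / \<beta>) * (\<integral>y. \<psi> x * indicator B y \<partial>lborel)"
        unfolding a_def by (intro tendsto_mult_left)
      also have "(1 / \<beta>) * (\<integral>y. \<psi> x * indicator B y \<partial>lborel) = \<psi> x"
        using \<beta> by (simp add: \<beta>_def)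
      finally show ?thesis .
    qed
    have "(\<integral>\<^sup>+x. ennreal (\<bar>\<psi> x\<bar> powr q) \<partial>lborel) = (\<integral>\<^sup>+x. liminf (\<lambda>n. ennreal (\<bar>a n x\<bar> powr q)) \<partial>lborel)"
    proof (rule nn_integral_cong)
      fix x
      have "(\<lambda>n. ennreal (\<bar>a n x\<bar> powr q)) \<longlonglongrightarrow> ennreal (\<bar>\<psi> x\<bar> powr q)"
        using lim[of x] q by (intro tendsto_ennrealI tendsto_powr2 tendsto_rabs tendsto_const) auto
      then show "ennreal (\<bar>\<psi> x\<bar> powr q) = liminf (\<lambda>n. ennreal (\<bar>a n x\<bar> powr q))"
        using lim_imp_Liminf[OF sequentially_bot] by metis
    qed
    also have "\<dots> \<le> liminf (\<lambda>n. \<integral>\<^sup>+x. ennreal (\<bar>a n x\<bar> powr q) \<partial>lborel)"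
      by (intro nn_integral_liminf) measurable
    also have "\<dots> \<le> limsup (\<lambda>n. \<integral>\<^sup>+x. ennreal (\<bar>a n x\<bar> powr q) \<partial>lborel)"
      by (intro Liminf_le_Limsup) simp
    also have "\<dots> \<le> ennreal (C * G powr (q / 2))"
      by (intro Limsup_bounded always_eventually allI an)
    finally show "(\<integral>\<^sup>+x. ennreal (\<bar>\<psi> x\<bar> powr q) \<partial>lborel) \<le> ennreal (C * G powr (q / 2))" .
  qed
qed

context bounded_open_set
begin

lemma test_function_H1_Lq:
  fixes q :: real
  assumes q: "2 < q" and d: "real DIM('a) * (1/2 - 1/q) < 1"
  obtains C where "0 \<le> C"
    "\<And>\<psi>. \<psi> \<in> test_functions \<Omega> \<Longrightarrow> (\<integral>\<^sup>+x. ennreal (\<bar>\<psi> x\<bar> powr q) \<partial>M) \<le> ennreal (C * H1_norm \<Omega> (abs_aefun \<psi>) powr q)"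
proof -
  obtain C where C: "0 \<le> C" "\<And>(\<psi> :: 'a \<Rightarrow> real) G R. smooth \<psi> \<Longrightarrow> (\<And>x. R \<le> norm x \<Longrightarrow> \<psi> x = 0) \<Longrightarrow> 0 \<le> G \<Longrightarrow>
       (\<integral>\<^sup>+x. ennreal ((\<psi> x)\<^sup>2) \<partial>lborel) \<le> ennreal G \<Longrightarrow>
       (\<integral>\<^sup>+x. ennreal ((norm (grad \<psi> x))\<^sup>2) \<partial>lborel) \<le> ennreal G \<Longrightarrow>
       (\<integral>\<^sup>+x. ennreal (\<bar>\<psi> x\<bar> powr q) \<partial>lborel) \<le> ennreal (C * G powr (q / 2))"
    using test_function_Lq_bound[OF q d] by metis
  show thesis
  proof (rule that[OF C(1)])
    fix \<psi> assume \<psi>: "\<psi> \<in> test_functions \<Omega>"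
    note T = test_functionsD[OF \<psi>]
    define N where "N = H1_norm \<Omega> (abs_aefun \<psi>)"
    have N0: "0 \<le> N" unfolding N_def using jet_test_function(1)[OF \<psi>] by simp
    have N2: "N\<^sup>2 = (\<integral>x. (norm (\<psi> x, grad \<psi> x))\<^sup>2 \<partial>M)"
      unfolding N_def H1_norm_square[OF jet_test_function(1)[OF \<psi>]] power2_norm_eq_inner
      by (intro integral_inner_cong jet_sq jet_test_function \<psi>)
    have "bounded (closure {x. \<psi> x \<noteq> 0})" using \<psi> compact_imp_bounded by (auto simp: test_functions_def)
    then obtain R where "\<forall>x\<in>closure {x. \<psi> x \<noteq> 0}. norm x \<le> R" unfolding bounded_iff by blast
    then have out: "x \<notin> closure {x. \<psi> x \<noteq> 0}" if "R + 1 \<le> norm x" for x using that by fastforce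
    have R: "\<psi> x = 0" "grad \<psi> x = 0" if "R + 1 \<le> norm x" for x
      using closure_subset[of "{x. \<psi> x \<noteq> 0}"] out[OF that] frechet_derivative_zero_outside[of x \<psi>] by (auto simp: grad_def)
    have g0: "grad \<psi> x = 0" if "x \<notin> \<Omega>" for x
      unfolding grad_def using test_functionsD(2)[OF test_functions_partial[OF \<psi>] that] by simp
    have c: "continuous_on UNIV (\<lambda>x. (\<psi> x)\<^sup>2)" "continuous_on UNIV (\<lambda>x. (norm (grad \<psi> x))\<^sup>2)"
      by (intro continuous_intros smooth_continuous[OF T(1)] continuous_grad[OF T(1)])+
    have i: "integrable lborel (\<lambda>x. (\<psi> x)\<^sup>2)" "integrable lborel (\<lambda>x. (norm (grad \<psi> x))\<^sup>2)"
      by (rule integrable_continuous_support[OF c(1), of "R + 1"], use R in simp)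
        (rule integrable_continuous_support[OF c(2), of "R + 1"], use R in simp)
    note L = integral_lebesgue_on_support[OF sets_\<Omega> i(1)] integral_lebesgue_on_support[OF sets_\<Omega> i(2)]
    have s: "N\<^sup>2 = (\<integral>x. (\<psi> x)\<^sup>2 \<partial>M) + (\<integral>x. (norm (grad \<psi> x))\<^sup>2 \<partial>M)"
      unfolding N2 using L T(2) g0 by (simp add: norm_Pair)
    have "(\<integral>x. (\<psi> x)\<^sup>2 \<partial>M) \<le> N\<^sup>2" "(\<integral>x. (norm (grad \<psi> x))\<^sup>2 \<partial>M) \<le> N\<^sup>2" unfolding s by simp_all
    then have "(\<integral>x. (\<psi> x)\<^sup>2 \<partial>lborel) \<le> N\<^sup>2" "(\<integral>x. (norm (grad \<psi> x))\<^sup>2 \<partial>lborel) \<le> N\<^sup>2"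
      using L T(2) g0 by auto
    then have "(\<integral>\<^sup>+x. ennreal ((\<psi> x)\<^sup>2) \<partial>lborel) \<le> ennreal (N\<^sup>2)"
      "(\<integral>\<^sup>+x. ennreal ((norm (grad \<psi> x))\<^sup>2) \<partial>lborel) \<le> ennreal (N\<^sup>2)"
      using nn_integral_eq_integral[OF i(1)] nn_integral_eq_integral[OF i(2)] by (auto intro: ennreal_leI)
    then have *: "(\<integral>\<^sup>+x. ennreal (\<bar>\<psi> x\<bar> powr q) \<partial>lborel) \<le> ennreal (C * N\<^sup>2 powr (q / 2))"
      by (intro C(2)[OF T(1), of "R + 1"]) (use R in auto)
    have "N\<^sup>2 powr (q / 2) = N powr q"
    proof (cases "N = 0")
      case False
      then have "N\<^sup>2 powr (q / 2) = (N powr 2) powr (q / 2)" using N0 by simp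
      also have "\<dots> = N powr (2 * (q / 2))" by (rule powr_powr)
      finally show ?thesis by simp
    qed simp
    moreover have "(\<integral>\<^sup>+x. ennreal (\<bar>\<psi> x\<bar> powr q) \<partial>M) \<le> (\<integral>\<^sup>+x. ennreal (\<bar>\<psi> x\<bar> powr q) \<partial>lborel)"
    proof -
      have "(\<integral>\<^sup>+x. ennreal (\<bar>\<psi> x\<bar> powr q) \<partial>M) = (\<integral>\<^sup>+x. ennreal (\<bar>\<psi> x\<bar> powr q) * indicator \<Omega> x \<partial>lebesgue)"
        using sets_\<Omega> by (subst nn_integral_restrict_space) auto
      also have "\<dots> \<le> (\<integral>\<^sup>+x. ennreal (\<bar>\<psi> x\<bar> powr q) \<partial>lebesgue)"
        by (intro nn_integral_mono) (auto simp: indicator_def)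
      also have "\<dots> = (\<integral>\<^sup>+x. ennreal (\<bar>\<psi> x\<bar> powr q) \<partial>lborel)"
        by (rule nn_integral_completion)
      finally show ?thesis .
    qed
    ultimately show "(\<integral>\<^sup>+x. ennreal (\<bar>\<psi> x\<bar> powr q) \<partial>M) \<le> ennreal (C * H1_norm \<Omega> (abs_aefun \<psi>) powr q)"
      using * by (simp add: N_def)
  qed
qed

text \<open>
Test functions approximating \<open>u\<close> converge almost everywhere along a subsequence; Fatou's lemma carries
the bound over to \<open>u\<close>.
\<close>

lemma Sobolev_embedding:
  fixes q :: real
  assumes q: "2 < q" and d: "real DIM('a) * (1/2 - 1/q) < 1"
  obtains C where "0 \<le> C"
    "\<And>u. u \<in> H10 \<Omega> \<Longrightarrow> integrable M (\<lambda>x. \<bar>rep_aefun u x\<bar> powr q)"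
    "\<And>u. u \<in> H10 \<Omega> \<Longrightarrow> (\<integral>x. \<bar>rep_aefun u x\<bar> powr q \<partial>M) \<le> C * H1_norm \<Omega> u powr q"
proof -
  obtain C where C: "0 \<le> C"
    "\<And>\<psi>. \<psi> \<in> test_functions \<Omega> \<Longrightarrow> (\<integral>\<^sup>+x. ennreal (\<bar>\<psi> x\<bar> powr q) \<partial>M) \<le> ennreal (C * H1_norm \<Omega> (abs_aefun \<psi>) powr q)"
    using test_function_H1_Lq[OF q d] by metis
  have nn: "(\<integral>\<^sup>+x. ennreal (\<bar>rep_aefun u x\<bar> powr q) \<partial>M) \<le> ennreal (C * H1_norm \<Omega> u powr q)" if u: "u \<in> H10 \<Omega>" for u
  proof -
    define N where "N = H1_norm \<Omega> u"
    have uH: "u \<in> H1 \<Omega>" using u by (rule H10_H1)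
    have um: "rep_aefun u \<in> borel_measurable M" using H1_sq[OF uH] by (rule square_integrable_measurable)
    have "\<exists>\<psi>\<in>test_functions \<Omega>. H1_norm \<Omega> (u - abs_aefun \<psi>) < 1 / real (Suc n)" for n
      by (rule H10_approx[OF u]) simp
    then obtain \<psi> where \<psi>: "\<And>n. \<psi> n \<in> test_functions \<Omega>" "\<And>n. H1_norm \<Omega> (u - abs_aefun (\<psi> n)) < 1 / real (Suc n)"
      by metis
    have pm: "\<psi> n \<in> borel_measurable M" for n using test_function_in_L2[OF \<psi>(1)] by (rule square_integrable_measurable)
    have pH: "abs_aefun (\<psi> n) \<in> H1 \<Omega>" for n by (rule jet_test_function(1)[OF \<psi>(1)])
    have l0: "(\<lambda>n. 1 / real (Suc n)) \<longlonglongrightarrow> 0" by (rule LIMSEQ_Suc[OF lim_1_over_n])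
    have lim: "(\<lambda>n. H1_norm \<Omega> (abs_aefun (\<psi> n) - u)) \<longlonglongrightarrow> 0"
    proof (rule Lim_null_comparison[OF _ l0], intro always_eventually allI)
      fix n show "norm (H1_norm \<Omega> (abs_aefun (\<psi> n) - u)) \<le> 1 / real (Suc n)"
        using \<psi>(2)[of n] H1.nm_diff_commute[OF uH pH[of n]] H1.nm_nonneg[of "abs_aefun (\<psi> n) - u"] uH pH by auto
    qed
    have limN: "(\<lambda>n. H1_norm \<Omega> (abs_aefun (\<psi> n))) \<longlonglongrightarrow> N" unfolding N_def by (rule H1.tendsto_nm[OF pH uH lim])
    define w where "w = (\<lambda>n x. (rep_aefun u x - \<psi> n x)\<^sup>2)"
    have wi: "integrable M (w n)" for n
      using square_integrable_diff[OF H1_sq[OF uH] test_function_in_L2[OF \<psi>(1)]] by (simp add: w_def square_integrable_def)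
    have wl: "(\<lambda>n. \<integral>x. norm (w n x) \<partial>M) \<longlonglongrightarrow> 0"
    proof (rule Lim_null_comparison)
      show "(\<lambda>n. (H1_norm \<Omega> (abs_aefun (\<psi> n) - u))\<^sup>2) \<longlonglongrightarrow> 0" using tendsto_power[OF lim, of 2] by simp
      show "\<forall>\<^sub>F n in sequentially. norm (\<integral>x. norm (w n x) \<partial>M) \<le> (H1_norm \<Omega> (abs_aefun (\<psi> n) - u))\<^sup>2"
      proof (intro always_eventually allI)
        fix n
        have "(\<integral>x. norm (w n x) \<partial>M) \<le> (\<integral>x. (norm (jet (abs_aefun (\<psi> n)) x - jet u x))\<^sup>2 \<partial>M)"
        proof (rule integral_mono_AE)
          show "integrable M (\<lambda>x. norm (w n x))" using wi by auto
          show "integrable M (\<lambda>x. (norm (jet (abs_aefun (\<psi> n)) x - jet u x))\<^sup>2)"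
            using square_integrable_diff[OF jet_sq[OF pH] jet_sq[OF uH]] by (simp add: square_integrable_def)
          show "AE x in M. norm (w n x) \<le> (norm (jet (abs_aefun (\<psi> n)) x - jet u x))\<^sup>2"
            using jet_test_function(2)[OF \<psi>(1)[of n]]
            by eventually_elim (simp add: w_def jet_def norm_Pair power2_commute)
        qed
        then show "norm (\<integral>x. norm (w n x) \<partial>M) \<le> (H1_norm \<Omega> (abs_aefun (\<psi> n) - u))\<^sup>2"
          by (simp add: H1_norm_diff_square[OF pH uH])
      qed
    qed
    obtain r where r: "strict_mono r" "AE x in M. (\<lambda>n. w (r n) x) \<longlonglongrightarrow> 0"
      using tendsto_L1_AE_subseq[OF wi wl] by blast
    have "(\<integral>\<^sup>+x. ennreal (\<bar>rep_aefun u x\<bar> powr q) \<partial>M) = (\<integral>\<^sup>+x. liminf (\<lambda>n. ennreal (\<bar>\<psi> (r n) x\<bar> powr q)) \<partial>M)"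
    proof (rule nn_integral_cong_AE, use r(2) in eventually_elim)
      fix x assume "(\<lambda>n. w (r n) x) \<longlonglongrightarrow> 0"
      then have "(\<lambda>n. rep_aefun u x - \<psi> (r n) x) \<longlonglongrightarrow> 0" unfolding w_def by (rule tendsto_zero_of_square)
      then have "(\<lambda>n. rep_aefun u x - (rep_aefun u x - \<psi> (r n) x)) \<longlonglongrightarrow> rep_aefun u x - 0" by (intro tendsto_diff tendsto_const)
      then have "(\<lambda>n. \<psi> (r n) x) \<longlonglongrightarrow> rep_aefun u x" by simp
      then have "(\<lambda>n. ennreal (\<bar>\<psi> (r n) x\<bar> powr q)) \<longlonglongrightarrow> ennreal (\<bar>rep_aefun u x\<bar> powr q)"
        using q by (intro tendsto_ennrealI tendsto_powr2 tendsto_rabs tendsto_const) auto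
      then show "ennreal (\<bar>rep_aefun u x\<bar> powr q) = liminf (\<lambda>n. ennreal (\<bar>\<psi> (r n) x\<bar> powr q))"
        using lim_imp_Liminf[OF sequentially_bot] by metis
    qed
    also have "\<dots> \<le> liminf (\<lambda>n. \<integral>\<^sup>+x. ennreal (\<bar>\<psi> (r n) x\<bar> powr q) \<partial>M)"
      using pm by (intro nn_integral_liminf) measurable
    also have "\<dots> \<le> liminf (\<lambda>n. ennreal (C * H1_norm \<Omega> (abs_aefun (\<psi> (r n))) powr q))"
      by (intro Liminf_mono always_eventually allI C(2) \<psi>(1))
    also have "\<dots> = ennreal (C * N powr q)"
    proof (rule lim_imp_Liminf[OF sequentially_bot])
      have "(\<lambda>n. H1_norm \<Omega> (abs_aefun (\<psi> (r n)))) \<longlonglongrightarrow> N"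
        using LIMSEQ_subseq_LIMSEQ[OF limN r(1)] by (simp add: o_def)
      then show "(\<lambda>n. ennreal (C * H1_norm \<Omega> (abs_aefun (\<psi> (r n))) powr q)) \<longlonglongrightarrow> ennreal (C * N powr q)"
        using q pH by (intro tendsto_ennrealI tendsto_mult_left tendsto_powr2 tendsto_const) (auto intro!: always_eventually)
    qed
    finally show ?thesis by (simp add: N_def)
  qed
  have i: "integrable M (\<lambda>x. \<bar>rep_aefun u x\<bar> powr q)" if u: "u \<in> H10 \<Omega>" for u
  proof (rule integrableI_bounded)
    have [measurable]: "rep_aefun u \<in> borel_measurable M" using H1_sq[OF H10_H1[OF u]] by (rule square_integrable_measurable)
    show "(\<lambda>x. \<bar>rep_aefun u x\<bar> powr q) \<in> borel_measurable M" by measurable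
    show "(\<integral>\<^sup>+x. ennreal (norm (\<bar>rep_aefun u x\<bar> powr q)) \<partial>M) < \<infinity>"
      using nn[OF u] by (auto simp: less_top[symmetric] top_unique)
  qed
  show thesis
  proof (rule that[OF C(1) i])
    fix u assume u: "u \<in> H10 \<Omega>"
    show "(\<integral>x. \<bar>rep_aefun u x\<bar> powr q \<partial>M) \<le> C * H1_norm \<Omega> u powr q"
      using nn[OF u] nn_integral_eq_integral[OF i[OF u]] C(1) by simp
  qed
qed

end

section \<open>The power nonlinearity\<close>

lemma signed_power_mult:
  "\<bar>x * y\<bar> powr r * (x * y) = (\<bar>x\<bar> powr r * x) * (\<bar>y\<bar> powr r * y)" for x y r :: real
  by (simp add: abs_mult powr_mult)

text \<open>
The map \<open>x \<mapsto> \<bar>x\<bar>\<^sup>p\<^sup>-\<^sup>1 x\<close> is multiplicative, which reduces the claim to \<open>a = 1\<close>. There the error is below \<open>\<eta> \<bar>s\<bar>\<close> for small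
\<open>s\<close> by differentiability, and for the other \<open>s\<close> each term is at most a multiple of \<open>\<bar>s\<bar>\<^sup>p\<close>. A Taylor estimate with
the second derivative would fail near \<open>0\<close> when \<open>p < 2\<close>.
\<close>

lemma signed_power_expansion:
  fixes p \<eta> :: real
  assumes p: "1 < p" and \<eta>: "0 < \<eta>"
  obtains K where "0 \<le> K" "\<And>a h. \<bar>\<bar>a + h\<bar> powr (p - 1) * (a + h) - \<bar>a\<bar> powr (p - 1) * a - p * \<bar>a\<bar> powr (p - 1) * h\<bar>
     \<le> \<eta> * (\<bar>a\<bar> powr (p - 1) * \<bar>h\<bar>) + K * (\<bar>h\<bar> powr (p - 1) * \<bar>h\<bar>)"
proof -
  define F where "F = (\<lambda>x::real. \<bar>x\<bar> powr (p - 1) * x)"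
  have F_le: "\<bar>F x\<bar> = \<bar>x\<bar> powr p" for x
  proof (cases "x = 0")
    case False
    then have "\<bar>F x\<bar> = \<bar>x\<bar> powr (p - 1) * \<bar>x\<bar> powr 1" by (simp add: F_def abs_mult)
    also have "\<dots> = \<bar>x\<bar> powr p" unfolding powr_add[symmetric] by simp
    finally show ?thesis .
  qed (simp add: F_def)
  have "((\<lambda>x. x powr p) has_real_derivative p) (at (1::real))"
    by (auto intro!: derivative_eq_intros)
  then have "(F has_real_derivative p) (at 1)"
  proof (rule has_field_derivative_transform_within_open[of _ _ _ "{0<..}"])
    fix x :: real assume "x \<in> {0<..}"
    moreover have "x powr p = x powr (p - 1) * x powr 1" unfolding powr_add[symmetric] by simp
    ultimately show "x powr p = F x" by (simp add: F_def)
  qed auto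
  then have "((\<lambda>s. (F (1 + s) - F 1) / s) \<longlongrightarrow> p) (at 0)" by (simp add: DERIV_def)
  then have "\<forall>\<^sub>F s in at 0. dist ((F (1 + s) - F 1) / s) p < \<eta>" using \<eta> by (rule tendstoD)
  then obtain \<delta> where d: "0 < \<delta>" "\<And>s. s \<noteq> 0 \<Longrightarrow> \<bar>s\<bar> < \<delta> \<Longrightarrow> \<bar>(F (1 + s) - F 1) / s - p\<bar> < \<eta>"
    unfolding eventually_at dist_real_def by auto
  \<comment> \<open>The three summands after \<open>1\<close> control \<open>F (1 + s)\<close>, \<open>F 1\<close> and the linear term when \<open>\<delta> \<le> \<bar>s\<bar>\<close>; the \<open>1\<close> serves \<open>a = 0\<close>.\<close>
  define K where "K = 1 + (1 / \<delta> + 1) powr p + (1 / \<delta>) powr p + p * \<delta> powr (1 - p)"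
  have K: "1 \<le> K" using p by (simp add: K_def)
  have one: "\<bar>F (1 + s) - 1 - p * s\<bar> \<le> \<eta> * \<bar>s\<bar> + K * \<bar>s\<bar> powr p" for s
  proof (cases "\<bar>s\<bar> < \<delta>")
    case True
    have "\<bar>F (1 + s) - 1 - p * s\<bar> \<le> \<eta> * \<bar>s\<bar>"
    proof (cases "s = 0")
      case False
      have "\<bar>F (1 + s) - 1 - p * s\<bar> = \<bar>(F (1 + s) - F 1) / s - p\<bar> * \<bar>s\<bar>"
        using False by (simp add: F_def abs_mult[symmetric] field_simps)
      also have "\<dots> \<le> \<eta> * \<bar>s\<bar>" using d(2)[OF False True] by (intro mult_right_mono) auto
      finally show ?thesis .
    qed (simp add: F_def)
    then show ?thesis using K by (simp add: add_increasing2)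
  next
    case False
    then have s: "\<delta> \<le> \<bar>s\<bar>" "0 < \<bar>s\<bar>" using d(1) by auto
    have 1: "1 \<le> \<bar>s\<bar> / \<delta>" using s d(1) by simp
    have "\<bar>F (1 + s)\<bar> \<le> ((1 / \<delta> + 1) * \<bar>s\<bar>) powr p"
      unfolding F_le using 1 p by (intro powr_mono2) (auto simp: distrib_right)
    also have "\<dots> = (1 / \<delta> + 1) powr p * \<bar>s\<bar> powr p" using d(1) by (intro powr_mult)
    finally have a: "\<bar>F (1 + s)\<bar> \<le> (1 / \<delta> + 1) powr p * \<bar>s\<bar> powr p" .
    have "1 powr p \<le> (1 / \<delta> * \<bar>s\<bar>) powr p" using 1 p by (intro powr_mono2) auto
    also have "\<dots> = (1 / \<delta>) powr p * \<bar>s\<bar> powr p" using d(1) by (intro powr_mult)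
    finally have b: "1 \<le> (1 / \<delta>) powr p * \<bar>s\<bar> powr p" by simp
    have "\<bar>s\<bar> = \<bar>s\<bar> powr (1 - p) * \<bar>s\<bar> powr p" using s by (simp add: powr_add[symmetric])
    also have "\<dots> \<le> \<delta> powr (1 - p) * \<bar>s\<bar> powr p"
      using s d(1) p by (intro mult_right_mono powr_mono2') auto
    finally have c: "p * \<bar>s\<bar> \<le> p * \<delta> powr (1 - p) * \<bar>s\<bar> powr p" using p by (simp add: mult.assoc)
    have "\<bar>F (1 + s) - 1 - p * s\<bar> \<le> \<bar>F (1 + s)\<bar> + 1 + p * \<bar>s\<bar>"
    proof -
      have "\<bar>p * s\<bar> = p * \<bar>s\<bar>" using p by (simp add: abs_mult)
      then show ?thesis by linarith
    qed
    also have "\<dots> \<le> (K - 1) * \<bar>s\<bar> powr p" using a b c by (simp add: K_def algebra_simps)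
    also have "\<dots> \<le> \<eta> * \<bar>s\<bar> + K * \<bar>s\<bar> powr p" using \<eta> by (simp add: algebra_simps)
    finally show ?thesis .
  qed
  show thesis
  proof (rule that[of K])
    show "0 \<le> K" using K by simp
    fix a h :: real
    have hp: "\<bar>h\<bar> powr (p - 1) * \<bar>h\<bar> = \<bar>h\<bar> powr p" for h
      using F_le[of h] by (simp add: F_def abs_mult)
    show "\<bar>\<bar>a + h\<bar> powr (p - 1) * (a + h) - \<bar>a\<bar> powr (p - 1) * a - p * \<bar>a\<bar> powr (p - 1) * h\<bar>
       \<le> \<eta> * (\<bar>a\<bar> powr (p - 1) * \<bar>h\<bar>) + K * (\<bar>h\<bar> powr (p - 1) * \<bar>h\<bar>)"
    proof (cases "a = 0")
      case True
      have "\<bar>h\<bar> powr (p - 1) * \<bar>h\<bar> \<le> K * (\<bar>h\<bar> powr (p - 1) * \<bar>h\<bar>)" using mult_right_mono[of 1 K "\<bar>h\<bar> powr (p - 1) * \<bar>h\<bar>"] K by simp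
      then show ?thesis using True by (simp add: abs_mult)
    next
      case False
      define s where "s = h / a"
      have h: "h = a * s" using False by (simp add: s_def)
      have ah: "a + h = a * (1 + s)" using h by (simp add: algebra_simps)
      have "F (a + h) - F a - p * \<bar>a\<bar> powr (p - 1) * h = F a * (F (1 + s) - 1 - p * s)"
      proof -
        have "F (a + h) = F a * F (1 + s)" unfolding ah F_def by (rule signed_power_mult)
        then show ?thesis by (simp add: h F_def algebra_simps)
      qed
      then have "\<bar>F (a + h) - F a - p * \<bar>a\<bar> powr (p - 1) * h\<bar> = \<bar>a\<bar> powr p * \<bar>F (1 + s) - 1 - p * s\<bar>"
        by (simp add: abs_mult F_le)
      also have "\<dots> \<le> \<bar>a\<bar> powr p * (\<eta> * \<bar>s\<bar> + K * \<bar>s\<bar> powr p)" by (intro mult_left_mono one) auto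
      also have "\<dots> = \<eta> * (\<bar>a\<bar> powr p * \<bar>s\<bar>) + K * (\<bar>a\<bar> powr p * \<bar>s\<bar> powr p)" by (simp add: algebra_simps)
      also have "\<bar>a\<bar> powr p * \<bar>s\<bar> powr p = \<bar>h\<bar> powr p" unfolding h abs_mult by (rule powr_mult[symmetric])
      also have "\<bar>a\<bar> powr p * \<bar>s\<bar> = \<bar>a\<bar> powr (p - 1) * \<bar>h\<bar>"
        using hp[of a] by (simp add: h abs_mult mult.assoc[symmetric])
      finally show ?thesis by (simp add: F_def hp)
    qed
  qed
qed

text \<open>
The left side is at most \<open>m\<^sup>p\<^sup>+\<^sup>1\<close> for the maximum \<open>m\<close> of the three numbers. After scaling to unit norms this does
the work of Hoelder's inequality with three factors.
\<close>

lemma product_le_sum_of_powers: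
  fixes a b c p :: real
  assumes "0 \<le> a" "0 \<le> b" "0 \<le> c" "1 < p"
  shows "a powr (p - 1) * b * c \<le> a powr (p + 1) + b powr (p + 1) + c powr (p + 1)"
proof -
  define m where "m = max a (max b c)"
  have m: "0 \<le> m" "a \<le> m" "b \<le> m" "c \<le> m" using assms by (auto simp: m_def)
  have "a powr (p - 1) * b * c \<le> m powr (p - 1) * m * m"
    using m assms by (intro mult_mono powr_mono2) auto
  also have "\<dots> = m powr (p + 1)"
  proof (cases "m = 0")
    case False
    then have "m powr (p - 1) * m * m = m powr (p - 1) * m powr 1 * m powr 1" using m by simp
    also have "\<dots> = m powr (p + 1)" unfolding powr_add[symmetric] by simp
    finally show ?thesis .
  qed simp
  also have "\<dots> \<le> a powr (p + 1) + b powr (p + 1) + c powr (p + 1)"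
    by (auto simp: m_def max_def)
  finally show ?thesis .
qed

context bounded_open_set
begin

lemma rep_measurable: "u \<in> H10 \<Omega> \<Longrightarrow> rep_aefun u \<in> borel_measurable M"
  using H1_sq[OF H10_H1] by (rule square_integrable_measurable)

text \<open>
The Riesz theorem puts the functional into the range of \<^const>\<open>L_op\<close>, and \<^const>\<open>L_inv\<close> then selects a preimage.
\<close>

lemma L_inv_representation:
  assumes int: "\<And>v. v \<in> H10 \<Omega> \<Longrightarrow> integrable M (\<lambda>x. f x * rep_aefun v x)"
    and bd: "\<And>v. v \<in> H10 \<Omega> \<Longrightarrow> \<bar>\<integral>x. f x * rep_aefun v x \<partial>M\<bar> \<le> K * H1_norm \<Omega> v"
  shows "L_inv \<Omega> (L2_functional \<Omega> f) \<in> H10 \<Omega>"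
    "v \<in> H10 \<Omega> \<Longrightarrow> H1_inner \<Omega> (L_inv \<Omega> (L2_functional \<Omega> f)) v = (\<integral>x. f x * rep_aefun v x \<partial>M)"
proof -
  have add: "(\<integral>x. f x * rep_aefun (v + w) x \<partial>M) = (\<integral>x. f x * rep_aefun v x \<partial>M) + (\<integral>x. f x * rep_aefun w x \<partial>M)"
    if vw: "v \<in> H10 \<Omega>" "w \<in> H10 \<Omega>" for v w
  proof -
    have "(\<integral>x. f x * rep_aefun (v + w) x \<partial>M) = (\<integral>x. f x * rep_aefun v x + f x * rep_aefun w x \<partial>M)"
    proof (rule integral_cong_AE)
      show "(\<lambda>x. f x * rep_aefun (v + w) x) \<in> borel_measurable M"
        using int[of "v + w"] vw by auto
      show "(\<lambda>x. f x * rep_aefun v x + f x * rep_aefun w x) \<in> borel_measurable M"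
        using int vw by (intro borel_measurable_add borel_measurable_integrable)
      show "AE x in M. f x * rep_aefun (v + w) x = f x * rep_aefun v x + f x * rep_aefun w x"
        using AE_M[OF rep_aefun_add[of v w]] by eventually_elim (simp add: distrib_left)
    qed
    then show ?thesis using int vw by simp
  qed
  have scale: "(\<integral>x. f x * rep_aefun (c *\<^sub>R v) x \<partial>M) = c * (\<integral>x. f x * rep_aefun v x \<partial>M)" if v: "v \<in> H10 \<Omega>" for c v
  proof -
    have "(\<integral>x. f x * rep_aefun (c *\<^sub>R v) x \<partial>M) = (\<integral>x. c * (f x * rep_aefun v x) \<partial>M)"
    proof (rule integral_cong_AE)
      show "(\<lambda>x. f x * rep_aefun (c *\<^sub>R v) x) \<in> borel_measurable M" using int[of "c *\<^sub>R v"] v by auto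
      show "(\<lambda>x. c * (f x * rep_aefun v x)) \<in> borel_measurable M"
        by (rule borel_measurable_times[OF borel_measurable_const borel_measurable_integrable[OF int[OF v]]])
      show "AE x in M. f x * rep_aefun (c *\<^sub>R v) x = c * (f x * rep_aefun v x)"
        using AE_M[OF rep_aefun_scaleR[of c v]] by eventually_elim simp
    qed
    then show ?thesis by simp
  qed
  obtain w where w: "w \<in> H10 \<Omega>" "\<And>v. v \<in> H10 \<Omega> \<Longrightarrow> H1_inner \<Omega> w v = (\<integral>x. f x * rep_aefun v x \<partial>M)"
    using H10.Riesz_representation[OF add scale bd] by blast
  have "L_op \<Omega> w = L2_functional \<Omega> f"
    unfolding L_op_def L2_functional_def using w(2) by (intro restrict_ext)
  then have "L2_functional \<Omega> f \<in> L_op \<Omega> ` H10 \<Omega>" using w(1) by (metis imageI)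
  then have in1: "L_inv \<Omega> (L2_functional \<Omega> f) \<in> H10 \<Omega>" and eq: "L_op \<Omega> (L_inv \<Omega> (L2_functional \<Omega> f)) = L2_functional \<Omega> f"
    unfolding L_inv_def by (auto intro: inv_into_into f_inv_into_f)
  show "L_inv \<Omega> (L2_functional \<Omega> f) \<in> H10 \<Omega>" by (fact in1)
  show "H1_inner \<Omega> (L_inv \<Omega> (L2_functional \<Omega> f)) v = (\<integral>x. f x * rep_aefun v x \<partial>M)" if "v \<in> H10 \<Omega>"
    using fun_cong[OF eq, of v] that by (simp add: L_op_def L2_functional_def)
qed

lemma H10_eqI:
  assumes "w \<in> H10 \<Omega>" "z \<in> H10 \<Omega>" "\<And>v. v \<in> H10 \<Omega> \<Longrightarrow> H1_inner \<Omega> w v = H1_inner \<Omega> z v"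
  shows "w = z"
proof -
  have "H1_inner \<Omega> (w - z) (w - z) = 0" using assms by (simp add: H10.ip_diff_left)
  then have "w - z = 0" using assms by (intro H10.ip_definite) auto
  then show ?thesis by simp
qed

lemma bounded_below_off_spectrum:
  assumes T: "\<And>h. h \<in> H10 \<Omega> \<Longrightarrow> T h \<in> H10 \<Omega>" and mu: "\<mu> \<notin> spectrum_H10 \<Omega> T"
  shows "H10.bounded_below_at T \<mu>"
proof -
  let ?nm = "H1_norm \<Omega>"
  obtain S where S: "bounded_operator \<Omega> S" "\<And>h. h \<in> H10 \<Omega> \<Longrightarrow> S (\<mu> *\<^sub>R h - T h) = h"
    using mu unfolding spectrum_H10_def by blast
  obtain B where B: "\<And>f. f \<in> H10 \<Omega> \<Longrightarrow> ?nm (S f) \<le> B * ?nm f"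
    using S(1) unfolding bounded_operator_def by blast
  have "1 / max B 1 * ?nm h \<le> ?nm (T h - \<mu> *\<^sub>R h)" if h: "h \<in> H10 \<Omega>" for h
  proof -
    have z: "\<mu> *\<^sub>R h - T h \<in> H10 \<Omega>" using h T by auto
    have "?nm h \<le> B * ?nm (\<mu> *\<^sub>R h - T h)" using B[OF z] S(2)[OF h] by simp
    also have "\<dots> \<le> max B 1 * ?nm (\<mu> *\<^sub>R h - T h)" using z by (intro mult_right_mono) auto
    also have "?nm (\<mu> *\<^sub>R h - T h) = ?nm (T h - \<mu> *\<^sub>R h)" using h T by (intro H10.nm_diff_commute) auto
    finally show ?thesis by (simp add: field_simps)
  qed
  then show ?thesis unfolding H10.bounded_below_at_def by (intro exI[of _ "1 / max B 1"]) auto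
qed

text \<open>
Otherwise \<open>x\<close> and \<open>\<phi>\<close> are two independent vectors in a generalized eigenspace of dimension \<open>1\<close>.
\<close>

lemma simple_eigenspace_orthogonal:
  assumes mult: "algebraic_multiplicity \<Omega> T p = 1"
    and \<phi>: "\<phi> \<in> H10 \<Omega>" "\<phi> \<noteq> 0" and T\<phi>: "T \<phi> = p *\<^sub>R \<phi>"
    and x: "x \<in> H10 \<Omega>" and orth: "H1_inner \<Omega> x \<phi> = 0" and Tx: "T x = p *\<^sub>R x"
  shows "x = 0"
proof (rule ccontr)
  let ?ip = "H1_inner \<Omega>"
  assume x0: "x \<noteq> 0"
  define V where "V = {h \<in> H10 \<Omega>. \<exists>k. ((\<lambda>g. T g - p *\<^sub>R g) ^^ k) h = 0}"
  have dimV: "dim V = 1" using mult by (simp add: algebraic_multiplicity_def V_def)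
  have inV: "x \<in> V" "\<phi> \<in> V"
    unfolding V_def using x \<phi> Tx T\<phi> by (auto intro!: exI[of _ "Suc 0"])
  obtain b where b: "independent b" "span b = span V" "card b = 1"
  proof -
    have "\<exists>b. independent b \<and> span b = span V"
      using dimV unfolding dim_def by (auto split: if_splits)
    then obtain b where "independent b \<and> span b = span V" by blast
    then show thesis using that dim_eq_card[of b V] dimV by auto
  qed
  have fin: "finite b" using b(3) card.infinite by fastforce
  have ne: "x \<noteq> \<phi>"
    using orth H10.ip_pos[OF \<phi>] by auto
  have ind: "independent {x, \<phi>}"
  proof -
    have "x \<notin> span {\<phi>}"
    proof
      assume "x \<in> span {\<phi>}"
      then obtain k where k: "x = k *\<^sub>R \<phi>" by (auto simp: span_singleton)
      then have "k * ?ip \<phi> \<phi> = 0" using orth \<phi> by (simp add: H10.ip_simps)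
      then have "k = 0" using H10.ip_pos[OF \<phi>] by simp
      then show False using k x0 by simp
    qed
    then show ?thesis using \<phi>(2) ne by (simp add: independent_insert)
  qed
  have "{x, \<phi>} \<subseteq> span b" using inV b(2) by (auto intro: span_base)
  then have "card {x, \<phi>} \<le> card b" using independent_span_bound[OF fin ind] by auto
  then show False using b(3) ne by simp
qed

end

text \<open>
The second assumption says \<open>1 / (p + 1) > 1 / 2 - 1 / d\<close>, that is, \<open>p + 1\<close> lies below the critical Sobolev exponent; it
is automatic for \<open>d \<le> 2\<close>.
\<close>

locale subcritical_problem = bounded_open_set \<Omega> for \<Omega> :: "'a::euclidean_space set" +
  fixes p :: real
  assumes p: "1 < p" and subcritical: "real DIM('a) * (1/2 - 1/(p + 1)) < 1"
begin

definition triple :: "'a aefun \<Rightarrow> 'a aefun \<Rightarrow> 'a aefun \<Rightarrow> 'a \<Rightarrow> real" where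
  "triple a b c x = \<bar>rep_aefun a x\<bar> powr (p - 1) * \<bar>rep_aefun b x\<bar> * \<bar>rep_aefun c x\<bar>"

text \<open>
For unit vectors the integrand is dominated by a sum of \<open>(p + 1)\<close>-st powers, which the Sobolev embedding
controls; the general case follows by homogeneity in each argument.
\<close>

lemma trilinear_bound:
  "\<exists>C\<ge>0. \<forall>a\<in>H10 \<Omega>. \<forall>b\<in>H10 \<Omega>. \<forall>c\<in>H10 \<Omega>. integrable M (triple a b c) \<and>
     (\<integral>x. triple a b c x \<partial>M) \<le> C * (H1_norm \<Omega> a powr (p - 1) * H1_norm \<Omega> b * H1_norm \<Omega> c)"
proof -
  obtain C where C: "0 \<le> C"
    and Ci: "\<And>u. u \<in> H10 \<Omega> \<Longrightarrow> integrable M (\<lambda>x. \<bar>rep_aefun u x\<bar> powr (p + 1))"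
    and Cb: "\<And>u. u \<in> H10 \<Omega> \<Longrightarrow> (\<integral>x. \<bar>rep_aefun u x\<bar> powr (p + 1) \<partial>M) \<le> C * H1_norm \<Omega> u powr (p + 1)"
    using Sobolev_embedding[of "p + 1"] p subcritical by auto
  have fi: "integrable M (triple a b c)" if abc: "a \<in> H10 \<Omega>" "b \<in> H10 \<Omega>" "c \<in> H10 \<Omega>" for a b c
  proof (rule Bochner_Integration.integrable_bound)
    show "integrable M (\<lambda>x. \<bar>rep_aefun a x\<bar> powr (p + 1) + \<bar>rep_aefun b x\<bar> powr (p + 1) + \<bar>rep_aefun c x\<bar> powr (p + 1))"
      using abc Ci by auto
    have [measurable]: "rep_aefun a \<in> borel_measurable M" "rep_aefun b \<in> borel_measurable M" "rep_aefun c \<in> borel_measurable M"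
      using abc rep_measurable by auto
    show "triple a b c \<in> borel_measurable M" unfolding triple_def by measurable
    show "AE x in M. norm (triple a b c x) \<le> norm (\<bar>rep_aefun a x\<bar> powr (p + 1) + \<bar>rep_aefun b x\<bar> powr (p + 1) + \<bar>rep_aefun c x\<bar> powr (p + 1))"
      using product_le_sum_of_powers[OF _ _ _ p] by (intro AE_I2) (simp add: triple_def abs_mult)
  qed
  have unit: "(\<integral>x. triple a b c x \<partial>M) \<le> 3 * C" if abc: "a \<in> H10 \<Omega>" "b \<in> H10 \<Omega>" "c \<in> H10 \<Omega>"
    and n: "H1_norm \<Omega> a = 1" "H1_norm \<Omega> b = 1" "H1_norm \<Omega> c = 1" for a b c
  proof -
    have "(\<integral>x. triple a b c x \<partial>M) \<le> (\<integral>x. \<bar>rep_aefun a x\<bar> powr (p + 1) + \<bar>rep_aefun b x\<bar> powr (p + 1) + \<bar>rep_aefun c x\<bar> powr (p + 1) \<partial>M)"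
    proof (rule integral_mono[OF fi[OF abc]])
      show "triple a b c x \<le> \<bar>rep_aefun a x\<bar> powr (p + 1) + \<bar>rep_aefun b x\<bar> powr (p + 1) + \<bar>rep_aefun c x\<bar> powr (p + 1)" for x
        unfolding triple_def by (rule product_le_sum_of_powers[OF _ _ _ p]) auto
    qed (use abc Ci in auto)
    also have "\<dots> \<le> 3 * C" using Cb[OF abc(1)] Cb[OF abc(2)] Cb[OF abc(3)] Ci abc n by simp
    finally show ?thesis .
  qed
  show ?thesis
  proof (rule exI[of _ "3 * C"], intro conjI ballI)
    show "0 \<le> 3 * C" using C by simp
    fix a b c assume abc: "a \<in> H10 \<Omega>" "b \<in> H10 \<Omega>" "c \<in> H10 \<Omega>"
    show "integrable M (triple a b c)" by (rule fi[OF abc])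
    define na nb nc where "na = H1_norm \<Omega> a" and "nb = H1_norm \<Omega> b" and "nc = H1_norm \<Omega> c"
    have n0: "0 \<le> na" "0 \<le> nb" "0 \<le> nc" using abc by (auto simp: na_def nb_def nc_def)
    have "(\<integral>x. triple a b c x \<partial>M) \<le> 3 * C * (na powr (p - 1) * nb * nc)"
    proof (cases "a = 0 \<or> b = 0 \<or> c = 0")
      case True
      have "AE x in M. triple a b c x = 0"
        using AE_M[OF rep_aefun_zero] by eventually_elim (use True in \<open>auto simp: triple_def\<close>)
      then have "(\<integral>x. triple a b c x \<partial>M) = 0"
        by (rule integral_eq_zero_AE)
      then show ?thesis using C n0 by simp
    next
      case False
      then have np: "0 < na" "0 < nb" "0 < nc" using abc H10.nm_pos by (auto simp: na_def nb_def nc_def)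
      define a' b' c' where "a' = (1 / na) *\<^sub>R a" and "b' = (1 / nb) *\<^sub>R b" and "c' = (1 / nc) *\<^sub>R c"
      have abc': "a' \<in> H10 \<Omega>" "b' \<in> H10 \<Omega>" "c' \<in> H10 \<Omega>" using abc by (auto simp: a'_def b'_def c'_def)
      have u: "H1_norm \<Omega> a' = 1" "H1_norm \<Omega> b' = 1" "H1_norm \<Omega> c' = 1"
        using abc np by (auto simp: a'_def b'_def c'_def H10.nm_scale na_def nb_def nc_def)
      have "(\<integral>x. triple a b c x \<partial>M) = (\<integral>x. (na powr (p - 1) * nb * nc) * triple a' b' c' x \<partial>M)"
      proof (rule integral_cong_AE)
        show "triple a b c \<in> borel_measurable M" using fi[OF abc] by auto
        show "(\<lambda>x. (na powr (p - 1) * nb * nc) * triple a' b' c' x) \<in> borel_measurable M" using fi[OF abc'] by auto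
        show "AE x in M. triple a b c x = (na powr (p - 1) * nb * nc) * triple a' b' c' x"
          using AE_M[OF rep_aefun_scaleR[of "1 / na" a]] AE_M[OF rep_aefun_scaleR[of "1 / nb" b]] AE_M[OF rep_aefun_scaleR[of "1 / nc" c]]
        proof eventually_elim
          case (elim x)
          have e: "rep_aefun a x = na * rep_aefun a' x" "rep_aefun b x = nb * rep_aefun b' x" "rep_aefun c x = nc * rep_aefun c' x"
            using elim np by (auto simp: a'_def b'_def c'_def)
          show ?case unfolding triple_def e abs_mult using np by (simp add: powr_mult)
        qed
      qed
      also have "\<dots> = (na powr (p - 1) * nb * nc) * (\<integral>x. triple a' b' c' x \<partial>M)" by simp
      also have "\<dots> \<le> (na powr (p - 1) * nb * nc) * (3 * C)"
        using n0 by (intro mult_left_mono unit abc' u) auto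
      finally show ?thesis by (simp add: mult_ac)
    qed
    then show "(\<integral>x. triple a b c x \<partial>M) \<le> 3 * C * (H1_norm \<Omega> a powr (p - 1) * H1_norm \<Omega> b * H1_norm \<Omega> c)"
      by (simp add: na_def nb_def nc_def)
  qed
qed

lemma signed_triple:
  assumes abc: "a \<in> H10 \<Omega>" "b \<in> H10 \<Omega>" "c \<in> H10 \<Omega>"
  shows "integrable M (\<lambda>x. (\<bar>rep_aefun a x\<bar> powr (p - 1) * rep_aefun b x) * rep_aefun c x)"
    "\<bar>\<integral>x. (\<bar>rep_aefun a x\<bar> powr (p - 1) * rep_aefun b x) * rep_aefun c x \<partial>M\<bar> \<le> (\<integral>x. triple a b c x \<partial>M)"
proof -
  have [measurable]: "rep_aefun a \<in> borel_measurable M" "rep_aefun b \<in> borel_measurable M" "rep_aefun c \<in> borel_measurable M"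
    using abc rep_measurable by auto
  have "integrable M (triple a b c)" using trilinear_bound abc by blast
  then show i: "integrable M (\<lambda>x. (\<bar>rep_aefun a x\<bar> powr (p - 1) * rep_aefun b x) * rep_aefun c x)"
    by (rule Bochner_Integration.integrable_bound) (auto simp: abs_mult triple_def)
  show "\<bar>\<integral>x. (\<bar>rep_aefun a x\<bar> powr (p - 1) * rep_aefun b x) * rep_aefun c x \<partial>M\<bar> \<le> (\<integral>x. triple a b c x \<partial>M)"
    using integral_norm_bound[of M "\<lambda>x. (\<bar>rep_aefun a x\<bar> powr (p - 1) * rep_aefun b x) * rep_aefun c x"]
    by (simp add: abs_mult triple_def)
qed

lemma trilinear_functional:
  "\<exists>C\<ge>0. \<forall>a\<in>H10 \<Omega>. \<forall>b\<in>H10 \<Omega>. \<forall>c\<in>H10 \<Omega>.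
    \<bar>\<integral>x. (\<bar>rep_aefun a x\<bar> powr (p - 1) * rep_aefun b x) * rep_aefun c x \<partial>M\<bar>
      \<le> C * (H1_norm \<Omega> a powr (p - 1) * H1_norm \<Omega> b * H1_norm \<Omega> c)"
proof -
  obtain C where C: "0 \<le> C" and Cb: "\<forall>a\<in>H10 \<Omega>. \<forall>b\<in>H10 \<Omega>. \<forall>c\<in>H10 \<Omega>. integrable M (triple a b c) \<and>
     (\<integral>x. triple a b c x \<partial>M) \<le> C * (H1_norm \<Omega> a powr (p - 1) * H1_norm \<Omega> b * H1_norm \<Omega> c)"
    using trilinear_bound by blast
  show ?thesis
    by (rule exI[of _ C]) (use C Cb in \<open>auto intro!: order_trans[OF signed_triple(2)]\<close>)
qed

text \<open>
The iteration map without its normalizing factor.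
\<close>

definition solution_map :: "'a aefun \<Rightarrow> 'a aefun" where
  "solution_map w = L_inv \<Omega> (L2_functional \<Omega> (power_nl p w))"

lemma solution_map_representation:
  assumes w: "w \<in> H10 \<Omega>"
  shows "solution_map w \<in> H10 \<Omega>"
    and "v \<in> H10 \<Omega> \<Longrightarrow> H1_inner \<Omega> (solution_map w) v = (\<integral>x. power_nl p w x * rep_aefun v x \<partial>M)"
    and "v \<in> H10 \<Omega> \<Longrightarrow> integrable M (\<lambda>x. power_nl p w x * rep_aefun v x)"
proof -
  obtain C where C: "\<forall>a\<in>H10 \<Omega>. \<forall>b\<in>H10 \<Omega>. \<forall>c\<in>H10 \<Omega>.
    \<bar>\<integral>x. (\<bar>rep_aefun a x\<bar> powr (p - 1) * rep_aefun b x) * rep_aefun c x \<partial>M\<bar>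
      \<le> C * (H1_norm \<Omega> a powr (p - 1) * H1_norm \<Omega> b * H1_norm \<Omega> c)"
    using trilinear_functional by blast
  have i: "integrable M (\<lambda>x. power_nl p w x * rep_aefun v x)" if "v \<in> H10 \<Omega>" for v
    unfolding power_nl_def using signed_triple(1)[OF w w that] .
  have b: "\<bar>\<integral>x. power_nl p w x * rep_aefun v x \<partial>M\<bar> \<le> (C * (H1_norm \<Omega> w powr (p - 1) * H1_norm \<Omega> w)) * H1_norm \<Omega> v" if "v \<in> H10 \<Omega>" for v
    unfolding power_nl_def using C[rule_format, OF w w that] by (simp add: mult.assoc)
  show "solution_map w \<in> H10 \<Omega>" unfolding solution_map_def by (rule L_inv_representation(1)[OF i b])
  show "H1_inner \<Omega> (solution_map w) v = (\<integral>x. power_nl p w x * rep_aefun v x \<partial>M)" if "v \<in> H10 \<Omega>"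
    unfolding solution_map_def by (rule L_inv_representation(2)[OF i b that])
  show "integrable M (\<lambda>x. power_nl p w x * rep_aefun v x)" if "v \<in> H10 \<Omega>" by (rule i[OF that])
qed

definition weight :: "'a aefun \<Rightarrow> 'a \<Rightarrow> real" where
  "weight \<phi> x = p * \<bar>rep_aefun \<phi> x\<bar> powr (p - 1)"

lemma T_op_representation:
  assumes \<phi>: "\<phi> \<in> H10 \<Omega>" and h: "h \<in> H10 \<Omega>"
  shows "T_op \<Omega> p \<phi> h \<in> H10 \<Omega>"
    and "v \<in> H10 \<Omega> \<Longrightarrow> H1_inner \<Omega> (T_op \<Omega> p \<phi> h) v = (\<integral>x. weight \<phi> x * rep_aefun h x * rep_aefun v x \<partial>M)"
    and "v \<in> H10 \<Omega> \<Longrightarrow> integrable M (\<lambda>x. weight \<phi> x * rep_aefun h x * rep_aefun v x)"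
    and "\<exists>C\<ge>0. \<forall>h\<in>H10 \<Omega>. \<forall>v\<in>H10 \<Omega>. \<bar>\<integral>x. weight \<phi> x * rep_aefun h x * rep_aefun v x \<partial>M\<bar> \<le> C * H1_norm \<Omega> h * H1_norm \<Omega> v"
proof -
  obtain C where C: "0 \<le> C" "\<forall>a\<in>H10 \<Omega>. \<forall>b\<in>H10 \<Omega>. \<forall>c\<in>H10 \<Omega>.
    \<bar>\<integral>x. (\<bar>rep_aefun a x\<bar> powr (p - 1) * rep_aefun b x) * rep_aefun c x \<partial>M\<bar>
      \<le> C * (H1_norm \<Omega> a powr (p - 1) * H1_norm \<Omega> b * H1_norm \<Omega> c)"
    using trilinear_functional by blast
  define D where "D = p * C * H1_norm \<Omega> \<phi> powr (p - 1)"
  have D: "0 \<le> D" using p C(1) by (simp add: D_def)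
  have e: "(\<lambda>x. weight \<phi> x * rep_aefun h x * rep_aefun v x)
      = (\<lambda>x. p * ((\<bar>rep_aefun \<phi> x\<bar> powr (p - 1) * rep_aefun h x) * rep_aefun v x))" for h v
    by (simp add: weight_def mult.assoc)
  have i: "integrable M (\<lambda>x. weight \<phi> x * rep_aefun h x * rep_aefun v x)" if "h \<in> H10 \<Omega>" "v \<in> H10 \<Omega>" for h v
    unfolding e using signed_triple(1)[OF \<phi> that] by simp
  have b: "\<bar>\<integral>x. weight \<phi> x * rep_aefun h x * rep_aefun v x \<partial>M\<bar> \<le> (D * H1_norm \<Omega> h) * H1_norm \<Omega> v"
    if "h \<in> H10 \<Omega>" "v \<in> H10 \<Omega>" for h v
  proof -
    have "\<bar>\<integral>x. weight \<phi> x * rep_aefun h x * rep_aefun v x \<partial>M\<bar>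
        = p * \<bar>\<integral>x. (\<bar>rep_aefun \<phi> x\<bar> powr (p - 1) * rep_aefun h x) * rep_aefun v x \<partial>M\<bar>"
      unfolding e using p by (simp add: abs_mult)
    also have "\<dots> \<le> p * (C * (H1_norm \<Omega> \<phi> powr (p - 1) * H1_norm \<Omega> h * H1_norm \<Omega> v))"
      using C(2)[rule_format, OF \<phi> that] p by (intro mult_left_mono) auto
    finally show ?thesis by (simp add: D_def mult_ac)
  qed
  have Teq: "T_op \<Omega> p \<phi> h = L_inv \<Omega> (L2_functional \<Omega> (\<lambda>x. weight \<phi> x * rep_aefun h x))"
    by (simp add: T_op_def weight_def)
  show "T_op \<Omega> p \<phi> h \<in> H10 \<Omega>" unfolding Teq by (rule L_inv_representation(1)[OF i[OF h] b[OF h]])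
  show "H1_inner \<Omega> (T_op \<Omega> p \<phi> h) v = (\<integral>x. weight \<phi> x * rep_aefun h x * rep_aefun v x \<partial>M)" if "v \<in> H10 \<Omega>"
    unfolding Teq by (rule L_inv_representation(2)[OF i[OF h] b[OF h] that])
  show "integrable M (\<lambda>x. weight \<phi> x * rep_aefun h x * rep_aefun v x)" if "v \<in> H10 \<Omega>" by (rule i[OF h that])
  show "\<exists>C\<ge>0. \<forall>h\<in>H10 \<Omega>. \<forall>v\<in>H10 \<Omega>. \<bar>\<integral>x. weight \<phi> x * rep_aefun h x * rep_aefun v x \<partial>M\<bar> \<le> C * H1_norm \<Omega> h * H1_norm \<Omega> v"
    using D b by blast
qed

lemma T_op_self_adjoint:
  assumes \<phi>: "\<phi> \<in> H10 \<Omega>"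
  shows "H10.sa_op (T_op \<Omega> p \<phi>)" and "h \<in> H10 \<Omega> \<Longrightarrow> 0 \<le> H1_inner \<Omega> (T_op \<Omega> p \<phi> h) h"
proof -
  let ?ip = "H1_inner \<Omega>" and ?nm = "H1_norm \<Omega>"
  define T where "T = T_op \<Omega> p \<phi>"
  note TH = T_op_representation(1)[OF \<phi>, folded T_def] and Tip = T_op_representation(2)[OF \<phi>, folded T_def]
  have Tsym: "?ip (T h) g = ?ip h (T g)" if h: "h \<in> H10 \<Omega>" and g: "g \<in> H10 \<Omega>" for h g
  proof -
    have "?ip h (T g) = ?ip (T g) h" using h TH[OF g] by (intro H10.ip_sym)
    then show ?thesis using Tip[OF h g] Tip[OF g h] by (simp add: mult_ac)
  qed
  have Tlin: "T (a *\<^sub>R h + g) = a *\<^sub>R T h + T g" if h: "h \<in> H10 \<Omega>" and g: "g \<in> H10 \<Omega>" for a h g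
  proof (rule H10_eqI)
    show "T (a *\<^sub>R h + g) \<in> H10 \<Omega>" "a *\<^sub>R T h + T g \<in> H10 \<Omega>" using TH h g by auto
    fix v assume v: "v \<in> H10 \<Omega>"
    have "?ip (T (a *\<^sub>R h + g)) v = ?ip (a *\<^sub>R h + g) (T v)" using h g v by (intro Tsym) auto
    also have "\<dots> = a * ?ip h (T v) + ?ip g (T v)" using h g TH[OF v] by (simp add: H10.ip_simps)
    also have "\<dots> = ?ip (a *\<^sub>R T h + T g) v" using h g v TH by (simp add: H10.ip_simps Tsym)
    finally show "?ip (T (a *\<^sub>R h + g)) v = ?ip (a *\<^sub>R T h + T g) v" .
  qed
  have T0: "T 0 = 0"
    using Tlin[of 0 0 "-1"] by simp
  obtain C where C: "0 \<le> C" "\<And>h v. h \<in> H10 \<Omega> \<Longrightarrow> v \<in> H10 \<Omega> \<Longrightarrow>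
      \<bar>\<integral>x. weight \<phi> x * rep_aefun h x * rep_aefun v x \<partial>M\<bar> \<le> C * ?nm h * ?nm v"
    using T_op_representation(4)[OF \<phi> \<phi>] by blast
  have Tnorm: "?nm (T h) \<le> C * ?nm h" if h: "h \<in> H10 \<Omega>" for h
  proof (cases "?nm (T h) = 0")
    case True
    then show ?thesis using C(1) h by simp
  next
    case False
    then have pos: "0 < ?nm (T h)" using H10.nm_nonneg[OF TH[OF h]] by linarith
    have "?nm (T h) * ?nm (T h) = ?ip (T h) (T h)" using H10.nm_square[OF TH[OF h]] by (simp add: power2_eq_square)
    also have "\<dots> \<le> (C * ?nm h) * ?nm (T h)"
      using C(2)[OF h TH[OF h]] Tip[OF h TH[OF h]] by linarith
    finally show ?thesis using pos by simp
  qed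
  have "H10.sa_op T"
    unfolding H10.sa_op_def
  proof (intro conjI ballI allI)
    show "T (x + y) = T x + T y" if "x \<in> H10 \<Omega>" "y \<in> H10 \<Omega>" for x y using Tlin[OF that, of 1] by simp
    show "T (c *\<^sub>R x) = c *\<^sub>R T x" if "x \<in> H10 \<Omega>" for c x using Tlin[OF that, of 0 c] T0 by simp
    show "\<exists>C. \<forall>x\<in>H10 \<Omega>. ?nm (T x) \<le> C * ?nm x" using Tnorm by blast
  qed (use TH Tsym in auto)
  then show "H10.sa_op (T_op \<Omega> p \<phi>)" by (simp add: T_def)
  show "0 \<le> ?ip (T_op \<Omega> p \<phi> h) h" if h: "h \<in> H10 \<Omega>"
    unfolding T_op_representation(2)[OF \<phi> h h] using p
    by (intro Bochner_Integration.integral_nonneg) (auto simp: weight_def mult.assoc)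
qed

lemma weak_solution_fixed_point:
  assumes sol: "weak_solution \<Omega> p \<phi>"
  shows "solution_map \<phi> = \<phi>" "T_op \<Omega> p \<phi> \<phi> = p *\<^sub>R \<phi>"
proof -
  let ?ip = "H1_inner \<Omega>"
  have \<phi>: "\<phi> \<in> H10 \<Omega>" using sol by (simp add: weak_solution_def)
  have solv: "?ip \<phi> v = (\<integral>x. power_nl p \<phi> x * rep_aefun v x \<partial>M)" if v: "v \<in> H10 \<Omega>" for v
  proof -
    have 1: "integrable M (\<lambda>x. jet \<phi> x \<bullet> jet v x)" using \<phi> v by (intro square_integrable_inner jet_sq H10_H1)
    have "0 = (\<integral>x. weak_gradient \<Omega> \<phi> x \<bullet> weak_gradient \<Omega> v x
        + rep_aefun \<phi> x * rep_aefun v x - power_nl p \<phi> x * rep_aefun v x \<partial>M)"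
      using sol v by (simp add: weak_solution_def)
    also have "\<dots> = (\<integral>x. jet \<phi> x \<bullet> jet v x - power_nl p \<phi> x * rep_aefun v x \<partial>M)"
      by (simp add: jet_def algebra_simps)
    also have "\<dots> = (\<integral>x. jet \<phi> x \<bullet> jet v x \<partial>M) - (\<integral>x. power_nl p \<phi> x * rep_aefun v x \<partial>M)"
      using 1 solution_map_representation(3)[OF \<phi> v] by simp
    finally show ?thesis by (simp add: H1_inner_jet)
  qed
  show "solution_map \<phi> = \<phi>"
    by (rule H10_eqI) (use \<phi> solution_map_representation[OF \<phi>] solv in auto)
  show "T_op \<Omega> p \<phi> \<phi> = p *\<^sub>R \<phi>"
  proof (rule H10_eqI)
    fix v assume v: "v \<in> H10 \<Omega>"
    have "?ip (T_op \<Omega> p \<phi> \<phi>) v = (\<integral>x. p * (power_nl p \<phi> x * rep_aefun v x) \<partial>M)"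
      unfolding T_op_representation(2)[OF \<phi> \<phi> v] by (simp add: weight_def power_nl_def mult.assoc)
    then show "?ip (T_op \<Omega> p \<phi> \<phi>) v = ?ip (p *\<^sub>R \<phi>) v" using solv[OF v] \<phi> v by (simp add: H10.ip_simps)
  qed (use T_op_representation(1) \<phi> in auto)
qed

text \<open>
The remainder \<open>e\<close> is tested against itself. The expansion of the nonlinearity and the trilinear bound give
\<open>\<parallel>e\<parallel>\<^sup>2 \<le> C (\<eta> \<parallel>\<phi>\<parallel>\<^sup>p\<^sup>-\<^sup>1 + L \<parallel>h\<parallel>\<^sup>p\<^sup>-\<^sup>1) \<parallel>h\<parallel> \<parallel>e\<parallel>\<close>. The first term is made small by the choice of \<open>\<eta>\<close>, the second
by the size of \<open>h\<close>, because \<open>p > 1\<close>.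
\<close>

lemma solution_map_derivative:
  assumes \<phi>: "\<phi> \<in> H10 \<Omega>"
  shows "H10.derivative_at solution_map (T_op \<Omega> p \<phi>) \<phi>"
proof -
  let ?ip = "H1_inner \<Omega>" and ?nm = "H1_norm \<Omega>"
  define K T where "K = solution_map" and "T = T_op \<Omega> p \<phi>"
  note KH = solution_map_representation(1)[folded K_def] and Kip = solution_map_representation(2)[folded K_def] and Ki = solution_map_representation(3)
  note TH = T_op_representation(1)[OF \<phi>, folded T_def] and Tip = T_op_representation(2)[OF \<phi>, folded T_def] and Ti = T_op_representation(3)[OF \<phi>]
  obtain C where C: "0 \<le> C" and CC: "\<forall>a\<in>H10 \<Omega>. \<forall>b\<in>H10 \<Omega>. \<forall>c\<in>H10 \<Omega>. integrable M (triple a b c) \<and>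
     (\<integral>x. triple a b c x \<partial>M) \<le> C * (?nm a powr (p - 1) * ?nm b * ?nm c)"
    using trilinear_bound by blast
  have Ci: "integrable M (triple a b c)"
    and Cb: "(\<integral>x. triple a b c x \<partial>M) \<le> C * (?nm a powr (p - 1) * ?nm b * ?nm c)"
    if "a \<in> H10 \<Omega>" "b \<in> H10 \<Omega>" "c \<in> H10 \<Omega>" for a b c
    using CC that by blast+
  have "H10.derivative_at K T \<phi>"
    unfolding H10.derivative_at_def
  proof (intro allI impI)
    fix \<epsilon> :: real assume eps: "0 < \<epsilon>"
    define n where "n = ?nm \<phi> powr (p - 1)"
    have n0: "0 \<le> n" by (simp add: n_def)
    \<comment> \<open>With \<open>\<eta>\<close> and the \<open>\<delta>\<close> below, each error term is at most \<open>\<epsilon> / 2\<close> times \<open>\<parallel>h\<parallel> \<parallel>e\<parallel>\<close>; the added \<open>1\<close> keeps the denominators positive.\<close>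
    define \<eta> where "\<eta> = \<epsilon> / (2 * (C * n + 1))"
    have Cn: "0 < C * n + 1" using C n0 by (simp add: add_nonneg_pos)
    have half: "\<epsilon> / (2 * c) * c = \<epsilon> / 2" if "0 < c" for c :: real using that by simp
    have eta: "0 < \<eta>" using eps Cn by (simp add: \<eta>_def)
    obtain L where L: "0 \<le> L" "\<And>a h. \<bar>\<bar>a + h\<bar> powr (p - 1) * (a + h) - \<bar>a\<bar> powr (p - 1) * a - p * \<bar>a\<bar> powr (p - 1) * h\<bar>
       \<le> \<eta> * (\<bar>a\<bar> powr (p - 1) * \<bar>h\<bar>) + L * (\<bar>h\<bar> powr (p - 1) * \<bar>h\<bar>)"
      using signed_power_expansion[OF p eta] by metis
    define \<delta> where "\<delta> = (\<epsilon> / (2 * (C * L + 1))) powr (1 / (p - 1))"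
    have CL: "0 < C * L + 1" using C L by (simp add: add_nonneg_pos)
    have delta: "0 < \<delta>" using eps CL by (simp add: \<delta>_def)
    have "?nm (K w - K \<phi> - T (w - \<phi>)) \<le> \<epsilon> * ?nm (w - \<phi>)" if w: "w \<in> H10 \<Omega>" and small: "?nm (w - \<phi>) < \<delta>" for w
    proof -
      define h where "h = w - \<phi>"
      have h: "h \<in> H10 \<Omega>" using w \<phi> by (simp add: h_def)
      define e where "e = K w - K \<phi> - T h"
      have e: "e \<in> H10 \<Omega>" using KH[OF w] KH[OF \<phi>] TH[OF h] by (simp add: e_def)
      have wh: "AE x in M. rep_aefun w x = rep_aefun \<phi> x + rep_aefun h x"
        using AE_M[OF rep_aefun_add[of \<phi> h]] by (simp add: h_def)
      have i1: "integrable M (triple \<phi> h e)"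
        and i2: "integrable M (triple h h e)"
        using Ci[OF \<phi> h e] Ci[OF h h e] by auto
      have "?ip e e = ?ip (K w) e - ?ip (K \<phi>) e - ?ip (T h) e"
        using KH[OF w] KH[OF \<phi>] TH[OF h] e unfolding e_def[symmetric]
        by (subst (1) e_def) (simp add: H10.ip_simps)
      also have "\<dots> = (\<integral>x. power_nl p w x * rep_aefun e x - power_nl p \<phi> x * rep_aefun e x - weight \<phi> x * rep_aefun h x * rep_aefun e x \<partial>M)"
        using Ki[OF w e] Ki[OF \<phi> e] Ti[OF h e] by (simp add: Kip[OF w e] Kip[OF \<phi> e] Tip[OF h e])
      also have "\<dots> \<le> (\<integral>x. \<eta> * triple \<phi> h e x
          + L * triple h h e x \<partial>M)"
      proof (rule integral_mono_AE)
        show "integrable M (\<lambda>x. power_nl p w x * rep_aefun e x - power_nl p \<phi> x * rep_aefun e x - weight \<phi> x * rep_aefun h x * rep_aefun e x)"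
          using Ki[OF w e] Ki[OF \<phi> e] Ti[OF h e] by auto
        show "integrable M (\<lambda>x. \<eta> * triple \<phi> h e x
          + L * triple h h e x)"
          using i1 i2 by auto
        show "AE x in M. power_nl p w x * rep_aefun e x - power_nl p \<phi> x * rep_aefun e x - weight \<phi> x * rep_aefun h x * rep_aefun e x
          \<le> \<eta> * triple \<phi> h e x
          + L * triple h h e x"
          using wh
        proof eventually_elim
          case (elim x)
          define \<alpha> \<beta> where "\<alpha> = rep_aefun \<phi> x" and "\<beta> = rep_aefun h x"
          define R where "R = \<bar>\<alpha> + \<beta>\<bar> powr (p - 1) * (\<alpha> + \<beta>) - \<bar>\<alpha>\<bar> powr (p - 1) * \<alpha> - p * \<bar>\<alpha>\<bar> powr (p - 1) * \<beta>"
          have "power_nl p w x * rep_aefun e x - power_nl p \<phi> x * rep_aefun e x - weight \<phi> x * rep_aefun h x * rep_aefun e x = R * rep_aefun e x"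
            by (simp add: power_nl_def weight_def elim R_def \<alpha>_def \<beta>_def algebra_simps)
          also have "\<dots> \<le> \<bar>R\<bar> * \<bar>rep_aefun e x\<bar>" using abs_ge_self[of "R * rep_aefun e x"] by (simp add: abs_mult)
          also have "\<dots> \<le> (\<eta> * (\<bar>\<alpha>\<bar> powr (p - 1) * \<bar>\<beta>\<bar>) + L * (\<bar>\<beta>\<bar> powr (p - 1) * \<bar>\<beta>\<bar>)) * \<bar>rep_aefun e x\<bar>"
            unfolding R_def by (intro mult_right_mono L(2)) auto
          finally show ?case by (simp add: \<alpha>_def \<beta>_def triple_def algebra_simps)
        qed
      qed
      also have "\<dots> = \<eta> * (\<integral>x. triple \<phi> h e x \<partial>M)
          + L * (\<integral>x. triple h h e x \<partial>M)"
        using i1 i2 by simp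
      also have "\<dots> \<le> \<eta> * (C * (n * ?nm h * ?nm e)) + L * (C * (?nm h powr (p - 1) * ?nm h * ?nm e))"
        using Cb[OF \<phi> h e] Cb[OF h h e] eta L by (intro add_mono mult_left_mono) (auto simp: n_def)
      also have "\<dots> = (\<eta> * (C * n) + L * C * ?nm h powr (p - 1)) * (?nm h * ?nm e)" by (simp add: algebra_simps)
      also have "\<dots> \<le> \<epsilon> * (?nm h * ?nm e)"
      proof (rule mult_right_mono)
        have "\<eta> * (C * n) \<le> \<eta> * (C * n + 1)" using eta by simp
        also have "\<dots> = \<epsilon> / 2" unfolding \<eta>_def by (rule half[OF Cn])
        finally have 1: "\<eta> * (C * n) \<le> \<epsilon> / 2" .
        have "?nm h powr (p - 1) \<le> \<delta> powr (p - 1)"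
          using small p h by (intro powr_mono2) (auto simp: h_def[symmetric])
        also have "\<dots> = \<epsilon> / (2 * (C * L + 1))" using p eps CL by (simp add: \<delta>_def powr_powr)
        finally have "L * C * ?nm h powr (p - 1) \<le> L * C * (\<epsilon> / (2 * (C * L + 1)))"
          using L C by (intro mult_left_mono) auto
        also have "\<dots> \<le> (C * L + 1) * (\<epsilon> / (2 * (C * L + 1)))"
          using eps CL by (intro mult_right_mono) (auto simp: mult.commute)
        also have "\<dots> = \<epsilon> / 2" by (subst mult.commute) (rule half[OF CL])
        finally show "\<eta> * (C * n) + L * C * ?nm h powr (p - 1) \<le> \<epsilon>" using 1 by simp
      qed (use h e in auto)
      finally have le: "?nm e * ?nm e \<le> (\<epsilon> * ?nm h) * ?nm e"
        using H10.nm_square[OF e] by (simp add: power2_eq_square mult.assoc)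
      have "?nm e \<le> \<epsilon> * ?nm h"
      proof (cases "?nm e = 0")
        case True
        then show ?thesis using eps h by simp
      next
        case False
        then have "0 < ?nm e" using H10.nm_nonneg[OF e] by linarith
        then show ?thesis using le by simp
      qed
      then show ?thesis by (simp add: e_def h_def)
    qed
    then show "\<exists>\<delta>>0. \<forall>u\<in>H10 \<Omega>. ?nm (u - \<phi>) < \<delta> \<longrightarrow> ?nm (K u - K \<phi> - T (u - \<phi>)) \<le> \<epsilon> * ?nm (u - \<phi>)"
      using delta by blast
  qed
  then show ?thesis by (simp add: K_def T_def)
qed

section \<open>Convergence of the iteration\<close>

lemma convergence_from_spectral_gap:
  assumes \<gamma>: "\<gamma> = p / (p - 1)"
    and u0: "u 0 \<in> H10 \<Omega>" and u: "\<And>n. u (Suc n) = A_map \<Omega> p \<gamma> (u n)"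
    and \<phi>: "\<phi> \<in> H10 \<Omega>" "\<phi> \<noteq> 0" and sol: "weak_solution \<Omega> p \<phi>"
    and sub: "(\<lambda>k. H1_norm \<Omega> (u (r k) - \<phi>)) \<longlonglongrightarrow> 0"
    and spec: "spectrum_H10 \<Omega> (T_op \<Omega> p \<phi>) - {..<1} = {p}"
    and mult: "algebraic_multiplicity \<Omega> (T_op \<Omega> p \<phi>) p = 1"
  shows "(\<lambda>n. H1_norm \<Omega> (u n - \<phi>)) \<longlonglongrightarrow> 0"
proof -
  let ?ip = "H1_inner \<Omega>" and ?nm = "H1_norm \<Omega>"
  define K T where "K = solution_map" and "T = T_op \<Omega> p \<phi>"
  note KH = solution_map_representation(1)[folded K_def] and Kip = solution_map_representation(2)[folded K_def]
  note TH = T_op_representation(1)[OF \<phi>(1), folded T_def] and Tsa = T_op_self_adjoint(1)[OF \<phi>(1), folded T_def]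
  note K\<phi> = weak_solution_fixed_point(1)[OF sol, folded K_def]
    and T\<phi> = weak_solution_fixed_point(2)[OF sol, folded T_def]
  have KT: "H10.derivative_at K T \<phi>"
    unfolding K_def T_def by (rule solution_map_derivative[OF \<phi>(1)])
  have reg: "H10.bounded_below_at T \<mu>" if mu: "1 \<le> \<mu>" "\<mu> \<noteq> p" for \<mu>
  proof (rule bounded_below_off_spectrum[OF TH])
    show "\<mu> \<notin> spectrum_H10 \<Omega> T"
    proof
      assume "\<mu> \<in> spectrum_H10 \<Omega> T"
      then have "\<mu> \<in> spectrum_H10 \<Omega> T - {..<1}" using mu(1) by simp
      then have "\<mu> \<in> {p}" unfolding T_def spec .
      then show False using mu(2) by simp
    qed
  qed
  note ker = simple_eigenspace_orthogonal[OF mult[folded T_def] \<phi> T\<phi>]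
  have gap: "\<exists>\<rho>. 0 \<le> \<rho> \<and> \<rho> < 1 \<and>
      (\<forall>x\<in>H10 \<Omega>. ?nm (T x - (p * ?ip x \<phi> / ?ip \<phi> \<phi>) *\<^sub>R \<phi>) \<le> \<rho> * ?nm x)"
    by (rule H10.deflated_operator_contraction[OF T_op_self_adjoint[OF \<phi>(1), folded T_def] \<phi> T\<phi> p reg ker])
  then obtain \<rho> where \<rho>: "0 \<le> \<rho>" "\<rho> < 1"
    "\<And>x. x \<in> H10 \<Omega> \<Longrightarrow> ?nm (T x - (p * ?ip x \<phi> / ?ip \<phi> \<phi>) *\<^sub>R \<phi>) \<le> \<rho> * ?nm x"
    using gap by auto
  define A where "A = (\<lambda>w. (?ip w w / ?ip (K w) w) powr \<gamma> *\<^sub>R K w)"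
  have A_eq: "A_map \<Omega> p \<gamma> w = A w" if w: "w \<in> H10 \<Omega>" for w
    using Kip[OF w w] w by (simp add: A_map_def A_def M_quot_def L_op_def L2_functional_def K_def solution_map_def)
  have DA: "H10.derivative_at A (\<lambda>x. T x - (p * ?ip x \<phi> / ?ip \<phi> \<phi>) *\<^sub>R \<phi>) \<phi>"
    unfolding A_def by (rule H10.normalized_iteration_derivative[OF KH K\<phi> \<phi> Tsa T\<phi> KT p \<gamma>])
  have AH: "A w \<in> H10 \<Omega>" if "w \<in> H10 \<Omega>" for w using KH[OF that] by (simp add: A_def)
  have uH: "u n \<in> H10 \<Omega>" for n
    by (induction n) (auto simp: u0 u A_eq AH)
  have A\<phi>: "A \<phi> = \<phi>" using H10.ip_pos[OF \<phi>] by (simp add: A_def K\<phi>)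
  show ?thesis
    by (rule H10.contracting_derivative_imp_convergence[OF \<phi>(1) A\<phi> AH DA _ \<rho>(2,1,3) u0 _ sub])
      (use TH \<phi> u uH A_eq in auto)
qed

end

theorem corollary1p3:
  fixes \<Omega> :: "'a::euclidean_space set"
    and p \<gamma> :: real
    and u :: "nat \<Rightarrow> 'a aefun"
    and \<phi> :: "'a aefun"
    and r :: "nat \<Rightarrow> nat"
  assumes "\<Omega> \<noteq> {}" and "open \<Omega>" and "bounded \<Omega>" and "convex \<Omega>"
    and "1 < p"
    and "DIM('a) \<ge> 3 \<Longrightarrow> p < (real DIM('a) + 2) / (real DIM('a) - 2)"
    and "\<gamma> = p / (p - 1)"
    and "u 0 \<in> H10 \<Omega>" and "u 0 \<noteq> 0"
    and "\<And>n. u (Suc n) = A_map \<Omega> p \<gamma> (u n)"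
    and "\<phi> \<in> H10 \<Omega>" and "\<phi> \<noteq> 0" and "weak_solution \<Omega> p \<phi>"
    and "strict_mono r"
    and "(\<lambda>k. H1_norm \<Omega> (u (r k) - \<phi>)) \<longlonglongrightarrow> 0"
    and "spectrum_H10 \<Omega> (T_op \<Omega> p \<phi>) - {..<1} = {p}"
    and "algebraic_multiplicity \<Omega> (T_op \<Omega> p \<phi>) p = 1"
  shows "(\<lambda>n. H1_norm \<Omega> (u n - \<phi>)) \<longlonglongrightarrow> 0"
proof -
  have sub: "real DIM('a) * (1/2 - 1/(p + 1)) < 1"
  proof (cases "DIM('a) \<ge> 3")
    case True
    have "p * (real DIM('a) - 2) < real DIM('a) + 2"
      using assms(6)[OF True] True by (simp add: pos_less_divide_eq)
    then show ?thesis using \<open>1 < p\<close> by (simp add: field_simps)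
  next
    case False
    then have "real DIM('a) * (1/2 - 1/(p + 1)) \<le> 2 * (1/2 - 1/(p + 1))"
      using \<open>1 < p\<close> by (intro mult_right_mono) (auto simp: field_simps)
    also have "\<dots> < 1" using \<open>1 < p\<close> by simp
    finally show ?thesis .
  qed
  interpret subcritical_problem \<Omega> p by standard (rule assms(2,3,5) sub)+
  show ?thesis by (rule convergence_from_spectral_gap[OF assms(7,8,10,11,12,13,15,16,17)])
qed

end
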